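(* Consider $\min\{c^Tx: Ax=b, x\ge0\}$ and its dual $\max\{b^Ty: A^Ty+s=c, s\ge0\}$ for the node-arc incidence matrix $A$ of a directed graph with $n$ nodes and $m$ arcs. Given interior primal and dual points ($x>0$, $Ax=b$; $s>0$, $A^Ty+s=c$) with potential $P(x,s)=P_0$, there is a combinatorial algorithm that outputs interior primal and dual solutions $x$ and $y,s$ with $x^Ts<1$ in time $O\big(P_0\cdot \mathrm{CEF}(n,m,1/(16q^2))\big)$, where $q=m+\min\{k\in\mathbb{Z}: k^2\ge m\}$.
   Context: Potential: $P(x,s)=q\ln(x^Ts)-\sum_a\ln(x_as_a)-m\ln m$. Electrical flows: for resistances $r\in\mathbb{Q}^m_{\ge0}$, $R=\operatorname{diag}(r)$, $\|v\|_R=\sqrt{v^TRv}$, and current sources $\chi\in\mathbb{Q}^n$ with $\mathbf{1}^T\chi=0$, the electrical flow $f^*$ is the minimizer of $\|f\|_R^2$ subject to $Af=\chi$; an $\varepsilon$-electrical flow is $f$ with $Af=\chi$ and $\|f\|_R^2\le(1+\varepsilon)\|f^*\|_R^2$. The dual problem is $\max\{2\pi^T\chi-\pi^TAR^{-1}A^T\pi\}$ with optimum $\pi^*$. A certifying $\varepsilon$-electrical flow algorithm computes an $\varepsilon$-electrical flow $f$ and voltages $\pi\in\mathbb{Q}^n$ with $\|\pi-\pi^*\|^2_{AR^{-1}A^T}\le\varepsilon\|\pi^*\|^2_{AR^{-1}A^T}$ (where $\|v\|_M^2=v^TMv$). $\mathrm{CEF}(n,m,\varepsilon)$ is a bound on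 the running time of a certifying $\varepsilon$-electrical flow algorithm on directed graphs with $n$ nodes and $m$ arcs. Combinatorial means using only rational arithmetic (addition, subtraction, multiplication, division) and comparisons.
   Formalization: The time bound is O(max{1,P₀}·CEF(n,m,1/(16q²))), since O(P₀·CEF) fails for P₀ near or below 0 (e.g. m=1, xs=1); the minimum in q is over nonnegative k, as none exists over all integers; and m ≥ 1, since 1/(16q²) is undefined for m=0. *)

theory Defs
  imports Complex_Main "Jordan_Normal_Form.Matrix" "Graph_Theory.Digraph"
begin

section \<open>Combinatorial algorithms\<close>

text \<open>
  A combinatorial algorithm is a program of a while language whose memory consists of arrays of
  rationals (array name, index). Numbers are only combined by the four rational operations and
  compared. Every operation, memory access, constant and command costs one time unit, whatever the
  size of the numbers involved.
\<close>

type_synonym store = "nat \<Rightarrow> nat \<Rightarrow> rat"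

datatype exp =
    Num rat
  | Cell nat exp
  | Add exp exp
  | Sub exp exp
  | Mul exp exp
  | Div exp exp

text \<open>
  An index that is not a natural number and a division by zero are errors, with no value. In
  particular, addressing an array cannot be used to round a number or to test it for being integral.
\<close>

fun eval :: "exp \<Rightarrow> store \<Rightarrow> rat option" where
  "eval (Num q) \<sigma> = Some q"
| "eval (Cell a e) \<sigma> =
     (case eval e \<sigma> of
        None \<Rightarrow> None
      | Some v \<Rightarrow> if v \<in> \<nat> then Some (\<sigma> a (nat \<lfloor>v\<rfloor>)) else None)"
| "eval (Add e1 e2) \<sigma> =
     (case (eval e1 \<sigma>, eval e2 \<sigma>) of (Some v, Some w) \<Rightarrow> Some (v + w) | _ \<Rightarrow> None)"
| "eval (Sub e1 e2) \<sigma> =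
     (case (eval e1 \<sigma>, eval e2 \<sigma>) of (Some v, Some w) \<Rightarrow> Some (v - w) | _ \<Rightarrow> None)"
| "eval (Mul e1 e2) \<sigma> =
     (case (eval e1 \<sigma>, eval e2 \<sigma>) of (Some v, Some w) \<Rightarrow> Some (v * w) | _ \<Rightarrow> None)"
| "eval (Div e1 e2) \<sigma> =
     (case (eval e1 \<sigma>, eval e2 \<sigma>) of
        (Some v, Some w) \<Rightarrow> if w = 0 then None else Some (v / w)
      | _ \<Rightarrow> None)"

fun cost :: "exp \<Rightarrow> nat" where
  "cost (Num q) = 1"
| "cost (Cell a e) = 1 + cost e"
| "cost (Add e1 e2) = 1 + cost e1 + cost e2"
| "cost (Sub e1 e2) = 1 + cost e1 + cost e2"
| "cost (Mul e1 e2) = 1 + cost e1 + cost e2"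
| "cost (Div e1 e2) = 1 + cost e1 + cost e2"

text \<open>
  \<open>Assign a i e\<close> is \<open>a[i] := e\<close>, and \<open>New a\<close> binds the name \<open>a\<close> to a freshly allocated array, which
  is zero as all unused memory is. The conditional and the loop test \<open>e1 < e2\<close>; the other
  comparisons are obtained by exchanging the operands or the branches.
\<close>

datatype com =
    Skip
  | Assign nat exp exp
  | New nat
  | Seq com com
  | IfLess exp exp com com
  | WhileLess exp exp com

inductive exec :: "com \<Rightarrow> store \<Rightarrow> nat \<Rightarrow> store \<Rightarrow> bool" where
  Skip: "exec Skip \<sigma> 1 \<sigma>"
| Assign: "\<lbrakk>eval i \<sigma> = Some (of_nat k); eval e \<sigma> = Some v\<rbrakk>
    \<Longrightarrow> exec (Assign a i e) \<sigma> (1 + cost i + cost e) (\<sigma>(a := (\<sigma> a)(k := v)))"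
| New: "exec (New a) \<sigma> 1 (\<sigma>(a := (\<lambda>_. 0)))"
| Seq: "\<lbrakk>exec c1 \<sigma>1 t1 \<sigma>2; exec c2 \<sigma>2 t2 \<sigma>3\<rbrakk> \<Longrightarrow> exec (Seq c1 c2) \<sigma>1 (t1 + t2) \<sigma>3"
| IfTrue: "\<lbrakk>eval e1 \<sigma> = Some v; eval e2 \<sigma> = Some w; v < w; exec c1 \<sigma> t \<sigma>'\<rbrakk>
    \<Longrightarrow> exec (IfLess e1 e2 c1 c2) \<sigma> (1 + cost e1 + cost e2 + t) \<sigma>'"
| IfFalse: "\<lbrakk>eval e1 \<sigma> = Some v; eval e2 \<sigma> = Some w; \<not> v < w; exec c2 \<sigma> t \<sigma>'\<rbrakk>
    \<Longrightarrow> exec (IfLess e1 e2 c1 c2) \<sigma> (1 + cost e1 + cost e2 + t) \<sigma>'"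
| WhileFalse: "\<lbrakk>eval e1 \<sigma> = Some v; eval e2 \<sigma> = Some w; \<not> v < w\<rbrakk>
    \<Longrightarrow> exec (WhileLess e1 e2 c) \<sigma> (1 + cost e1 + cost e2) \<sigma>"
| WhileTrue: "\<lbrakk>eval e1 \<sigma>1 = Some v; eval e2 \<sigma>1 = Some w; v < w;
      exec c \<sigma>1 t1 \<sigma>2; exec (WhileLess e1 e2 c) \<sigma>2 t2 \<sigma>3\<rbrakk>
    \<Longrightarrow> exec (WhileLess e1 e2 c) \<sigma>1 (1 + cost e1 + cost e2 + t1 + t2) \<sigma>3"

text \<open>
  The input is loaded into array 0 of an otherwise zero memory and the output is taken from array 1.
  Loading and unloading a number also takes one time unit, so the running time is at least the size
  of the input and the output.
\<close>

definition initial_store :: "rat list \<Rightarrow> store" where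
  "initial_store ins = (\<lambda>a i. if a = 0 \<and> i < length ins then ins ! i else 0)"

definition computes_in_time :: "com \<Rightarrow> rat list \<Rightarrow> rat list \<Rightarrow> nat \<Rightarrow> bool" where
  "computes_in_time p ins outs t \<longleftrightarrow>
     (\<exists>k \<sigma>. exec p (initial_store ins) k \<sigma> \<and>
            outs = map (\<sigma> 1) [0..<length outs] \<and>
            t = k + length ins + length outs)"

section \<open>Graphs and the minimum cost flow problem\<close>

text \<open>Nodes and arcs are numbered, so that a graph can be given to a program.\<close>

definition numbered_digraph :: "nat \<Rightarrow> nat \<Rightarrow> (nat, nat) pre_digraph \<Rightarrow> bool" where
  "numbered_digraph n m G \<longleftrightarrow> fin_digraph G \<and> verts G = {..<n} \<and> arcs G = {..<m}"

definition encode_digraph :: "nat \<Rightarrow> nat \<Rightarrow> (nat, nat) pre_digraph \<Rightarrow> rat list" where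
  "encode_digraph n m G =
     [of_nat n, of_nat m] @ map (\<lambda>a. of_nat (tail G a)) [0..<m]
       @ map (\<lambda>a. of_nat (head G a)) [0..<m]"

definition incidence_mat :: "nat \<Rightarrow> nat \<Rightarrow> (nat, nat) pre_digraph \<Rightarrow> 'a::ring_1 mat" where
  "incidence_mat n m G =
     mat n m (\<lambda>(v, a). (if head G a = v then 1 else 0) - (if tail G a = v then 1 else 0))"

definition interior_primal :: "'a::linordered_field mat \<Rightarrow> 'a vec \<Rightarrow> 'a vec \<Rightarrow> bool" where
  "interior_primal A b x \<longleftrightarrow>
     x \<in> carrier_vec (dim_col A) \<and> A *\<^sub>v x = b \<and> (\<forall>a < dim_col A. x $ a > 0)"

definition interior_dual ::
    "'a::linordered_field mat \<Rightarrow> 'a vec \<Rightarrow> 'a vec \<Rightarrow> 'a vec \<Rightarrow> bool" where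
  "interior_dual A c y s \<longleftrightarrow>
     y \<in> carrier_vec (dim_row A) \<and> s \<in> carrier_vec (dim_col A) \<and>
     A\<^sup>T *\<^sub>v y + s = c \<and> (\<forall>a < dim_col A. s $ a > 0)"

definition potential_parameter :: "nat \<Rightarrow> nat" where
  "potential_parameter m = m + (LEAST k. k\<^sup>2 \<ge> m)"

definition potential :: "nat \<Rightarrow> real vec \<Rightarrow> real vec \<Rightarrow> real" where
  "potential m x s =
     real (potential_parameter m) * ln (x \<bullet> s) - (\<Sum>a<m. ln (x $ a * s $ a)) - real m * ln (real m)"

abbreviation real_vec :: "rat vec \<Rightarrow> real vec" where
  "real_vec \<equiv> map_vec real_of_rat"

section \<open>Electrical flows\<close>

definition sq_norm_wrt :: "real mat \<Rightarrow> real vec \<Rightarrow> real" where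
  "sq_norm_wrt M v = v \<bullet> (M *\<^sub>v v)"

definition resistance_mat :: "real vec \<Rightarrow> real mat" where
  "resistance_mat r = mat_diag (dim_vec r) (\<lambda>a. r $ a)"

definition conductance_mat :: "real vec \<Rightarrow> real mat" where
  "conductance_mat r = mat_diag (dim_vec r) (\<lambda>a. inverse (r $ a))"

definition electrical_flow :: "real mat \<Rightarrow> real vec \<Rightarrow> real vec \<Rightarrow> real vec \<Rightarrow> bool" where
  "electrical_flow A r \<chi> f \<longleftrightarrow>
     f \<in> carrier_vec (dim_col A) \<and> A *\<^sub>v f = \<chi> \<and>
     (\<forall>g \<in> carrier_vec (dim_col A). A *\<^sub>v g = \<chi> \<longrightarrow>
        sq_norm_wrt (resistance_mat r) f \<le> sq_norm_wrt (resistance_mat r) g)"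

definition eps_electrical_flow ::
    "real \<Rightarrow> real mat \<Rightarrow> real vec \<Rightarrow> real vec \<Rightarrow> real vec \<Rightarrow> bool" where
  "eps_electrical_flow \<epsilon> A r \<chi> f \<longleftrightarrow>
     f \<in> carrier_vec (dim_col A) \<and> A *\<^sub>v f = \<chi> \<and>
     (\<exists>f_opt. electrical_flow A r \<chi> f_opt \<and>
        sq_norm_wrt (resistance_mat r) f \<le> (1 + \<epsilon>) * sq_norm_wrt (resistance_mat r) f_opt)"

definition weighted_laplacian :: "real mat \<Rightarrow> real vec \<Rightarrow> real mat" where
  "weighted_laplacian A r = A * conductance_mat r * A\<^sup>T"

definition dual_objective :: "real mat \<Rightarrow> real vec \<Rightarrow> real vec \<Rightarrow> real vec \<Rightarrow> real" where
  "dual_objective A r \<chi> \<pi> = 2 * (\<pi> \<bullet> \<chi>) - \<pi> \<bullet> (weighted_laplacian A r *\<^sub>v \<pi>)"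

definition optimal_voltages :: "real mat \<Rightarrow> real vec \<Rightarrow> real vec \<Rightarrow> real vec \<Rightarrow> bool" where
  "optimal_voltages A r \<chi> \<pi> \<longleftrightarrow>
     \<pi> \<in> carrier_vec (dim_row A) \<and>
     (\<forall>\<rho> \<in> carrier_vec (dim_row A). dual_objective A r \<chi> \<rho> \<le> dual_objective A r \<chi> \<pi>)"

text \<open>
  Optimal voltages are unique up to the kernel of \<open>A\<^sup>T\<close>, on which the norm below vanishes, so it does
  not matter which of them is taken.
\<close>

definition eps_voltages ::
    "real \<Rightarrow> real mat \<Rightarrow> real vec \<Rightarrow> real vec \<Rightarrow> real vec \<Rightarrow> bool" where
  "eps_voltages \<epsilon> A r \<chi> \<pi> \<longleftrightarrow>
     \<pi> \<in> carrier_vec (dim_row A) \<and>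
     (\<exists>\<pi>_opt. optimal_voltages A r \<chi> \<pi>_opt \<and>
        sq_norm_wrt (weighted_laplacian A r) (\<pi> - \<pi>_opt)
          \<le> \<epsilon> * sq_norm_wrt (weighted_laplacian A r) \<pi>_opt)"

text \<open>
  The resistances are nonzero because the dual problem involves their inverses. If the graph is not
  connected, currents that sum up to zero need not admit a flow, hence the last condition.
\<close>

definition electrical_instance ::
    "nat \<Rightarrow> nat \<Rightarrow> (nat, nat) pre_digraph \<Rightarrow> rat vec \<Rightarrow> rat vec \<Rightarrow> bool" where
  "electrical_instance n m G r \<chi> \<longleftrightarrow>
     numbered_digraph n m G \<and>
     r \<in> carrier_vec m \<and> (\<forall>a<m. r $ a > 0) \<and>
     \<chi> \<in> carrier_vec n \<and> (\<Sum>v<n. \<chi> $ v) = 0 \<and>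
     (\<exists>f \<in> carrier_vec m. incidence_mat n m G *\<^sub>v f = real_vec \<chi>)"

text \<open>
  \<open>E\<close> is a certifying electrical flow algorithm, which is given the precision \<open>\<epsilon>\<close> with the instance,
  and \<open>CEF n m \<epsilon>\<close> bounds its running time.
\<close>

definition certifying_electrical_flow_algorithm ::
    "com \<Rightarrow> (nat \<Rightarrow> nat \<Rightarrow> rat \<Rightarrow> real) \<Rightarrow> bool" where
  "certifying_electrical_flow_algorithm E CEF \<longleftrightarrow>
     (\<forall>n m G r \<chi> \<epsilon>. electrical_instance n m G r \<chi> \<and> \<epsilon> > 0 \<longrightarrow>
        (\<exists>f \<pi> t.
           computes_in_time E
             (encode_digraph n m G @ list_of_vec r @ list_of_vec \<chi> @ [\<epsilon>])
             (list_of_vec f @ list_of_vec \<pi>) t \<and>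
           eps_electrical_flow (real_of_rat \<epsilon>) (incidence_mat n m G)
             (real_vec r) (real_vec \<chi>) (real_vec f) \<and>
           eps_voltages (real_of_rat \<epsilon>) (incidence_mat n m G)
             (real_vec r) (real_vec \<chi>) (real_vec \<pi>) \<and>
           real t \<le> CEF n m \<epsilon>))"

end

theory Submission
  imports Defs
begin

text \<open>
  Let \<open>q\<close> be the potential parameter. A point \<open>x, s\<close> defines resistances \<open>r\<^sub>a = 1 / x\<^sub>a\<^sup>2\<close> and the flow
  \<open>u\<^sub>a = x\<^sub>a (q x\<^sub>a s\<^sub>a / x\<^sup>T s - 1)\<close>, the scaled gradient of the potential, whose energy is at most \<open>q\<^sup>2\<close>.
  Call the electrical flow algorithm for the currents \<open>A u\<close> and let \<open>h\<close> be the flow induced by the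
  voltages \<open>\<pi>\<close> that it returns with the flow \<open>f\<close>. The exact electrical flow is the orthogonal projection of
  \<open>u\<close> on the induced flows, so the energies of \<open>u - h\<close> and \<open>f\<close> sum up to at most \<open>1 + 2 \<epsilon>\<close> times the energy
  of \<open>u\<close>, that is, to at most \<open>1 / 8\<close> more than the energy of \<open>u\<close>. If \<open>u - h\<close> has large energy, then \<open>f\<close> has
  much less energy than \<open>u\<close>, and the circulation \<open>u - f\<close> is a direction of descent for \<open>x\<close>. Otherwise
  the slacks \<open>s - (x\<^sup>T s / q) A\<^sup>T \<pi>\<close> nearly satisfy \<open>x\<^sub>a s\<^sub>a = x\<^sup>T s / q\<close>, and moving there decreases the
  potential. Either way the decrease is at least a constant, while \<open>x\<^sup>T s \<ge> 1\<close> forces the potential to be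
  nonnegative; so there are \<open>O(P\<^sub>0)\<close> iterations. Apart from the call, an iteration takes time \<open>O(n + m)\<close>,
  which is less than the time for reading the input of the call.
\<close>

section \<open>The logarithmic potential\<close>

definition log_potential :: "real \<Rightarrow> 'a set \<Rightarrow> ('a \<Rightarrow> real) \<Rightarrow> real" where
  "log_potential q A z = q * ln (sum z A) - (\<Sum>a\<in>A. ln (z a)) - card A * ln (card A)"

lemma log_potential_add: "log_potential (q + k) A z = log_potential q A z + k * ln (sum z A)"
  by (simp add: log_potential_def algebra_simps)

lemma log_potential_cong: "(\<And>a. a \<in> A \<Longrightarrow> z a = z' a) \<Longrightarrow> log_potential q A z = log_potential q A z'"
  by (simp add: log_potential_def cong: sum.cong)

lemma log_potential_card_nonneg:
  assumes A: "finite A" "A \<noteq> {}" and pos: "\<And>a. a \<in> A \<Longrightarrow> z a > 0"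
  shows "0 \<le> log_potential (card A) A z"
proof -
  have card: "real (card A) > 0" using A by (simp add: card_gt_0_iff)
  have sum: "sum z A > 0" using A pos by (intro sum_pos) auto
  have "ln (z a) \<le> (ln (sum z A) - ln (card A)) + (card A / sum z A * z a - 1)" if "a \<in> A" for a
    using ln_le_minus_one[of "card A / sum z A * z a"] pos[OF that] card sum
    by (simp add: ln_mult ln_div)
  then have "(\<Sum>a\<in>A. ln (z a)) \<le> (\<Sum>a\<in>A. (ln (sum z A) - ln (card A)) + (card A / sum z A * z a - 1))"
    by (intro sum_mono)
  also have "\<dots> = card A * (ln (sum z A) - ln (card A)) + (card A / sum z A * sum z A - card A)"
    by (simp add: sum.distrib sum_subtractf sum_distrib_left)
  also have "\<dots> = card A * (ln (sum z A) - ln (card A))" using sum by simp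
  finally show ?thesis by (simp add: log_potential_def algebra_simps)
qed

lemma log_potential_card_scale:
  assumes A: "finite A" "A \<noteq> {}" and pos: "\<And>a. a \<in> A \<Longrightarrow> z a > 0" and "c > 0"
  shows "log_potential (card A) A (\<lambda>a. c * z a) = log_potential (card A) A z"
proof -
  have "sum z A > 0" using A pos by (intro sum_pos) auto
  then have "ln (\<Sum>a\<in>A. c * z a) = ln c + ln (sum z A)"
    using \<open>c > 0\<close> by (simp add: ln_mult flip: sum_distrib_left)
  moreover have "(\<Sum>a\<in>A. ln (c * z a)) = (\<Sum>a\<in>A. ln c + ln (z a))"
    using pos \<open>c > 0\<close> by (intro sum.cong refl ln_mult_pos) auto
  ultimately show ?thesis by (simp add: log_potential_def sum.distrib algebra_simps)
qed

lemma sum_ln_one_plus_ge: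
  fixes e :: "'a \<Rightarrow> real"
  assumes "\<And>a. a \<in> A \<Longrightarrow> \<bar>e a\<bar> \<le> 1/2"
  shows "sum e A - 2 * (\<Sum>a\<in>A. (e a)\<^sup>2) \<le> (\<Sum>a\<in>A. ln (1 + e a))"
proof -
  have "(\<Sum>a\<in>A. e a - 2 * (e a)\<^sup>2) \<le> (\<Sum>a\<in>A. ln (1 + e a))"
  proof (rule sum_mono)
    fix a assume "a \<in> A"
    show "e a - 2 * (e a)\<^sup>2 \<le> ln (1 + e a)"
      using abs_ln_one_plus_x_minus_x_bound[OF assms[OF \<open>a \<in> A\<close>]] by linarith
  qed
  then show ?thesis by (simp add: sum_subtractf sum_distrib_left)
qed

lemma log_potential_card_one_plus_le:
  assumes A: "finite A" "A \<noteq> {}" and small: "\<And>a. a \<in> A \<Longrightarrow> \<bar>e a\<bar> \<le> 1/2"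
  shows "log_potential (card A) A (\<lambda>a. 1 + e a) \<le> 2 * (\<Sum>a\<in>A. (e a)\<^sup>2)"
proof -
  have card: "real (card A) > 0" using A by (simp add: card_gt_0_iff)
  have "0 < (\<Sum>a\<in>A. 1 + e a)" using A small by (intro sum_pos) force+
  then have sum: "card A + sum e A > 0" by (simp add: sum.distrib)
  then have "ln ((card A + sum e A) / card A) \<le> sum e A / card A"
    using ln_le_minus_one[OF divide_pos_pos[OF sum card]] card by (simp add: add_divide_distrib)
  then have "card A * (ln (card A + sum e A) - ln (card A)) \<le> sum e A"
    using sum card by (simp add: ln_div field_simps)
  then show ?thesis using sum_ln_one_plus_ge[of A e, OF small]
    by (simp add: log_potential_def sum.distrib algebra_simps)
qed

definition potential_gradient :: "real \<Rightarrow> 'a set \<Rightarrow> ('a \<Rightarrow> real) \<Rightarrow> 'a \<Rightarrow> real" where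
  "potential_gradient q A z a = q * z a / sum z A - 1"

lemma sum_potential_gradient_sq_le:
  assumes A: "finite A" and pos: "\<And>a. a \<in> A \<Longrightarrow> z a > 0" and q: "card A \<le> q"
  shows "(\<Sum>a\<in>A. (potential_gradient q A z a)\<^sup>2) \<le> q\<^sup>2"
proof (cases "A = {}")
  case False
  define p where "p a = z a / sum z A" for a
  have sum: "sum z A > 0" using A False pos by (intro sum_pos) auto
  have p_nonneg: "p a \<ge> 0" if "a \<in> A" for a using pos[OF that] sum by (simp add: p_def)
  have p_sum: "sum p A = 1" using sum by (simp add: p_def flip: sum_divide_distrib)
  have "(p a)\<^sup>2 \<le> p a" if "a \<in> A" for a
    using member_le_sum[of a A p] that A p_nonneg p_sum by (simp add: power2_eq_square mult_left_le)
  then have "(\<Sum>a\<in>A. (p a)\<^sup>2) \<le> 1" unfolding p_sum[symmetric] by (rule sum_mono)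
  then have "q\<^sup>2 * (\<Sum>a\<in>A. (p a)\<^sup>2) \<le> q\<^sup>2" by (intro mult_left_le) auto
  moreover have "(\<Sum>a\<in>A. (potential_gradient q A z a)\<^sup>2) = (\<Sum>a\<in>A. q\<^sup>2 * (p a)\<^sup>2 - 2 * q * p a + 1)"
    by (intro sum.cong refl) (simp add: potential_gradient_def p_def power2_diff power_mult_distrib
      power_divide)
  moreover have "\<dots> = q\<^sup>2 * (\<Sum>a\<in>A. (p a)\<^sup>2) - 2 * q + card A"
    using p_sum by (simp add: sum.distrib sum_subtractf flip: sum_distrib_left)
  ultimately show ?thesis using q by linarith
qed simp

lemma log_potential_gradient_step_le:
  assumes A: "finite A" "A \<noteq> {}" and pos: "\<And>a. a \<in> A \<Longrightarrow> z a > 0" and "q \<ge> 0"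
    and small: "\<And>a. a \<in> A \<Longrightarrow> \<bar>e a\<bar> \<le> 1/2"
  shows "log_potential q A (\<lambda>a. z a * (1 + e a))
    \<le> log_potential q A z + (\<Sum>a\<in>A. potential_gradient q A z a * e a) + 2 * (\<Sum>a\<in>A. (e a)\<^sup>2)"
proof -
  define r where "r = (\<Sum>a\<in>A. z a * e a) / sum z A"
  have sum: "sum z A > 0" using A pos by (intro sum_pos) auto
  have factor_pos: "1 + e a > 0" if "a \<in> A" for a using small[OF that] by linarith
  have sum_eq: "(\<Sum>a\<in>A. z a * (1 + e a)) = sum z A * (1 + r)"
    using sum by (simp add: r_def distrib_left sum.distrib)
  have "(\<Sum>a\<in>A. z a * (1 + e a)) > 0" using A pos factor_pos by (intro sum_pos) auto
  then have r_pos: "1 + r > 0" using sum by (simp add: sum_eq zero_less_mult_iff)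
  then have "ln (\<Sum>a\<in>A. z a * (1 + e a)) \<le> ln (sum z A) + r"
    using ln_le_minus_one[OF r_pos] sum by (simp add: sum_eq ln_mult)
  then have "q * ln (\<Sum>a\<in>A. z a * (1 + e a)) \<le> q * ln (sum z A) + q * r"
    using \<open>q \<ge> 0\<close> by (simp add: mult_left_mono flip: distrib_left)
  moreover have "(\<Sum>a\<in>A. ln (z a * (1 + e a))) = (\<Sum>a\<in>A. ln (z a)) + (\<Sum>a\<in>A. ln (1 + e a))"
    using pos factor_pos by (simp add: ln_mult_pos flip: sum.distrib)
  moreover have "(\<Sum>a\<in>A. potential_gradient q A z a * e a) = q * r - sum e A"
    by (simp add: potential_gradient_def r_def left_diff_distrib sum_subtractf sum_divide_distrib
        sum_distrib_left mult.assoc)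
  ultimately show ?thesis using sum_ln_one_plus_ge[of A e, OF small]
    by (simp add: log_potential_def)
qed

lemma abs_le_of_sum_sq_le:
  fixes e :: "'a \<Rightarrow> real"
  assumes "finite A" "(\<Sum>a\<in>A. (e a)\<^sup>2) \<le> \<delta>\<^sup>2" "\<delta> \<ge> 0" "a \<in> A"
  shows "\<bar>e a\<bar> \<le> \<delta>"
proof (rule power2_le_imp_le)
  show "\<bar>e a\<bar>\<^sup>2 \<le> \<delta>\<^sup>2"
    using member_le_sum[of a A "\<lambda>a. (e a)\<^sup>2"] assms by simp
qed fact

lemma log_potential_short_step:
  fixes d z :: "'a \<Rightarrow> real"
  assumes A: "finite A" "A \<noteq> {}" and pos: "\<And>a. a \<in> A \<Longrightarrow> z a > 0" and q: "q \<ge> 0"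
    and t: "t = 1 / (128 * ((\<Sum>a\<in>A. (d a)\<^sup>2) + 1))"
    and descent: "((\<Sum>a\<in>A. (d a)\<^sup>2) + 1) / 128 \<le> (\<Sum>a\<in>A. potential_gradient q A z a * d a)"
  shows "\<And>a. a \<in> A \<Longrightarrow> 1 - t * d a > 0"
    and "log_potential q A (\<lambda>a. z a * (1 - t * d a)) \<le> log_potential q A z - 1 / 32768"
proof -
  define N where "N = (\<Sum>a\<in>A. (d a)\<^sup>2)"
  define e where "e a = - (t * d a)" for a
  have N: "N \<ge> 0" unfolding N_def by (intro sum_nonneg) simp
  have t_pos: "t > 0" and t_N: "t * (N + 1) = 1 / 128" using N by (auto simp: t simp flip: N_def)
  have e_sq: "(\<Sum>a\<in>A. (e a)\<^sup>2) = t\<^sup>2 * N"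
    by (simp add: e_def N_def power_mult_distrib sum_distrib_left)
  have t_sq: "t\<^sup>2 * N \<le> 1 / 65536"
  proof -
    have "4 * N \<le> (N + 1)\<^sup>2" using zero_le_power2[of "N - 1"]
      by (simp add: power2_eq_square algebra_simps)
    then have "t\<^sup>2 * (4 * N) \<le> t\<^sup>2 * (N + 1)\<^sup>2" by (rule mult_left_mono) simp
    also have "\<dots> = (1 / 128)\<^sup>2" unfolding t_N[symmetric] by (simp only: power_mult_distrib)
    finally show ?thesis by (simp add: power2_eq_square)
  qed
  have small: "\<bar>e a\<bar> \<le> 1/2" if "a \<in> A" for a
    using t_sq that by (intro abs_le_of_sum_sq_le[OF A(1)]) (simp_all add: e_sq power_divide)
  show "1 - t * d a > 0" if "a \<in> A" for a using small[OF that] by (simp add: e_def)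
  have "(\<Sum>a\<in>A. potential_gradient q A z a * e a) = - t * (\<Sum>a\<in>A. potential_gradient q A z a * d a)"
    by (simp add: e_def sum_distrib_left sum_negf mult.left_commute)
  also have "\<dots> \<le> - t * ((N + 1) / 128)"
    using descent t_pos by (intro mult_left_mono_neg) (simp_all add: N_def)
  also have "\<dots> = - 1 / 16384" using t_N by simp
  finally show "log_potential q A (\<lambda>a. z a * (1 - t * d a)) \<le> log_potential q A z - 1 / 32768"
    using log_potential_gradient_step_le[of A z q e, OF A pos q small] t_sq
    by (simp add: e_sq) (simp add: e_def)
qed

lemma sum_le_of_sum_sq_le:
  fixes e :: "'a \<Rightarrow> real" and \<delta> k :: real
  assumes sq: "(\<Sum>a\<in>A. (e a)\<^sup>2) \<le> \<delta>\<^sup>2" and card: "card A \<le> k\<^sup>2" and "\<delta> > 0" "k > 0"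
  shows "sum e A \<le> \<delta> * k"
proof -
  have "2 * e a \<le> k / \<delta> * (e a)\<^sup>2 + \<delta> / k" for a
  proof -
    have "0 \<le> (k * e a - \<delta>)\<^sup>2 / (k * \<delta>)" using assms by simp
    also have "\<dots> = k / \<delta> * (e a)\<^sup>2 + \<delta> / k - 2 * e a"
      using assms by (simp add: field_simps power2_eq_square)
    finally show ?thesis by simp
  qed
  then have "2 * sum e A \<le> (\<Sum>a\<in>A. k / \<delta> * (e a)\<^sup>2 + \<delta> / k)"
    unfolding sum_distrib_left by (intro sum_mono)
  also have "\<dots> = k / \<delta> * (\<Sum>a\<in>A. (e a)\<^sup>2) + card A * (\<delta> / k)"
    by (simp add: sum.distrib sum_distrib_left)
  also have "\<dots> \<le> k / \<delta> * \<delta>\<^sup>2 + k\<^sup>2 * (\<delta> / k)"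
    using assms by (intro add_mono mult_left_mono mult_right_mono) auto
  also have "\<dots> = 2 * (\<delta> * k)" using assms by (simp add: power2_eq_square)
  finally show ?thesis by simp
qed

lemma log_potential_centering_step_le:
  fixes k q \<delta> :: real
  assumes A: "finite A" "A \<noteq> {}" and pos: "\<And>a. a \<in> A \<Longrightarrow> z a > 0" and k: "k \<ge> 1" "card A \<le> k\<^sup>2"
    and \<delta>: "0 < \<delta>" "\<delta> \<le> 1/2" and near: "(\<Sum>a\<in>A. (e a)\<^sup>2) \<le> \<delta>\<^sup>2" and q: "q = card A + k"
  shows "log_potential q A (\<lambda>a. sum z A / q * (1 + e a))
      \<le> log_potential q A z - (1 - \<delta>) / 2 + 2 * \<delta>\<^sup>2"
proof -
  let ?z' = "\<lambda>a. sum z A / q * (1 + e a)"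
  have small: "\<bar>e a\<bar> \<le> 1/2" if "a \<in> A" for a
    using abs_le_of_sum_sq_le[OF A(1) near _ that] \<delta> by simp
  have q_pos: "q > 0" using k by (simp add: q)
  have sum: "sum z A > 0" using A pos by (intro sum_pos) auto
  have e_pos: "1 + e a > 0" if "a \<in> A" for a using small[OF that] by linarith
  have "0 < (\<Sum>a\<in>A. 1 + e a)" using A e_pos by (intro sum_pos)
  then have ratio_pos: "(card A + sum e A) / q > 0" using q_pos by (simp add: sum.distrib)
  have "(\<Sum>a\<in>A. ?z' a) = sum z A * ((card A + sum e A) / q)"
    by (simp add: sum.distrib flip: sum_distrib_left sum_divide_distrib)
  then have "ln (\<Sum>a\<in>A. ?z' a) - ln (sum z A) = ln ((card A + sum e A) / q)"
    by (simp only: ln_mult_pos[OF sum ratio_pos] add_diff_cancel_left')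
  also have "\<dots> \<le> (card A + sum e A) / q - 1" using ratio_pos by (rule ln_le_minus_one)
  also have "\<dots> = (sum e A - k) / q" using q_pos by (simp add: q field_simps)
  also have "\<dots> \<le> - ((1 - \<delta>) * k) / q"
    using sum_le_of_sum_sq_le[OF near k(2)] \<delta> k q_pos
    by (intro divide_right_mono) (auto simp: algebra_simps)
  finally have "k * (ln (\<Sum>a\<in>A. ?z' a) - ln (sum z A)) \<le> k * (- ((1 - \<delta>) * k) / q)"
    using k by (intro mult_left_mono) auto
  also have "\<dots> = - (1 - \<delta>) * (k\<^sup>2 / q)" using q_pos by (simp add: field_simps power2_eq_square)
  also have "\<dots> \<le> - (1 - \<delta>) * (1/2)"
  proof (intro mult_left_mono_neg)
    have "k \<le> k\<^sup>2" using k by (simp add: power2_eq_square)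
    then have "q \<le> 2 * k\<^sup>2" using k by (simp add: q)
    then show "1/2 \<le> k\<^sup>2 / q" using q_pos by (simp add: field_simps)
  qed (use \<delta> in simp)
  finally have "k * ln (\<Sum>a\<in>A. ?z' a) \<le> k * ln (sum z A) - (1 - \<delta>) / 2"
    unfolding right_diff_distrib by linarith
  moreover have "log_potential (card A) A ?z' \<le> 2 * \<delta>\<^sup>2"
  proof -
    have "log_potential (card A) A ?z' = log_potential (card A) A (\<lambda>a. 1 + e a)"
      using sum q_pos by (intro log_potential_card_scale A e_pos divide_pos_pos)
    also have "\<dots> \<le> 2 * (\<Sum>a\<in>A. (e a)\<^sup>2)" by (rule log_potential_card_one_plus_le[OF A small])
    finally show ?thesis using near by simp
  qed
  moreover have "0 \<le> log_potential (card A) A z" using A pos by (rule log_potential_card_nonneg)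
  ultimately show ?thesis unfolding q log_potential_add by (simp flip: q)
qed

section \<open>Energy of flows\<close>

definition energy_inner :: "'a::field vec \<Rightarrow> 'a vec \<Rightarrow> 'a vec \<Rightarrow> 'a" where
  "energy_inner r u v = (\<Sum>a<dim_vec r. r $ a * (u $ a * v $ a))"

definition energy :: "'a::field vec \<Rightarrow> 'a vec \<Rightarrow> 'a" where
  "energy r u = energy_inner r u u"

definition induced_flow :: "'a::field mat \<Rightarrow> 'a vec \<Rightarrow> 'a vec \<Rightarrow> 'a vec" where
  "induced_flow A r \<pi> = vec (dim_vec r) (\<lambda>a. (A\<^sup>T *\<^sub>v \<pi>) $ a / r $ a)"

lemma dim_induced_flow [simp]: "dim_vec (induced_flow A r \<pi>) = dim_vec r"
  by (simp add: induced_flow_def)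

lemma induced_flow_carrier [simp]: "r \<in> carrier_vec m \<Longrightarrow> induced_flow A r \<pi> \<in> carrier_vec m"
  by (auto simp: induced_flow_def)

lemma energy_nonneg:
  fixes r :: "'a::linordered_field vec"
  assumes "\<And>a. a < dim_vec r \<Longrightarrow> r $ a > 0"
  shows "0 \<le> energy r u"
  unfolding energy_def energy_inner_def
  using assms by (intro sum_nonneg mult_nonneg_nonneg[OF less_imp_le zero_le_square]) auto

lemma energy_add_smult:
  assumes "r \<in> carrier_vec m" "u \<in> carrier_vec m" "v \<in> carrier_vec m"
  shows "energy r (u + t \<cdot>\<^sub>v v) = energy r u + 2 * t * energy_inner r u v + t\<^sup>2 * energy r v"
  using assms by (simp add: energy_def energy_inner_def algebra_simps power2_eq_square sum.distrib
      sum_distrib_left)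

lemma energy_diff:
  fixes r :: "'a::field vec"
  assumes "r \<in> carrier_vec m" "u \<in> carrier_vec m" "v \<in> carrier_vec m"
  shows "energy r (u - v) = energy r u - 2 * energy_inner r u v + energy r v"
  using assms by (simp add: energy_def energy_inner_def sum_distrib_left algebra_simps
      flip: sum.distrib sum_subtractf)

lemma energy_inner_commute: "energy_inner r u v = energy_inner r v u"
  by (simp add: energy_inner_def mult.commute)

lemma energy_inner_induced_flow:
  assumes A: "A \<in> carrier_mat n m" and r: "r \<in> carrier_vec m" "\<And>a. a < m \<Longrightarrow> r $ a \<noteq> 0"
    and u: "u \<in> carrier_vec m" and \<pi>: "\<pi> \<in> carrier_vec n"
  shows "energy_inner r u (induced_flow A r \<pi>) = \<pi> \<bullet> (A *\<^sub>v u)"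
proof -
  have "energy_inner r u (induced_flow A r \<pi>) = (\<Sum>a<m. (A\<^sup>T *\<^sub>v \<pi>) $ a * u $ a)"
    unfolding energy_inner_def induced_flow_def using r by (auto intro!: sum.cong)
  also have "\<dots> = (A\<^sup>T *\<^sub>v \<pi>) \<bullet> u" using u by (simp add: scalar_prod_def lessThan_atLeast0)
  also have "\<dots> = \<pi> \<bullet> (A *\<^sub>v u)" by (rule transpose_vec_mult_scalar[OF A u \<pi>])
  finally show ?thesis .
qed

lemma induced_flow_add_smult:
  fixes A :: "'a::field mat"
  assumes A: "A \<in> carrier_mat n m" and r: "r \<in> carrier_vec m"
    and \<pi>: "\<pi> \<in> carrier_vec n" and \<rho>: "\<rho> \<in> carrier_vec n"
  shows "induced_flow A r (\<pi> + t \<cdot>\<^sub>v \<rho>) = induced_flow A r \<pi> + t \<cdot>\<^sub>v induced_flow A r \<rho>"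
proof -
  have "A\<^sup>T *\<^sub>v (\<pi> + t \<cdot>\<^sub>v \<rho>) = A\<^sup>T *\<^sub>v \<pi> + t \<cdot>\<^sub>v (A\<^sup>T *\<^sub>v \<rho>)"
    using mult_add_distrib_mat_vec[of "A\<^sup>T" m n \<pi> "t \<cdot>\<^sub>v \<rho>"] mult_mat_vec[of "A\<^sup>T" m n \<rho> t] A \<pi> \<rho>
    by simp
  then show ?thesis using A r by (auto simp: induced_flow_def add_divide_distrib)
qed

lemma induced_flow_diff:
  assumes "A \<in> carrier_mat n m" "r \<in> carrier_vec m" "\<pi> \<in> carrier_vec n" "\<rho> \<in> carrier_vec n"
  shows "induced_flow A r (\<pi> - \<rho>) = induced_flow A r \<pi> - induced_flow A r \<rho>"
  using assms mult_minus_distrib_mat_vec[of "A\<^sup>T" m n \<pi> \<rho>]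
  by (auto simp: induced_flow_def diff_divide_distrib)

lemma mat_diag_mult_vec:
  assumes "u \<in> carrier_vec m"
  shows "mat_diag m d *\<^sub>v u = vec m (\<lambda>a. d a * u $ a)"
  using assms
  by (intro eq_vecI) (auto simp: mat_diag_def scalar_prod_def if_distrib[of "\<lambda>z. z * _"]
    cong: if_cong)

lemma sq_norm_wrt_resistance_mat:
  assumes "r \<in> carrier_vec m" "u \<in> carrier_vec m"
  shows "sq_norm_wrt (resistance_mat r) u = energy r u"
  using assms
  by (auto simp: sq_norm_wrt_def resistance_mat_def mat_diag_mult_vec energy_def energy_inner_def
      scalar_prod_def lessThan_atLeast0 mult.left_commute intro!: sum.cong)

lemma weighted_laplacian_mult_vec:
  assumes A: "A \<in> carrier_mat n m" and r: "r \<in> carrier_vec m" and \<pi>: "\<pi> \<in> carrier_vec n"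
  shows "weighted_laplacian A r *\<^sub>v \<pi> = A *\<^sub>v induced_flow A r \<pi>"
proof -
  have C: "conductance_mat r \<in> carrier_mat m m" using r by (simp add: conductance_mat_def)
  have drop: "A\<^sup>T *\<^sub>v \<pi> \<in> carrier_vec m" using A \<pi> by simp
  have "weighted_laplacian A r *\<^sub>v \<pi> = (A * conductance_mat r) *\<^sub>v (A\<^sup>T *\<^sub>v \<pi>)"
    unfolding weighted_laplacian_def using A C \<pi> by (intro assoc_mult_mat_vec) auto
  also have "\<dots> = A *\<^sub>v (conductance_mat r *\<^sub>v (A\<^sup>T *\<^sub>v \<pi>))" by (rule assoc_mult_mat_vec[OF A C drop])
  also have "conductance_mat r *\<^sub>v (A\<^sup>T *\<^sub>v \<pi>) = induced_flow A r \<pi>"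
    using r mat_diag_mult_vec[OF drop]
    by (simp add: conductance_mat_def induced_flow_def field_simps)
  finally show ?thesis .
qed

lemma sq_norm_wrt_weighted_laplacian:
  assumes "A \<in> carrier_mat n m" "r \<in> carrier_vec m" "\<And>a. a < m \<Longrightarrow> r $ a \<noteq> 0" "\<pi> \<in> carrier_vec n"
  shows "sq_norm_wrt (weighted_laplacian A r) \<pi> = energy r (induced_flow A r \<pi>)"
  unfolding sq_norm_wrt_def energy_def weighted_laplacian_mult_vec[OF assms(1,2,4)]
  using energy_inner_induced_flow[OF assms(1-3) induced_flow_carrier[OF assms(2)] assms(4)] by simp

lemma quadratic_bound_imp_zero:
  fixes b c :: "'a::linordered_field"
  assumes "b \<ge> 0" "\<And>t. 2 * t * c \<le> t\<^sup>2 * b"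
  shows "c = 0"
proof (rule ccontr)
  assume "c \<noteq> 0"
  have "2 * (c / (b + 1)) * c - (c / (b + 1))\<^sup>2 * b = c\<^sup>2 * (b + 2) / (b + 1)\<^sup>2"
    using assms(1) by (simp add: divide_simps power2_eq_square) (simp add: algebra_simps)
  moreover have "\<dots> > 0" using assms(1) \<open>c \<noteq> 0\<close> by (intro divide_pos_pos mult_pos_pos) auto
  ultimately show False using assms(2)[of "c / (b + 1)"] by simp
qed

lemma scalar_prod_self_eq_0D:
  fixes v :: "'a::linordered_idom vec"
  assumes "v \<bullet> v = 0"
  shows "v = 0\<^sub>v (dim_vec v)"
  using assms by (intro eq_vecI) (auto simp: scalar_prod_def sum_nonneg_eq_0_iff)

lemma optimal_voltages_induced_flow:
  assumes A: "A \<in> carrier_mat n m" and r: "r \<in> carrier_vec m" "\<And>a. a < m \<Longrightarrow> r $ a > 0"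
    and \<chi>: "\<chi> \<in> carrier_vec n" and opt: "optimal_voltages A r \<chi> \<pi>"
  shows "A *\<^sub>v induced_flow A r \<pi> = \<chi>"
proof -
  define h where "h = induced_flow A r \<pi>"
  define z where "z = \<chi> - A *\<^sub>v h"
  have \<pi>: "\<pi> \<in> carrier_vec n" using opt A by (simp add: optimal_voltages_def)
  have r_nz: "r $ a \<noteq> 0" if "a < m" for a using r(2)[OF that] by simp
  have h: "h \<in> carrier_vec m" using r(1) by (simp add: h_def)
  have Ah: "A *\<^sub>v h \<in> carrier_vec n" using A h by simp
  have z: "z \<in> carrier_vec n" using \<chi> Ah by (simp add: z_def)
  have objective: "dual_objective A r \<chi> \<rho> = 2 * (\<rho> \<bullet> \<chi>) - energy r (induced_flow A r \<rho>)"
    if "\<rho> \<in> carrier_vec n" for \<rho>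
    using sq_norm_wrt_weighted_laplacian[OF A r(1) r_nz that]
    by (simp add: dual_objective_def sq_norm_wrt_def)
  have "2 * t * (z \<bullet> z) \<le> t\<^sup>2 * energy r (induced_flow A r z)" for t
  proof -
    have \<pi>t: "\<pi> + t \<cdot>\<^sub>v z \<in> carrier_vec n" using \<pi> z by simp
    have "dual_objective A r \<chi> (\<pi> + t \<cdot>\<^sub>v z) \<le> dual_objective A r \<chi> \<pi>"
      using opt \<pi>t A by (simp add: optimal_voltages_def)
    then have "2 * t * (z \<bullet> \<chi>) \<le> 2 * t * energy_inner r h (induced_flow A r z)
        + t\<^sup>2 * energy r (induced_flow A r z)"
      unfolding objective[OF \<pi>t] objective[OF \<pi>] induced_flow_add_smult[OF A r(1) \<pi> z] h_def
      using energy_add_smult[of r m "induced_flow A r \<pi>" "induced_flow A r z" t] r(1) \<pi> z \<chi>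
      by (simp add: add_scalar_prod_distrib[of _ n])
    also have "energy_inner r h (induced_flow A r z) = z \<bullet> (A *\<^sub>v h)"
      by (rule energy_inner_induced_flow[OF A r(1) r_nz h z])
    also have "z \<bullet> (A *\<^sub>v h) = z \<bullet> \<chi> - z \<bullet> z"
      using scalar_prod_minus_distrib[OF z \<chi> Ah] by (simp add: z_def)
    finally show ?thesis by (simp add: algebra_simps)
  qed
  then have "z \<bullet> z = 0"
    using energy_nonneg[of r "induced_flow A r z"] r
    by (intro quadratic_bound_imp_zero[of "energy r (induced_flow A r z)"]) auto
  then have "z = 0\<^sub>v n" using scalar_prod_self_eq_0D z by fastforce
  then have "\<chi> = A *\<^sub>v h" using \<chi> Ah by (auto simp: z_def vec_eq_iff)
  then show ?thesis by (simp add: h_def)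
qed

lemma optimal_voltages_projection:
  assumes A: "A \<in> carrier_mat n m" and r: "r \<in> carrier_vec m" "\<And>a. a < m \<Longrightarrow> r $ a > 0"
    and u: "u \<in> carrier_vec m" and opt: "optimal_voltages A r (A *\<^sub>v u) \<pi>" and \<rho>: "\<rho> \<in> carrier_vec n"
  shows "energy_inner r u (induced_flow A r \<rho>)
      = energy_inner r (induced_flow A r \<pi>) (induced_flow A r \<rho>)"
proof -
  have r_nz: "r $ a \<noteq> 0" if "a < m" for a using r(2)[OF that] by simp
  have "A *\<^sub>v induced_flow A r \<pi> = A *\<^sub>v u"
    by (rule optimal_voltages_induced_flow[OF A r mult_mat_vec_carrier[OF A u] opt])
  then show ?thesis
    using energy_inner_induced_flow[OF A r(1) r_nz _ \<rho>] u r(1) by simp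
qed

lemma eps_electrical_flow_energy_le:
  assumes A: "A \<in> carrier_mat n m" and r: "r \<in> carrier_vec m" and "\<epsilon> \<ge> 0"
    and flow: "eps_electrical_flow \<epsilon> A r \<chi> f" and h: "h \<in> carrier_vec m" "A *\<^sub>v h = \<chi>"
  shows "energy r f \<le> (1 + \<epsilon>) * energy r h"
proof -
  from flow obtain f_opt where f_opt: "electrical_flow A r \<chi> f_opt"
    and near: "sq_norm_wrt (resistance_mat r) f \<le> (1 + \<epsilon>) * sq_norm_wrt (resistance_mat r) f_opt"
    by (auto simp: eps_electrical_flow_def)
  have f: "f \<in> carrier_vec m" "f_opt \<in> carrier_vec m"
    using flow f_opt A by (auto simp: eps_electrical_flow_def electrical_flow_def)
  have "energy r f_opt \<le> energy r h"
    using f_opt A h sq_norm_wrt_resistance_mat[OF r f(2)] sq_norm_wrt_resistance_mat[OF r h(1)]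
    by (auto simp: electrical_flow_def)
  then have "(1 + \<epsilon>) * energy r f_opt \<le> (1 + \<epsilon>) * energy r h"
    using \<open>\<epsilon> \<ge> 0\<close> by (intro mult_left_mono) auto
  then show ?thesis using near f sq_norm_wrt_resistance_mat[OF r] by simp
qed

lemma eps_voltages_induced_flow:
  assumes A: "A \<in> carrier_mat n m" and r: "r \<in> carrier_vec m" "\<And>a. a < m \<Longrightarrow> r $ a > 0"
    and voltages: "eps_voltages \<epsilon> A r \<chi> \<pi>"
  obtains \<pi>_opt where "optimal_voltages A r \<chi> \<pi>_opt"
    and "energy r (induced_flow A r \<pi> - induced_flow A r \<pi>_opt)
        \<le> \<epsilon> * energy r (induced_flow A r \<pi>_opt)"
proof -
  from voltages obtain \<pi>_opt where opt: "optimal_voltages A r \<chi> \<pi>_opt"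
    and near: "sq_norm_wrt (weighted_laplacian A r) (\<pi> - \<pi>_opt)
      \<le> \<epsilon> * sq_norm_wrt (weighted_laplacian A r) \<pi>_opt"
    by (auto simp: eps_voltages_def)
  have \<pi>: "\<pi> \<in> carrier_vec n" "\<pi>_opt \<in> carrier_vec n"
    using voltages opt A by (auto simp: eps_voltages_def optimal_voltages_def)
  have r_nz: "r $ a \<noteq> 0" if "a < m" for a using r(2)[OF that] by simp
  show thesis
    using that[OF opt] near sq_norm_wrt_weighted_laplacian[OF A r(1) r_nz minus_carrier_vec[OF \<pi>]]
      sq_norm_wrt_weighted_laplacian[OF A r(1) r_nz \<pi>(2)] induced_flow_diff[OF A r(1) \<pi>] by simp
qed

lemma approximate_electrical_energy_le:
  assumes A: "A \<in> carrier_mat n m" and r: "r \<in> carrier_vec m" "\<And>a. a < m \<Longrightarrow> r $ a > 0"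
    and u: "u \<in> carrier_vec m" and \<epsilon>: "\<epsilon> \<ge> 0"
    and flow: "eps_electrical_flow \<epsilon> A r (A *\<^sub>v u) f" and voltages: "eps_voltages \<epsilon> A r (A *\<^sub>v u) \<pi>"
  shows "energy r (u - induced_flow A r \<pi>) + energy r f \<le> (1 + 2 * \<epsilon>) * energy r u"
proof -
  obtain \<pi>_opt where opt: "optimal_voltages A r (A *\<^sub>v u) \<pi>_opt"
    and near: "energy r (induced_flow A r \<pi> - induced_flow A r \<pi>_opt)
        \<le> \<epsilon> * energy r (induced_flow A r \<pi>_opt)"
    by (rule eps_voltages_induced_flow[OF A r voltages])
  define h where "h = induced_flow A r \<pi>_opt"
  define h' where "h' = induced_flow A r \<pi>"
  have \<pi>: "\<pi> \<in> carrier_vec n" "\<pi>_opt \<in> carrier_vec n"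
    using voltages opt A by (auto simp: eps_voltages_def optimal_voltages_def)
  have h: "h \<in> carrier_vec m" "h' \<in> carrier_vec m" using r(1) by (simp_all add: h_def h'_def)
  have projection: "energy_inner r u (induced_flow A r \<rho>) = energy_inner r h (induced_flow A r \<rho>)"
    if "\<rho> \<in> carrier_vec n" for \<rho>
    unfolding h_def by (rule optimal_voltages_projection[OF A r u opt that])
  have "A *\<^sub>v h = A *\<^sub>v u"
    unfolding h_def by (rule optimal_voltages_induced_flow[OF A r mult_mat_vec_carrier[OF A u] opt])
  then have "energy r f \<le> (1 + \<epsilon>) * energy r h"
    by (rule eps_electrical_flow_energy_le[OF A r(1) \<epsilon> flow h(1)])
  moreover have "energy r (u - h') = energy r u - energy r h + energy r (h' - h)"
    using projection[OF \<pi>(1)] energy_diff[OF r(1) u h(2)] energy_diff[OF r(1) h(2,1)]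
    by (simp add: h_def h'_def energy_inner_commute)
  moreover have "\<epsilon> * energy r h \<le> \<epsilon> * energy r u"
  proof (intro mult_left_mono)
    have "energy_inner r u h = energy r h" using projection[OF \<pi>(2)] by (simp add: h_def energy_def)
    then show "energy r h \<le> energy r u"
      using energy_nonneg[of r "u - h"] r energy_diff[OF r(1) u h(1)] by simp
  qed fact
  ultimately show ?thesis using near by (simp add: h_def h'_def algebra_simps)
qed

section \<open>One potential reduction step\<close>

lemma interior_primal_diff_circulation:
  fixes A :: "'a::linordered_field mat"
  assumes A: "A \<in> carrier_mat n m" and x: "interior_primal A b x"
    and u: "u \<in> carrier_vec m" and v: "v \<in> carrier_vec m" and eq: "A *\<^sub>v v = A *\<^sub>v u"
    and pos: "\<And>a. a < m \<Longrightarrow> (x - t \<cdot>\<^sub>v (u - v)) $ a > 0"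
  shows "interior_primal A b (x - t \<cdot>\<^sub>v (u - v))"
proof -
  have xm: "x \<in> carrier_vec m" and Ax: "A *\<^sub>v x = b" using x A by (auto simp: interior_primal_def)
  have "A *\<^sub>v (u - v) = 0\<^sub>v n"
    using A u mult_minus_distrib_mat_vec[OF A u v] mult_mat_vec_carrier[OF A u] by (simp add: eq)
  then have "A *\<^sub>v (t \<cdot>\<^sub>v (u - v)) = 0\<^sub>v n"
    using u v mult_mat_vec[OF A, of "u - v" t] by auto
  then have "A *\<^sub>v (x - t \<cdot>\<^sub>v (u - v)) = b"
    using mult_minus_distrib_mat_vec[OF A xm, of "t \<cdot>\<^sub>v (u - v)"] u v mult_mat_vec_carrier[OF A xm]
      Ax by simp
  then show ?thesis using A xm u v pos by (auto simp: interior_primal_def)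
qed

lemma interior_dual_add_voltages:
  fixes A :: "'a::linordered_field mat"
  assumes A: "A \<in> carrier_mat n m" and s: "interior_dual A c y s" and \<pi>: "\<pi> \<in> carrier_vec n"
    and pos: "\<And>a. a < m \<Longrightarrow> (s - t \<cdot>\<^sub>v (A\<^sup>T *\<^sub>v \<pi>)) $ a > 0"
  shows "interior_dual A c (y + t \<cdot>\<^sub>v \<pi>) (s - t \<cdot>\<^sub>v (A\<^sup>T *\<^sub>v \<pi>))"
proof -
  have y: "y \<in> carrier_vec n" and sm: "s \<in> carrier_vec m" and c: "A\<^sup>T *\<^sub>v y + s = c"
    using s A by (auto simp: interior_dual_def)
  have "A\<^sup>T *\<^sub>v (y + t \<cdot>\<^sub>v \<pi>) = A\<^sup>T *\<^sub>v y + t \<cdot>\<^sub>v (A\<^sup>T *\<^sub>v \<pi>)"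
    using mult_add_distrib_mat_vec[of "A\<^sup>T" m n y "t \<cdot>\<^sub>v \<pi>"] mult_mat_vec[of "A\<^sup>T" m n \<pi> t] A y \<pi>
    by simp
  then have "A\<^sup>T *\<^sub>v (y + t \<cdot>\<^sub>v \<pi>) + (s - t \<cdot>\<^sub>v (A\<^sup>T *\<^sub>v \<pi>)) = c"
    using c A sm by auto
  then show ?thesis using A y sm \<pi> pos by (auto simp: interior_dual_def)
qed

definition barrier_resistances :: "'a::field vec \<Rightarrow> 'a vec" where
  "barrier_resistances x = vec (dim_vec x) (\<lambda>a. 1 / (x $ a)\<^sup>2)"

definition gradient_flow :: "'a::field vec \<Rightarrow> 'a vec \<Rightarrow> 'a vec" where
  "gradient_flow x s = vec (dim_vec x)
     (\<lambda>a. x $ a * (of_nat (potential_parameter (dim_vec x)) * (x $ a * s $ a) / (x \<bullet> s) - 1))"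

lemma potential_eq_log_potential:
  assumes "x \<in> carrier_vec m" "s \<in> carrier_vec m"
  shows "potential m x s = log_potential (potential_parameter m) {..<m} (\<lambda>a. x $ a * s $ a)"
  using assms by (simp add: potential_def log_potential_def scalar_prod_def lessThan_atLeast0)

lemma gradient_flow_eq:
  assumes "x \<in> carrier_vec m" "s \<in> carrier_vec m" "a < m"
  shows "gradient_flow x s $ a
    = x $ a * potential_gradient (potential_parameter m) {..<m} (\<lambda>a. x $ a * s $ a) a"
  using assms by (simp add: gradient_flow_def potential_gradient_def scalar_prod_def
    lessThan_atLeast0)

lemma potential_parameter_ge: "m \<le> potential_parameter m"
  by (simp add: potential_parameter_def)

lemma potential_parameter_pos: "m \<ge> 1 \<Longrightarrow> 0 < potential_parameter m"
  by (simp add: potential_parameter_def)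

lemma le_potential_parameter_diff_sq: "m \<le> (potential_parameter m - m)\<^sup>2"
proof -
  have "m \<le> m\<^sup>2" by (simp add: power2_eq_square)
  then show ?thesis unfolding potential_parameter_def by (simp add: LeastI[where P = "\<lambda>k. m \<le> k\<^sup>2"])
qed

lemma potential_nonneg:
  assumes m: "m \<ge> 1" and x: "x \<in> carrier_vec m" "\<And>a. a < m \<Longrightarrow> x $ a > 0"
    and s: "s \<in> carrier_vec m" "\<And>a. a < m \<Longrightarrow> s $ a > 0" and gap: "x \<bullet> s \<ge> 1"
  shows "0 \<le> potential m x s"
proof -
  define k where "k = potential_parameter m - m"
  have q: "real (potential_parameter m) = card {..<m} + real k"
    using potential_parameter_ge[of m] by (simp add: k_def)
  have "0 \<le> log_potential (card {..<m}) {..<m} (\<lambda>a. x $ a * s $ a)"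
    using m x s by (intro log_potential_card_nonneg) (auto simp: lessThan_empty_iff)
  moreover have "0 \<le> real k * ln (\<Sum>a<m. x $ a * s $ a)"
    using gap s by (simp add: scalar_prod_def lessThan_atLeast0)
  ultimately show ?thesis
    unfolding potential_eq_log_potential[OF x(1) s(1)] q log_potential_add by simp
qed

lemma energy_barrier_resistances:
  assumes "x \<in> carrier_vec m"
  shows "energy (barrier_resistances x) u = (\<Sum>a<m. (u $ a / x $ a)\<^sup>2)"
  using assms by (simp add: energy_def energy_inner_def barrier_resistances_def power2_eq_square)

lemma energy_gradient_flow_le:
  fixes x s :: "real vec"
  assumes x: "x \<in> carrier_vec m" "\<And>a. a < m \<Longrightarrow> x $ a > 0"
    and s: "s \<in> carrier_vec m" "\<And>a. a < m \<Longrightarrow> s $ a > 0"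
  shows "energy (barrier_resistances x) (gradient_flow x s) \<le> (potential_parameter m)\<^sup>2"
proof -
  let ?g = "potential_gradient (potential_parameter m) {..<m} (\<lambda>a. x $ a * s $ a)"
  have "energy (barrier_resistances x) (gradient_flow x s) = (\<Sum>a<m. (?g a)\<^sup>2)"
    unfolding energy_barrier_resistances[OF x(1)]
    using x s by (intro sum.cong refl) (auto simp: gradient_flow_eq dest: less_imp_neq[symmetric])
  also have "\<dots> \<le> (potential_parameter m)\<^sup>2"
    using x s potential_parameter_ge[of m] by (intro sum_potential_gradient_sq_le) auto
  finally show ?thesis by simp
qed

lemma potential_primal_step:
  fixes x s f :: "real vec"
  assumes m: "m \<ge> 1" and x: "x \<in> carrier_vec m" "\<And>a. a < m \<Longrightarrow> x $ a > 0"
    and s: "s \<in> carrier_vec m" "\<And>a. a < m \<Longrightarrow> s $ a > 0" and f: "f \<in> carrier_vec m"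
    and r: "r = barrier_resistances x" and u: "u = gradient_flow x s"
    and t: "t = 1 / (128 * (energy r (u - f) + 1))" and gap: "energy r f + 1 / 64 \<le> energy r u"
  shows "\<And>a. a < m \<Longrightarrow> (x - t \<cdot>\<^sub>v (u - f)) $ a > 0"
    and "potential m (x - t \<cdot>\<^sub>v (u - f)) s \<le> potential m x s - 1 / 32768"
proof -
  define z where "z a = x $ a * s $ a" for a
  define d where "d a = (u - f) $ a / x $ a" for a
  let ?q = "real (potential_parameter m)"
  have r_dim: "r \<in> carrier_vec m" and um: "u \<in> carrier_vec m"
    using x by (auto simp: r u barrier_resistances_def gradient_flow_def)
  have x_nz: "x $ a \<noteq> 0" if "a < m" for a using x(2)[OF that] by simp
  have d_sq: "(\<Sum>a<m. (d a)\<^sup>2) = energy r (u - f)"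
    unfolding r energy_barrier_resistances[OF x(1)] d_def ..
  have "(\<Sum>a<m. potential_gradient ?q {..<m} z a * d a) = energy_inner r u (u - f)"
    unfolding energy_inner_def r u using x s x_nz
    by (auto simp: barrier_resistances_def gradient_flow_eq z_def[abs_def] d_def u power2_eq_square
      intro!: sum.cong)
  also have "\<dots> = energy r u - energy_inner r u f"
    using r_dim um f by (simp add: energy_def energy_inner_def sum_subtractf algebra_simps)
  also have "\<dots> \<ge> (energy r (u - f) + 1 / 64) / 2"
    using energy_diff[OF r_dim um f] gap by simp
  finally have descent: "((\<Sum>a<m. (d a)\<^sup>2) + 1) / 128
      \<le> (\<Sum>a<m. potential_gradient ?q {..<m} z a * d a)"
    using sum_nonneg[of "{..<m}" "\<lambda>a. (d a)\<^sup>2"] by (simp add: d_sq)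
  have step: "1 - t * d a > 0" if "a < m" for a
    using log_potential_short_step(1)[OF _ _ _ _ _ descent] m x s that
    by (auto simp: z_def d_sq t lessThan_empty_iff)
  have x': "(x - t \<cdot>\<^sub>v (u - f)) $ a = x $ a * (1 - t * d a)" if "a < m" for a
    using that x um f x_nz by (simp add: d_def field_simps)
  show "(x - t \<cdot>\<^sub>v (u - f)) $ a > 0" if "a < m" for a
    unfolding x'[OF that] using x(2)[OF that] step[OF that] by simp
  have "potential m (x - t \<cdot>\<^sub>v (u - f)) s = log_potential ?q {..<m} (\<lambda>a. z a * (1 - t * d a))"
    using x um f s by (subst potential_eq_log_potential)
      (auto intro!: log_potential_cong simp: z_def x' simp del: index_minus_vec)
  also have "\<dots> \<le> log_potential ?q {..<m} z - 1 / 32768"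
    using log_potential_short_step(2)[OF _ _ _ _ _ descent] m x s
    by (auto simp: z_def d_sq t lessThan_empty_iff)
  finally show "potential m (x - t \<cdot>\<^sub>v (u - f)) s \<le> potential m x s - 1 / 32768"
    using x s by (simp add: potential_eq_log_potential z_def[abs_def])
qed

lemma potential_dual_step:
  fixes x s \<pi> :: "real vec"
  assumes m: "m \<ge> 1" and x: "x \<in> carrier_vec m" "\<And>a. a < m \<Longrightarrow> x $ a > 0"
    and s: "s \<in> carrier_vec m" "\<And>a. a < m \<Longrightarrow> s $ a > 0" and A: "A \<in> carrier_mat n m"
    and r: "r = barrier_resistances x" and u: "u = gradient_flow x s"
    and t: "t = (x \<bullet> s) / real (potential_parameter m)"
    and near: "energy r (u - induced_flow A r \<pi>) \<le> 9 / 64"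
  shows "\<And>a. a < m \<Longrightarrow> (s - t \<cdot>\<^sub>v (A\<^sup>T *\<^sub>v \<pi>)) $ a > 0"
    and "potential m x (s - t \<cdot>\<^sub>v (A\<^sup>T *\<^sub>v \<pi>)) \<le> potential m x s - 1 / 32"
proof -
  define z where "z a = x $ a * s $ a" for a
  define w where "w = A\<^sup>T *\<^sub>v \<pi>"
  define e where "e a = (u - induced_flow A r \<pi>) $ a / x $ a" for a
  define k where "k = potential_parameter m - m"
  let ?q = "real (potential_parameter m)"
  have w: "w \<in> carrier_vec m" unfolding w_def using A by (intro carrier_vecI) simp
  have x_nz: "x $ a \<noteq> 0" if "a < m" for a using x(2)[OF that] by simp
  have k: "m \<le> k\<^sup>2" "?q = m + real k"
    using le_potential_parameter_diff_sq[of m] potential_parameter_ge[of m] by (simp_all add: k_def)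
  then have k_ge_1: "real k \<ge> 1" using m by (cases k) auto
  have sum: "x \<bullet> s = sum z {..<m}" using s by (simp add: scalar_prod_def z_def lessThan_atLeast0)
  have z: "z a > 0" if "a < m" for a using x s that by (simp add: z_def)
  have sum_pos: "sum z {..<m} > 0" using m z by (intro sum_pos) (auto simp: lessThan_empty_iff)
  have e_sq: "(\<Sum>a<m. (e a)\<^sup>2) \<le> (3 / 8)\<^sup>2"
    using near unfolding r energy_barrier_resistances[OF x(1)] e_def by (simp add: power2_eq_square)
  have product: "x $ a * (s - t \<cdot>\<^sub>v w) $ a = sum z {..<m} / ?q * (1 + e a)" if "a < m" for a
  proof -
    have "e a = ?q * z a / sum z {..<m} - 1 - x $ a * w $ a"
      using that x s w x_nz[OF that]
      by (simp add: e_def r u gradient_flow_eq potential_gradient_def induced_flow_def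
          barrier_resistances_def z_def w_def[symmetric]
            gradient_flow_def[THEN arg_cong[of _ _ dim_vec]] field_simps power2_eq_square)
    then show ?thesis
      using that s w sum_pos k k_ge_1 by (simp add: t sum z_def field_simps)
  qed
  show "(s - t \<cdot>\<^sub>v (A\<^sup>T *\<^sub>v \<pi>)) $ a > 0" if "a < m" for a
  proof -
    have "1 + e a > 0" using abs_le_of_sum_sq_le[OF _ e_sq, of a] that by simp
    then have "x $ a * (s - t \<cdot>\<^sub>v w) $ a > 0"
      unfolding product[OF that] using sum_pos k k_ge_1 by (intro mult_pos_pos divide_pos_pos) auto
    then show ?thesis using x(2)[OF that] by (simp add: zero_less_mult_iff w_def)
  qed
  have "potential m x (s - t \<cdot>\<^sub>v w) = log_potential ?q {..<m} (\<lambda>a. sum z {..<m} / ?q * (1 + e a))"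
    using x w s by (subst potential_eq_log_potential)
      (auto intro!: log_potential_cong simp: product simp del: index_minus_vec)
  also have "\<dots> \<le> log_potential ?q {..<m} z - (1 - 3 / 8) / 2 + 2 * (3 / 8)\<^sup>2"
    using m z k k_ge_1 e_sq
    by (intro log_potential_centering_step_le[where k = k])
      (auto simp: lessThan_empty_iff simp flip: of_nat_power)
  finally show "potential m x (s - t \<cdot>\<^sub>v (A\<^sup>T *\<^sub>v \<pi>)) \<le> potential m x s - 1 / 32"
    using x s by (simp add: potential_eq_log_potential z_def[abs_def] w_def power2_eq_square)
qed

text \<open>
  The thresholds are such that both steps are proved to decrease the potential by a constant from
  the single bound \<open>\<bar>ln (1 + e) - e\<bar> \<le> 2 * e\<^sup>2\<close>; dividing by the energy plus 1 avoids the
  square root in the normalisation of the primal direction.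
\<close>

definition residual_energy :: "'a::field mat \<Rightarrow> 'a vec \<Rightarrow> 'a vec \<Rightarrow> 'a vec \<Rightarrow> 'a" where
  "residual_energy A x s \<pi> = energy (barrier_resistances x)
     (gradient_flow x s - induced_flow A (barrier_resistances x) \<pi>)"

definition circulation_energy :: "'a::field vec \<Rightarrow> 'a vec \<Rightarrow> 'a vec \<Rightarrow> 'a" where
  "circulation_energy x s f = energy (barrier_resistances x) (gradient_flow x s - f)"

definition primal_step_size :: "'a::linordered_field mat \<Rightarrow> 'a vec \<Rightarrow> 'a vec \<Rightarrow> 'a vec \<Rightarrow> 'a vec \<Rightarrow> 'a"
  where
  "primal_step_size A x s f \<pi> =
     (if 9 / 64 < residual_energy A x s \<pi> then 1 / (128 * (circulation_energy x s f + 1)) else 0)"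

definition dual_step_size :: "'a::linordered_field mat \<Rightarrow> 'a vec \<Rightarrow> 'a vec \<Rightarrow> 'a vec \<Rightarrow> 'a" where
  "dual_step_size A x s \<pi> =
     (if 9 / 64 < residual_energy A x s \<pi> then 0
      else (x \<bullet> s) / of_nat (potential_parameter (dim_vec x)))"

definition primal_step :: "'a::linordered_field mat \<Rightarrow> 'a vec \<Rightarrow> 'a vec \<Rightarrow> 'a vec \<Rightarrow> 'a vec \<Rightarrow> 'a vec"
  where
  "primal_step A x s f \<pi> = x - primal_step_size A x s f \<pi> \<cdot>\<^sub>v (gradient_flow x s - f)"

definition slack_step :: "'a::linordered_field mat \<Rightarrow> 'a vec \<Rightarrow> 'a vec \<Rightarrow> 'a vec \<Rightarrow> 'a vec" where
  "slack_step A x s \<pi> = s - dual_step_size A x s \<pi> \<cdot>\<^sub>v (A\<^sup>T *\<^sub>v \<pi>)"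

lemma dim_barrier_resistances [simp]: "dim_vec (barrier_resistances x) = dim_vec x"
  by (simp add: barrier_resistances_def)

lemma dim_gradient_flow [simp]: "dim_vec (gradient_flow x s) = dim_vec x"
  by (simp add: gradient_flow_def)

lemma barrier_resistances_carrier [simp]:
  "x \<in> carrier_vec m \<Longrightarrow> barrier_resistances x \<in> carrier_vec m"
  by (auto simp: barrier_resistances_def)

lemma barrier_resistances_pos:
  fixes x :: "'a::linordered_field vec"
  assumes "x \<in> carrier_vec m" "\<And>a. a < m \<Longrightarrow> x $ a > 0" "a < m"
  shows "barrier_resistances x $ a > 0"
  using assms(1,3) assms(2)[OF assms(3)] by (simp add: barrier_resistances_def)

lemma gradient_flow_carrier [simp]: "x \<in> carrier_vec m \<Longrightarrow> gradient_flow x s \<in> carrier_vec m"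
  by (auto simp: gradient_flow_def)

lemma potential_step_decreases:
  fixes x s f \<pi> :: "real vec"
  assumes m: "m \<ge> 1" and x: "x \<in> carrier_vec m" "\<And>a. a < m \<Longrightarrow> x $ a > 0"
    and s: "s \<in> carrier_vec m" "\<And>a. a < m \<Longrightarrow> s $ a > 0"
    and A: "A \<in> carrier_mat n m" and f: "f \<in> carrier_vec m"
    and r: "r = barrier_resistances x" and u: "u = gradient_flow x s"
    and energies: "residual_energy A x s \<pi> + energy r f
      \<le> (1 + 2 / (16 * (potential_parameter m)\<^sup>2)) * energy r u"
  shows "\<And>a. a < m \<Longrightarrow> primal_step A x s f \<pi> $ a > 0" and "\<And>a. a < m \<Longrightarrow> slack_step A x s \<pi> $ a > 0"
    and "potential m (primal_step A x s f \<pi>) (slack_step A x s \<pi>) \<le> potential m x s - 1 / 32768"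
proof -
  have "(\<forall>a<m. primal_step A x s f \<pi> $ a > 0) \<and> (\<forall>a<m. slack_step A x s \<pi> $ a > 0) \<and>
    potential m (primal_step A x s f \<pi>) (slack_step A x s \<pi>) \<le> potential m x s - 1 / 32768"
  proof (cases "9 / 64 < residual_energy A x s \<pi>")
    case True
    define t where "t = 1 / (128 * (energy r (u - f) + 1))"
    let ?q = "real (potential_parameter m)"
    have "energy r u \<le> ?q\<^sup>2" unfolding r u using energy_gradient_flow_le[OF x s] by simp
    moreover have "?q > 0" using potential_parameter_pos[OF m] by simp
    ultimately have "2 / (16 * ?q\<^sup>2) * energy r u \<le> 1 / 8" by (simp add: field_simps)
    then have gap: "energy r f + 1 / 64 \<le> energy r u" using energies True
      by (simp add: distrib_right)
    have "primal_step A x s f \<pi> = x - t \<cdot>\<^sub>v (u - f)"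
      using True by (simp add: primal_step_def primal_step_size_def circulation_energy_def
          t_def r u)
    moreover have "slack_step A x s \<pi> = s"
      using True s A by (auto simp: slack_step_def dual_step_size_def)
    ultimately show ?thesis using potential_primal_step[OF m x s f r u t_def gap] s by simp
  next
    case False
    define t where "t = (x \<bullet> s) / real (potential_parameter m)"
    have "primal_step A x s f \<pi> = x"
      using False x f by (auto simp: primal_step_def primal_step_size_def gradient_flow_def)
    moreover have "slack_step A x s \<pi> = s - t \<cdot>\<^sub>v (A\<^sup>T *\<^sub>v \<pi>)"
      using False x by (simp add: slack_step_def dual_step_size_def t_def)
    moreover have "energy r (u - induced_flow A r \<pi>) \<le> 9 / 64" using False
      by (simp add: residual_energy_def r u)
    ultimately show ?thesis using potential_dual_step[OF m x s A r u t_def] x by fastforce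
  qed
  then show "\<And>a. a < m \<Longrightarrow> primal_step A x s f \<pi> $ a > 0" "\<And>a. a < m \<Longrightarrow> slack_step A x s \<pi> $ a > 0"
    "potential m (primal_step A x s f \<pi>) (slack_step A x s \<pi>) \<le> potential m x s - 1 / 32768"
    by blast+
qed

subsection \<open>Rational data\<close>

abbreviation real_mat :: "rat mat \<Rightarrow> real mat" where
  "real_mat \<equiv> map_mat real_of_rat"

lemma scalar_prod_real_vec: "dim_vec u = dim_vec v \<Longrightarrow> real_vec u \<bullet> real_vec v = real_of_rat (u \<bullet> v)"
  by (simp add: scalar_prod_def of_rat_sum of_rat_mult)

lemma real_vec_minus: "dim_vec u = dim_vec v \<Longrightarrow> real_vec (u - v) = real_vec u - real_vec v"
  by (auto simp: of_rat_diff)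

lemma energy_real_vec:
  assumes "r \<in> carrier_vec m" "u \<in> carrier_vec m"
  shows "energy (real_vec r) (real_vec u) = real_of_rat (energy r u)"
  using assms by (simp add: energy_def energy_inner_def of_rat_sum of_rat_mult)

lemma barrier_resistances_real_vec:
  "barrier_resistances (real_vec x) = real_vec (barrier_resistances x)"
  by (auto simp: barrier_resistances_def of_rat_divide of_rat_power)

lemma gradient_flow_real_vec:
  assumes "dim_vec x = dim_vec s"
  shows "gradient_flow (real_vec x) (real_vec s) = real_vec (gradient_flow x s)"
  using assms scalar_prod_real_vec[OF assms]
  by (auto simp: gradient_flow_def of_rat_divide of_rat_mult of_rat_diff)

lemma transpose_mult_real_vec:
  assumes "A \<in> carrier_mat n m" "\<pi> \<in> carrier_vec n"
  shows "(real_mat A)\<^sup>T *\<^sub>v real_vec \<pi> = real_vec (A\<^sup>T *\<^sub>v \<pi>)"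
  unfolding map_mat_transpose using assms by (intro of_rat_hom.mult_mat_vec_hom[symmetric]) auto

lemma induced_flow_real_vec:
  assumes "A \<in> carrier_mat n m" "r \<in> carrier_vec m" "\<pi> \<in> carrier_vec n"
  shows "induced_flow (real_mat A) (real_vec r) (real_vec \<pi>) = real_vec (induced_flow A r \<pi>)"
  using assms by (auto simp: induced_flow_def transpose_mult_real_vec of_rat_divide)

context
  fixes n m :: nat and A :: "rat mat" and x s f \<pi> :: "rat vec"
  assumes dims: "A \<in> carrier_mat n m" "x \<in> carrier_vec m" "s \<in> carrier_vec m" "f \<in> carrier_vec m"
    "\<pi> \<in> carrier_vec n"
begin

lemma residual_energy_real_vec:
  "residual_energy (real_mat A) (real_vec x) (real_vec s) (real_vec \<pi>)
    = real_of_rat (residual_energy A x s \<pi>)"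
proof -
  have r: "barrier_resistances x \<in> carrier_vec m" and u: "gradient_flow x s \<in> carrier_vec m"
    using dims by simp_all
  have h: "induced_flow A (barrier_resistances x) \<pi> \<in> carrier_vec m" using r by simp
  show ?thesis
    using dims energy_real_vec[OF r minus_carrier_vec[OF u h]] carrier_vecD[OF u] carrier_vecD[OF h]
    by (simp add: residual_energy_def barrier_resistances_real_vec gradient_flow_real_vec
        induced_flow_real_vec[OF dims(1) r dims(5)] real_vec_minus)
qed

lemma circulation_energy_real_vec:
  "circulation_energy (real_vec x) (real_vec s) (real_vec f)
    = real_of_rat (circulation_energy x s f)"
proof -
  have r: "barrier_resistances x \<in> carrier_vec m" and u: "gradient_flow x s \<in> carrier_vec m"
    using dims by simp_all
  show ?thesis
    using dims energy_real_vec[OF r minus_carrier_vec[OF u dims(4)]] carrier_vecD[OF u]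
    by (simp add: circulation_energy_def barrier_resistances_real_vec gradient_flow_real_vec
      real_vec_minus)
qed

lemma step_sizes_real_vec:
  "primal_step_size (real_mat A) (real_vec x) (real_vec s) (real_vec f) (real_vec \<pi>)
    = real_of_rat (primal_step_size A x s f \<pi>)"
  "dual_step_size (real_mat A) (real_vec x) (real_vec s) (real_vec \<pi>)
    = real_of_rat (dual_step_size A x s \<pi>)"
proof -
  have "9 / 64 < real_of_rat e \<longleftrightarrow> 9 / 64 < e" for e
    using of_rat_less[of "9 / 64" e, where ?'a = real] by (simp add: of_rat_divide)
  then show "primal_step_size (real_mat A) (real_vec x) (real_vec s) (real_vec f) (real_vec \<pi>)
      = real_of_rat (primal_step_size A x s f \<pi>)"
    "dual_step_size (real_mat A) (real_vec x) (real_vec s) (real_vec \<pi>)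
      = real_of_rat (dual_step_size A x s \<pi>)"
    using dims unfolding primal_step_size_def dual_step_size_def residual_energy_real_vec
      circulation_energy_real_vec
    by (simp_all add: scalar_prod_real_vec of_rat_divide of_rat_mult of_rat_add)
qed

lemma primal_step_real_vec:
  "primal_step (real_mat A) (real_vec x) (real_vec s) (real_vec f) (real_vec \<pi>)
   = real_vec (primal_step A x s f \<pi>)"
  unfolding primal_step_def step_sizes_real_vec
  using dims by (auto simp: gradient_flow_real_vec real_vec_minus of_rat_hom.vec_hom_smult)

lemma slack_step_real_vec:
  "slack_step (real_mat A) (real_vec x) (real_vec s) (real_vec \<pi>) = real_vec (slack_step A x s \<pi>)"
  unfolding slack_step_def step_sizes_real_vec transpose_mult_real_vec[OF dims(1,5)]
  using dims by (auto simp: real_vec_minus of_rat_hom.vec_hom_smult)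

end

abbreviation call_precision :: "nat \<Rightarrow> rat" where
  "call_precision m \<equiv> 1 / (16 * (of_nat (potential_parameter m))\<^sup>2)"

lemma potential_step_decreases_rat:
  fixes x s f \<pi> :: "rat vec"
  assumes m: "m \<ge> 1" and A: "A \<in> carrier_mat n m" and P: "interior_primal A b x"
    and D: "interior_dual A c y s"
    and f: "f \<in> carrier_vec m" "A *\<^sub>v f = A *\<^sub>v gradient_flow x s" and \<pi>: "\<pi> \<in> carrier_vec n"
    and r: "r = barrier_resistances x" and u: "u = gradient_flow x s"
    and energies: "residual_energy A x s \<pi> + energy r f
      \<le> (1 + 2 * call_precision m) * energy r u"
  shows "interior_primal A b (primal_step A x s f \<pi>)"
    and "interior_dual A c (y + dual_step_size A x s \<pi> \<cdot>\<^sub>v \<pi>) (slack_step A x s \<pi>)"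
    and "potential m (real_vec (primal_step A x s f \<pi>)) (real_vec (slack_step A x s \<pi>))
      \<le> potential m (real_vec x) (real_vec s) - 1 / 32768"
proof -
  have x: "x \<in> carrier_vec m" "\<And>a. a < m \<Longrightarrow> x $ a > 0"
    and s: "s \<in> carrier_vec m" "\<And>a. a < m \<Longrightarrow> s $ a > 0"
    using P D A by (auto simp: interior_primal_def interior_dual_def)
  have um: "u \<in> carrier_vec m" and rm: "r \<in> carrier_vec m" using x by (simp_all add: u r)
  have energies_real: "residual_energy (real_mat A) (real_vec x) (real_vec s) (real_vec \<pi>)
      + energy (real_vec r) (real_vec f)
    \<le> (1 + 2 / (16 * (potential_parameter m)\<^sup>2)) * energy (real_vec r) (real_vec u)"
  proof -
    have "real_of_rat (residual_energy A x s \<pi> + energy r f)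
      \<le> real_of_rat ((1 + 2 * call_precision m) * energy r u)"
      using energies by (simp only: of_rat_less_eq)
    then show ?thesis
      by (simp add: residual_energy_real_vec[OF A x(1) s(1) f(1) \<pi>] energy_real_vec[OF rm f(1)]
          energy_real_vec[OF rm um] of_rat_add of_rat_mult of_rat_divide of_rat_power)
  qed
  note decrease = potential_step_decreases[where
    A = "real_mat A" and x = "real_vec x" and s = "real_vec s"
      and f = "real_vec f" and \<pi> = "real_vec \<pi>" and n = n, OF m _ _ _ _ _ _ _ _ energies_real,
      unfolded primal_step_real_vec[OF A x(1) s(1) f(1) \<pi>]
        slack_step_real_vec[OF A x(1) s(1) f(1) \<pi>]]
  have side: "real_vec x \<in> carrier_vec m" "\<And>a. a < m \<Longrightarrow> real_vec x $ a > 0"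
      "real_vec s \<in> carrier_vec m"
    "\<And>a. a < m \<Longrightarrow> real_vec s $ a > 0" "real_mat A \<in> carrier_mat n m" "real_vec f \<in> carrier_vec m"
    "real_vec r = barrier_resistances (real_vec x)"
      "real_vec u = gradient_flow (real_vec x) (real_vec s)"
    using x s A f by (auto simp: r u barrier_resistances_real_vec gradient_flow_real_vec)
  show "potential m (real_vec (primal_step A x s f \<pi>)) (real_vec (slack_step A x s \<pi>))
      \<le> potential m (real_vec x) (real_vec s) - 1 / 32768"
    by (rule decrease(3)[OF side])
  have step_dims: "dim_vec (primal_step A x s f \<pi>) = m" "dim_vec (slack_step A x s \<pi>) = m"
    using A f x s by (simp_all add: primal_step_def slack_step_def)
  have "primal_step A x s f \<pi> $ a > 0" if "a < m" for a
    using decrease(1)[OF side that] that step_dims by simp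
  then show "interior_primal A b (primal_step A x s f \<pi>)"
    unfolding primal_step_def using f um
    by (intro interior_primal_diff_circulation[OF A P]) (simp_all add: u)
  have "slack_step A x s \<pi> $ a > 0" if "a < m" for a
    using decrease(2)[OF side that] that step_dims by simp
  then show "interior_dual A c (y + dual_step_size A x s \<pi> \<cdot>\<^sub>v \<pi>) (slack_step A x s \<pi>)"
    unfolding slack_step_def by (intro interior_dual_add_voltages[OF A D \<pi>])
qed

section \<open>Incidence matrices and electrical instances\<close>

lemma incidence_mat_carrier [simp]: "incidence_mat n m G \<in> carrier_mat n m"
  by (simp add: incidence_mat_def)

lemma dim_incidence_mat [simp]: "dim_row (incidence_mat n m G) = n"
  "dim_col (incidence_mat n m G) = m"
  by (simp_all add: incidence_mat_def)

lemma real_mat_incidence_mat: "real_mat (incidence_mat n m G) = incidence_mat n m G"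
  by (auto simp: incidence_mat_def of_rat_diff)

lemma numbered_digraph_bounds:
  assumes "numbered_digraph n m G" "a < m"
  shows "head G a < n" "tail G a < n"
proof -
  interpret fin_digraph G using assms by (simp add: numbered_digraph_def)
  show "head G a < n" "tail G a < n"
    using assms head_in_verts[of a] tail_in_verts[of a] by (auto simp: numbered_digraph_def)
qed

lemma sum_incidence_mat_mult:
  fixes p :: "nat \<Rightarrow> 'a::comm_ring_1"
  assumes "numbered_digraph n m G" "a < m"
  shows "(\<Sum>v<n. incidence_mat n m G $$ (v, a) * p v) = p (head G a) - p (tail G a)"
  using assms numbered_digraph_bounds[OF assms]
  by (simp add: incidence_mat_def left_diff_distrib sum_subtractf if_distrib[of "\<lambda>z. z * _"]
    cong: if_cong)

lemma incidence_mat_transpose_mult_vec: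
  fixes \<pi> :: "'a::comm_ring_1 vec"
  assumes "numbered_digraph n m G" "\<pi> \<in> carrier_vec n" "a < m"
  shows "((incidence_mat n m G)\<^sup>T *\<^sub>v \<pi>) $ a = \<pi> $ head G a - \<pi> $ tail G a"
proof -
  have "((incidence_mat n m G)\<^sup>T *\<^sub>v \<pi>) $ a = (\<Sum>v<n. incidence_mat n m G $$ (v, a) * \<pi> $ v)"
    using assms by (simp add: scalar_prod_def lessThan_atLeast0)
  then show ?thesis by (simp add: sum_incidence_mat_mult[OF assms(1,3)])
qed

lemma incidence_mat_mult_vec:
  fixes u :: "'a::comm_ring_1 vec"
  assumes "u \<in> carrier_vec m" "v < n"
  shows "(incidence_mat n m G *\<^sub>v u) $ v = (\<Sum>a<m. incidence_mat n m G $$ (v, a) * u $ a)"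
  using assms by (simp add: scalar_prod_def lessThan_atLeast0)

lemma sum_incidence_mat_mult_vec:
  fixes u :: "'a::comm_ring_1 vec"
  assumes G: "numbered_digraph n m G" and u: "u \<in> carrier_vec m"
  shows "(\<Sum>v<n. (incidence_mat n m G *\<^sub>v u) $ v) = 0"
proof -
  have "(\<Sum>v<n. (incidence_mat n m G *\<^sub>v u) $ v)
      = (\<Sum>v<n. \<Sum>a<m. incidence_mat n m G $$ (v, a) * u $ a)"
    using incidence_mat_mult_vec[OF u] by simp
  also have "\<dots> = (\<Sum>a<m. \<Sum>v<n. incidence_mat n m G $$ (v, a) * u $ a)" by (rule sum.swap)
  also have "\<dots> = 0" using sum_incidence_mat_mult[OF G, of _ "\<lambda>_. u $ _"] by simp
  finally show ?thesis .
qed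

lemma certifying_electrical_flow_algorithm_energy:
  assumes E: "certifying_electrical_flow_algorithm E CEF" and G: "numbered_digraph n m G"
    and r: "r \<in> carrier_vec m" "\<And>a. a < m \<Longrightarrow> r $ a > 0" and u: "u \<in> carrier_vec m" and \<epsilon>: "\<epsilon> > 0"
  defines "A \<equiv> incidence_mat n m G"
  obtains f \<pi> t where
    "computes_in_time E (encode_digraph n m G @ list_of_vec r @ list_of_vec (A *\<^sub>v u) @ [\<epsilon>])
       (list_of_vec f @ list_of_vec \<pi>) t"
    and "real t \<le> CEF n m \<epsilon>" and "f \<in> carrier_vec m" and "\<pi> \<in> carrier_vec n" and "A *\<^sub>v f = A *\<^sub>v u"
    and "energy r (u - induced_flow A r \<pi>) + energy r f \<le> (1 + 2 * \<epsilon>) * energy r u"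
proof -
  have A: "A \<in> carrier_mat n m" "real_mat A \<in> carrier_mat n m" by (simp_all add: A_def)
  have real_A: "incidence_mat n m G = real_mat A" by (simp add: A_def real_mat_incidence_mat)
  have \<chi>: "real_vec (A *\<^sub>v u) = real_mat A *\<^sub>v real_vec u"
    by (rule of_rat_hom.mult_mat_vec_hom[OF A(1) u])
  have "electrical_instance n m G r (A *\<^sub>v u)"
    unfolding electrical_instance_def real_A using G r u A \<chi> sum_incidence_mat_mult_vec[OF G u]
    by (auto simp: A_def intro: carrier_vecI)
  then obtain f \<pi> t where run: "real t \<le> CEF n m \<epsilon>"
      "computes_in_time E (encode_digraph n m G @ list_of_vec r @ list_of_vec (A *\<^sub>v u) @ [\<epsilon>])
        (list_of_vec f @ list_of_vec \<pi>) t"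
    and flow: "eps_electrical_flow (real_of_rat \<epsilon>) (real_mat A) (real_vec r) (real_vec (A *\<^sub>v u))
        (real_vec f)"
    and voltages: "eps_voltages (real_of_rat \<epsilon>) (real_mat A) (real_vec r) (real_vec (A *\<^sub>v u))
        (real_vec \<pi>)"
    using E[unfolded certifying_electrical_flow_algorithm_def, rule_format, of n m G r "A *\<^sub>v u" \<epsilon>] \<epsilon>
    unfolding real_A by blast
  have f: "f \<in> carrier_vec m" and \<pi>: "\<pi> \<in> carrier_vec n"
    using flow voltages A by (auto simp: eps_electrical_flow_def eps_voltages_def)
  have "real_vec (A *\<^sub>v f) = real_vec (A *\<^sub>v u)"
    unfolding of_rat_hom.mult_mat_vec_hom[OF A(1) f] using flow
    by (simp only: eps_electrical_flow_def)
  then have "A *\<^sub>v f = A *\<^sub>v u" by (rule of_rat_hom.vec_hom_inj)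
  moreover have "energy r (u - induced_flow A r \<pi>) + energy r f \<le> (1 + 2 * \<epsilon>) * energy r u"
  proof -
    have h: "induced_flow A r \<pi> \<in> carrier_vec m" using r by simp
    have "energy (real_vec r) (real_vec u - induced_flow (real_mat A) (real_vec r) (real_vec \<pi>))
        + energy (real_vec r) (real_vec f) \<le> (1 + 2 * real_of_rat \<epsilon>) * energy (real_vec r)
          (real_vec u)"
      using flow voltages r u \<epsilon> unfolding \<chi>
      by (intro approximate_electrical_energy_le[OF A(2)]) auto
    then have "real_of_rat (energy r (u - induced_flow A r \<pi>) + energy r f)
        \<le> real_of_rat ((1 + 2 * \<epsilon>) * energy r u)"
      using energy_real_vec[OF r(1) minus_carrier_vec[OF u h]] energy_real_vec[OF r(1) u]
        energy_real_vec[OF r(1) f]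
        carrier_vecD[OF u] carrier_vecD[OF h]
      by (simp add: induced_flow_real_vec[OF A(1) r(1) \<pi>] real_vec_minus of_rat_add of_rat_mult)
    then show ?thesis by (simp only: of_rat_less_eq)
  qed
  ultimately show thesis using that run f \<pi> by blast
qed

section \<open>Running programs\<close>

subsection \<open>Isolated subroutines\<close>

fun exp_names :: "exp \<Rightarrow> nat set" where
  "exp_names (Num q) = {}"
| "exp_names (Cell a e) = insert a (exp_names e)"
| "exp_names (Add e1 e2) = exp_names e1 \<union> exp_names e2"
| "exp_names (Sub e1 e2) = exp_names e1 \<union> exp_names e2"
| "exp_names (Mul e1 e2) = exp_names e1 \<union> exp_names e2"
| "exp_names (Div e1 e2) = exp_names e1 \<union> exp_names e2"

fun com_names :: "com \<Rightarrow> nat set" where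
  "com_names Skip = {}"
| "com_names (Assign a i e) = insert a (exp_names i \<union> exp_names e)"
| "com_names (New a) = {a}"
| "com_names (Seq c1 c2) = com_names c1 \<union> com_names c2"
| "com_names (IfLess e1 e2 c1 c2) = exp_names e1 \<union> exp_names e2 \<union> com_names c1 \<union> com_names c2"
| "com_names (WhileLess e1 e2 c) = exp_names e1 \<union> exp_names e2 \<union> com_names c"

lemma finite_exp_names: "finite (exp_names e)"
  by (induction e) auto

lemma finite_com_names: "finite (com_names c)"
  by (induction c) (auto simp: finite_exp_names)

lemma eval_override_on: "exp_names e \<subseteq> A \<Longrightarrow> eval e (override_on \<tau> \<sigma> A) = eval e \<sigma>"
  by (induction e) (auto split: option.splits)

lemma override_on_fun_upd: "a \<in> A \<Longrightarrow> override_on f (g(a := x)) A = (override_on f g A)(a := x)"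
  by (auto simp: override_on_def)

lemma exec_override_on:
  "exec c \<sigma> t \<sigma>' \<Longrightarrow> com_names c \<subseteq> A \<Longrightarrow> exec c (override_on \<tau> \<sigma> A) t (override_on \<tau> \<sigma>' A)"
proof (induction rule: exec.induct)
  case (Assign i \<sigma> k e v a)
  then have "eval i (override_on \<tau> \<sigma> A) = Some (of_nat k)" "eval e (override_on \<tau> \<sigma> A) = Some v"
      "a \<in> A"
    by (simp_all add: eval_override_on)
  from exec.Assign[OF this(1,2), of a] \<open>a \<in> A\<close> show ?case
    by (simp add: override_on_fun_upd del: fun_upd_apply)
next
  case (New a \<sigma>)
  then show ?case using exec.New[of a "override_on \<tau> \<sigma> A"]
    by (simp add: override_on_fun_upd del: fun_upd_apply)
qed (auto intro: exec.intros[simplified] simp: eval_override_on)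

subsection \<open>Total correctness with running times\<close>

definition triple :: "nat \<Rightarrow> (store \<Rightarrow> bool) \<Rightarrow> com \<Rightarrow> (store \<Rightarrow> bool) \<Rightarrow> bool" where
  "triple T P c Q \<longleftrightarrow> (\<forall>\<sigma>. P \<sigma> \<longrightarrow> (\<exists>t \<sigma>'. t \<le> T \<and> exec c \<sigma> t \<sigma>' \<and> Q \<sigma>'))"

lemma tripleI: "(\<And>\<sigma>. P \<sigma> \<Longrightarrow> \<exists>t \<sigma>'. t \<le> T \<and> exec c \<sigma> t \<sigma>' \<and> Q \<sigma>') \<Longrightarrow> triple T P c Q"
  by (simp add: triple_def)

lemma tripleE:
  assumes "triple T P c Q" "P \<sigma>"
  obtains t \<sigma>' where "t \<le> T" "exec c \<sigma> t \<sigma>'" "Q \<sigma>'"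
  using assms by (auto simp: triple_def)

lemma triple_mono:
  "triple T P c Q \<Longrightarrow> (\<And>\<sigma>. P' \<sigma> \<Longrightarrow> P \<sigma>) \<Longrightarrow> (\<And>\<sigma>. Q \<sigma> \<Longrightarrow> Q' \<sigma>) \<Longrightarrow> T \<le> T' \<Longrightarrow> triple T' P' c Q'"
  unfolding triple_def by (meson le_trans)

lemma triple_Seq [trans]:
  assumes "triple T1 P c1 Q" "triple T2 Q c2 R"
  shows "triple (T1 + T2) P (Seq c1 c2) R"
proof (rule tripleI)
  fix \<sigma> assume "P \<sigma>"
  with assms obtain t1 t2 \<sigma>1 \<sigma>2
    where "t1 \<le> T1" "exec c1 \<sigma> t1 \<sigma>1" "t2 \<le> T2" "exec c2 \<sigma>1 t2 \<sigma>2" "R \<sigma>2"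
    by (metis tripleE)
  then show "\<exists>t \<sigma>'. t \<le> T1 + T2 \<and> exec (Seq c1 c2) \<sigma> t \<sigma>' \<and> R \<sigma>'"
    by (meson add_mono exec.Seq)
qed

lemma triple_While:
  assumes test: "\<And>k \<sigma>. I k \<sigma> \<Longrightarrow> \<exists>v w. eval e1 \<sigma> = Some v \<and> eval e2 \<sigma> = Some w
      \<and> (if v < w then 0 < k \<and> B (k - 1) \<sigma> else Q \<sigma>)"
    and body: "\<And>k. k < N \<Longrightarrow> triple T (B k) c (I k)"
  shows "triple ((N + 1) * (1 + cost e1 + cost e2 + T)) (I N) (WhileLess e1 e2 c) Q"
  using body
proof (induction N)
  case 0
  show ?case
  proof (rule tripleI)
    fix \<sigma> assume "I 0 \<sigma>"
    from test[OF this] obtain v w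
      where vw: "eval e1 \<sigma> = Some v" "eval e2 \<sigma> = Some w" "\<not> v < w" "Q \<sigma>"
      by (auto split: if_splits)
    show "\<exists>t \<sigma>'. t \<le> (0 + 1) * (1 + cost e1 + cost e2 + T) \<and> exec (WhileLess e1 e2 c) \<sigma> t \<sigma>' \<and> Q \<sigma>'"
      using exec.WhileFalse[OF vw(1-3)] vw(4) by (intro exI[of _ "1 + cost e1 + cost e2"]) auto
  qed
next
  case (Suc N)
  show ?case
  proof (rule tripleI)
    fix \<sigma> assume "I (Suc N) \<sigma>"
    from test[OF this] obtain v w where vw: "eval e1 \<sigma> = Some v" "eval e2 \<sigma> = Some w"
      and cases: "v < w \<Longrightarrow> B N \<sigma>" "\<not> v < w \<Longrightarrow> Q \<sigma>"
      by (metis diff_Suc_1)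
    show "\<exists>t \<sigma>'. t \<le> (Suc N + 1) * (1 + cost e1 + cost e2 + T) \<and> exec (WhileLess e1 e2 c) \<sigma> t \<sigma>' \<and>
        Q \<sigma>'"
    proof (cases "v < w")
      case True
      with cases(1) Suc.prems[of N] obtain t1 \<sigma>1 where body: "t1 \<le> T" "exec c \<sigma> t1 \<sigma>1" and "I N \<sigma>1"
        by (auto elim: tripleE)
      moreover have "triple ((N + 1) * (1 + cost e1 + cost e2 + T)) (I N) (WhileLess e1 e2 c) Q"
        using Suc by simp
      ultimately obtain t2 \<sigma>2 where rest: "t2 \<le> (N + 1) * (1 + cost e1 + cost e2 + T)"
        "exec (WhileLess e1 e2 c) \<sigma>1 t2 \<sigma>2" "Q \<sigma>2"
        by (blast elim: tripleE)
      show ?thesis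
        using exec.WhileTrue[OF vw True body(2) rest(2)] body(1) rest(1,3)
        by (intro exI[of _ "1 + cost e1 + cost e2 + t1 + t2"] exI[of _ \<sigma>2]) auto
    next
      case False
      then show ?thesis
        using exec.WhileFalse[OF vw] cases(2)
        by (intro exI[of _ "1 + cost e1 + cost e2"] exI[of _ \<sigma>]) auto
    qed
  qed
qed

subsection \<open>Programs without nested loops\<close>

text \<open>The running time of such a program is at most \<open>com_cost\<close> times a bound on the iterations
  of its loops.\<close>

fun com_cost :: "com \<Rightarrow> nat" where
  "com_cost Skip = 1"
| "com_cost (Assign a i e) = 1 + cost i + cost e"
| "com_cost (New a) = 1"
| "com_cost (Seq c1 c2) = com_cost c1 + com_cost c2"
| "com_cost (IfLess e1 e2 c1 c2) = 1 + cost e1 + cost e2 + com_cost c1 + com_cost c2"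
| "com_cost (WhileLess e1 e2 c) = 1 + cost e1 + cost e2 + com_cost c"

definition loop_triple :: "nat \<Rightarrow> (store \<Rightarrow> bool) \<Rightarrow> com \<Rightarrow> (store \<Rightarrow> bool) \<Rightarrow> bool" where
  "loop_triple L P c Q \<longleftrightarrow> triple (com_cost c * L) P c Q"

lemma loop_triple_weaken:
  "loop_triple L P c Q \<Longrightarrow> (\<And>\<sigma>. P' \<sigma> \<Longrightarrow> P \<sigma>) \<Longrightarrow> (\<And>\<sigma>. Q \<sigma> \<Longrightarrow> Q' \<sigma>) \<Longrightarrow> loop_triple L P' c Q'"
  unfolding loop_triple_def by (erule triple_mono) auto

lemma loop_triple_Seq [trans]: "loop_triple L P c1 Q \<Longrightarrow> loop_triple L Q c2 R \<Longrightarrow>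
  loop_triple L P (Seq c1 c2) R"
  unfolding loop_triple_def by (simp add: add_mult_distrib triple_Seq)

lemma loop_triple_exec:
  assumes "\<And>\<sigma>. P \<sigma> \<Longrightarrow> \<exists>\<sigma>'. exec c \<sigma> (com_cost c) \<sigma>' \<and> Q \<sigma>'" and L: "0 < L"
  shows "loop_triple L P c Q"
  unfolding loop_triple_def
proof (rule tripleI)
  fix \<sigma> assume "P \<sigma>"
  from assms(1)[OF this] obtain \<sigma>' where "exec c \<sigma> (com_cost c) \<sigma>'" "Q \<sigma>'" by blast
  moreover have "com_cost c \<le> com_cost c * L" using L by simp
  ultimately show "\<exists>t \<sigma>'. t \<le> com_cost c * L \<and> exec c \<sigma> t \<sigma>' \<and> Q \<sigma>'" by blast
qed

lemma loop_triple_Assign: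
  assumes "\<And>\<sigma>. P \<sigma> \<Longrightarrow> \<exists>k v. eval i \<sigma> = Some (of_nat k) \<and> eval e \<sigma> = Some v \<and>
      Q (\<sigma>(a := (\<sigma> a)(k := v)))"
    and "0 < L"
  shows "loop_triple L P (Assign a i e) Q"
proof (rule loop_triple_exec)
  fix \<sigma> assume "P \<sigma>"
  from assms(1)[OF this] obtain k v where "eval i \<sigma> = Some (of_nat k)" "eval e \<sigma> = Some v"
    "Q (\<sigma>(a := (\<sigma> a)(k := v)))" by blast
  from exec.Assign[OF this(1,2), of a] this(3)
  show "\<exists>\<sigma>'. exec (Assign a i e) \<sigma> (com_cost (Assign a i e)) \<sigma>' \<and> Q \<sigma>'"
    unfolding com_cost.simps by blast
qed fact

lemma loop_triple_New: "(\<And>\<sigma>. P \<sigma> \<Longrightarrow> Q (\<sigma>(a := (\<lambda>_. 0)))) \<Longrightarrow> 0 < L \<Longrightarrow> loop_triple L P (New a) Q"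
  by (rule loop_triple_exec) (use exec.New in auto)

lemma loop_triple_Skip: "0 < L \<Longrightarrow> loop_triple L P Skip P"
  by (rule loop_triple_exec) (use exec.Skip in auto)

lemma loop_triple_IfLess:
  assumes test: "\<And>\<sigma>. P \<sigma> \<Longrightarrow> \<exists>v w. eval e1 \<sigma> = Some v \<and> eval e2 \<sigma> = Some w
      \<and> (if v < w then P1 \<sigma> else P2 \<sigma>)"
    and branches: "loop_triple L P1 c1 Q" "loop_triple L P2 c2 Q" and L: "0 < L"
  shows "loop_triple L P (IfLess e1 e2 c1 c2) Q"
  unfolding loop_triple_def
proof (rule tripleI)
  fix \<sigma> assume "P \<sigma>"
  from test[OF this] obtain v w where vw: "eval e1 \<sigma> = Some v" "eval e2 \<sigma> = Some w"
    and cases: "if v < w then P1 \<sigma> else P2 \<sigma>" by blast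
  let ?T = "com_cost (IfLess e1 e2 c1 c2) * L"
  have T: "1 + cost e1 + cost e2 + t \<le> ?T" if "t \<le> com_cost c1 * L \<or> t \<le> com_cost c2 * L" for t
  proof -
    have "x + t \<le> x * L + com_cost c1 * L + com_cost c2 * L" for x
    proof -
      have "x \<le> x * L" using L by simp
      then show ?thesis using that by linarith
    qed
    from this[of "1 + cost e1 + cost e2"] show ?thesis by (simp add: add_mult_distrib)
  qed
  show "\<exists>t \<sigma>'. t \<le> ?T \<and> exec (IfLess e1 e2 c1 c2) \<sigma> t \<sigma>' \<and> Q \<sigma>'"
  proof (cases "v < w")
    case True
    with cases branches(1) obtain t \<sigma>' where "t \<le> com_cost c1 * L" "exec c1 \<sigma> t \<sigma>'" "Q \<sigma>'"
      by (auto simp: loop_triple_def elim: tripleE)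
    then show ?thesis using exec.IfTrue[OF vw True] T by blast
  next
    case False
    with cases branches(2) obtain t \<sigma>' where "t \<le> com_cost c2 * L" "exec c2 \<sigma> t \<sigma>'" "Q \<sigma>'"
      by (auto simp: loop_triple_def elim: tripleE)
    then show ?thesis using exec.IfFalse[OF vw False] T by blast
  qed
qed

lemma loop_triple_While:
  assumes "\<And>k \<sigma>. I k \<sigma> \<Longrightarrow> \<exists>v w. eval e1 \<sigma> = Some v \<and> eval e2 \<sigma> = Some w
      \<and> (if v < w then 0 < k \<and> B (k - 1) \<sigma> else Q \<sigma>)"
    and "\<And>k. k < N \<Longrightarrow> loop_triple 1 (B k) c (I k)" and L: "N < L"
  shows "loop_triple L (I N) (WhileLess e1 e2 c) Q"
proof -
  have "triple ((N + 1) * (1 + cost e1 + cost e2 + com_cost c)) (I N) (WhileLess e1 e2 c) Q"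
    using assms(2) by (intro triple_While[OF assms(1)]) (auto simp: loop_triple_def)
  moreover have "(N + 1) * com_cost (WhileLess e1 e2 c) \<le> L * com_cost (WhileLess e1 e2 c)"
    using L by (intro mult_right_mono) auto
  ultimately show ?thesis
    unfolding loop_triple_def by (auto elim!: triple_mono simp: mult.commute)
qed

abbreviation Var :: "nat \<Rightarrow> exp" where
  "Var a \<equiv> Cell a (Num 0)"

abbreviation SetVar :: "nat \<Rightarrow> exp \<Rightarrow> com" where
  "SetVar a e \<equiv> Assign a (Num 0) e"

definition For :: "nat \<Rightarrow> exp \<Rightarrow> com \<Rightarrow> com" where
  "For i l c = Seq (SetVar i (Num 0))
    (WhileLess (Var i) l (Seq c (SetVar i (Add (Var i) (Num 1)))))"

lemma loop_triple_For:
  assumes bound: "\<And>k \<sigma>. k \<le> N \<Longrightarrow> I k \<sigma> \<Longrightarrow> \<sigma> i 0 = of_nat k \<Longrightarrow> eval l \<sigma> = Some (of_nat N)"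
    and body: "\<And>k. k < N \<Longrightarrow> loop_triple 1 (\<lambda>\<sigma>. I k \<sigma> \<and> \<sigma> i 0 = of_nat k) c (\<lambda>\<sigma>. I (Suc k) \<sigma> \<and>
        \<sigma> i 0 = of_nat k)"
    and counter: "\<And>k \<sigma> v. I k \<sigma> \<Longrightarrow> I k (\<sigma>(i := (\<sigma> i)(0 := v)))" and L: "N < L"
  shows "loop_triple L (I 0) (For i l c) (I N)"
  unfolding For_def
proof (rule loop_triple_Seq)
  define J where "J k \<sigma> \<longleftrightarrow> k \<le> N \<and> I (N - k) \<sigma> \<and> \<sigma> i 0 = of_nat (N - k)" for k \<sigma>
  define B where "B k \<sigma> \<longleftrightarrow> I (N - Suc k) \<sigma> \<and> \<sigma> i 0 = of_nat (N - Suc k)" for k \<sigma>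
  show "loop_triple L (I 0) (SetVar i (Num 0)) (J N)"
    using counter L by (intro loop_triple_Assign) (auto simp: J_def intro!: exI[of _ "0::nat"])
  show "loop_triple L (J N) (WhileLess (Var i) l (Seq c (SetVar i (Add (Var i) (Num 1))))) (I N)"
  proof (rule loop_triple_While[OF _ _ L])
    fix k \<sigma> assume "J k \<sigma>"
    then have "eval (Var i) \<sigma> = Some (of_nat (N - k))" "eval l \<sigma> = Some (of_nat N)" "k \<le> N"
        "I (N - k) \<sigma>"
      using bound[of "N - k" \<sigma>] by (auto simp: J_def)
    then show "\<exists>v w. eval (Var i) \<sigma> = Some v \<and> eval l \<sigma> = Some w \<and>
        (if v < w then 0 < k \<and> B (k - 1) \<sigma> else I N \<sigma>)"
      using \<open>J k \<sigma>\<close> by (cases k) (auto simp: B_def J_def)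
  next
    fix k assume k: "k < N"
    then have "N - k = Suc (N - Suc k)" by simp
    then have "loop_triple 1 (B k) c (\<lambda>\<sigma>. I (N - k) \<sigma> \<and> \<sigma> i 0 = of_nat (N - Suc k))"
      using body[of "N - Suc k"] k by (simp add: B_def[abs_def])
    then show "loop_triple 1 (B k) (Seq c (SetVar i (Add (Var i) (Num 1)))) (J k)"
      by (rule loop_triple_Seq) (use counter k
        in \<open>auto simp: J_def of_nat_diff intro!: loop_triple_Assign exI[of _ "0::nat"]\<close>)
  qed
qed

subsection \<open>Memory contents\<close>

text \<open>A memory records a known initial segment of every array.\<close>

type_synonym memory = "nat \<Rightarrow> rat list"

definition represents :: "memory \<Rightarrow> store \<Rightarrow> bool" where
  "represents M \<sigma> \<longleftrightarrow> (\<forall>a k. k < length (M a) \<longrightarrow> \<sigma> a k = M a ! k)"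

lemma representsD: "represents M \<sigma> \<Longrightarrow> k < length (M a) \<Longrightarrow> \<sigma> a k = M a ! k"
  by (simp add: represents_def)

lemma represents_mono: "represents M \<sigma> \<Longrightarrow> (\<And>a. \<exists>ys. M a = M' a @ ys) \<Longrightarrow> represents M' \<sigma>"
  unfolding represents_def by (metis nth_append length_append trans_less_add1)

declare nat_int_add [simp]

lemma loop_triple_SetVar:
  assumes "\<And>\<sigma>. represents M \<sigma> \<Longrightarrow> eval e \<sigma> = Some v" "0 < L"
  shows "loop_triple L (represents M) (SetVar a e) (represents (M(a := [v])))"
  using assms by (intro loop_triple_Assign exI[of _ 0] exI[of _ v]) (auto simp: represents_def)

lemma loop_triple_Assign_memory:
  assumes "\<And>\<sigma>. represents M \<sigma> \<Longrightarrow> eval p \<sigma> = Some (of_nat j) \<and> eval e \<sigma> = Some v"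
    and "j \<le> length (M a)" "0 < L"
  shows "loop_triple L (represents M) (Assign a p e)
      (represents (M(a := take j (M a) @ v # drop (Suc j) (M a))))"
  using assms by (intro loop_triple_Assign exI[of _ j] exI[of _ v])
    (auto simp: represents_def nth_append nth_Cons' Suc_diff_Suc)

definition tabulate :: "nat \<Rightarrow> nat \<Rightarrow> exp \<Rightarrow> exp \<Rightarrow> exp \<Rightarrow> com" where
  "tabulate i b p l e = For i l (Assign b (Add p (Var i)) e)"

lemma represents_fun_upd:
  "M i = [] \<Longrightarrow> represents (M(i := [v])) = (\<lambda>\<sigma>. represents M \<sigma> \<and> \<sigma> i 0 = v)"
  by (auto simp: represents_def fun_eq_iff)

lemma represents_counter: "represents M \<sigma> \<Longrightarrow> M i = [] \<Longrightarrow> represents M (\<sigma>(i := f))"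
  by (auto simp: represents_def)

lemma loop_triple_For_memory:
  assumes counter: "\<And>k. M k i = []" and L: "N < L"
    and bound: "\<And>k \<sigma>. k \<le> N \<Longrightarrow> represents ((M k)(i := [of_nat k])) \<sigma> \<Longrightarrow> eval l \<sigma> = Some (of_nat N)"
    and body: "\<And>k. k < N \<Longrightarrow>
      loop_triple 1 (represents ((M k)(i := [of_nat k]))) c
        (represents ((M (Suc k))(i := [of_nat k])))"
  shows "loop_triple L (represents (M 0)) (For i l c) (represents (M N))"
  using body bound
  by (intro loop_triple_For[where I = "\<lambda>k. represents (M k)"] represents_counter counter L)
    (simp_all only: represents_fun_upd counter)

lemma loop_triple_tabulate:
  fixes M :: memory and b i j :: nat and ys :: "rat list"
  defines "N \<equiv> \<lambda>k. M(b := take j (M b) @ take k ys @ drop (j + k) (M b))"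
  assumes names: "i \<noteq> b" "M i = []" and L: "length ys < L" and j: "j \<le> length (M b)"
    and bounds: "\<And>k \<sigma>. k \<le> length ys \<Longrightarrow> represents ((N k)(i := [of_nat k])) \<sigma> \<Longrightarrow>
      eval p \<sigma> = Some (of_nat j) \<and> eval l \<sigma> = Some (of_nat (length ys))"
    and entry: "\<And>k \<sigma>. k < length ys \<Longrightarrow> represents ((N k)(i := [of_nat k])) \<sigma> \<Longrightarrow> eval e \<sigma>
        = Some (ys ! k)"
  shows "loop_triple L (represents M) (tabulate i b p l e) (represents (M(b := take j (M b) @ ys)))"
proof -
  have "loop_triple L (represents (N 0)) (tabulate i b p l e) (represents (N (length ys)))"
    unfolding tabulate_def
  proof (rule loop_triple_For_memory[where M = N, OF _ L])
    fix k assume k: "k < length ys"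
    let ?M = "(N k)(i := [of_nat k])"
    have "loop_triple 1 (represents ?M) (Assign b (Add p (Var i)) e)
        (represents (?M(b := take (j + k) (?M b) @ ys ! k # drop (Suc (j + k)) (?M b))))"
      using bounds[of k] entry[OF k] k j names
      by (intro loop_triple_Assign_memory) (auto simp: N_def representsD)
    also have "?M(b := take (j + k) (?M b) @ ys ! k # drop (Suc (j + k)) (?M b))
        = (N (Suc k))(i := [of_nat k])"
      using k j names by (auto simp: N_def take_Suc_conv_app_nth)
    finally show "loop_triple 1 (represents ?M) (Assign b (Add p (Var i)) e)
        (represents ((N (Suc k))(i := [of_nat k])))" .
  qed (use bounds names in \<open>auto simp: N_def\<close>)
  then show ?thesis by (rule loop_triple_weaken) (auto simp: N_def elim!: represents_mono)
qed

definition accumulate :: "nat \<Rightarrow> nat \<Rightarrow> exp \<Rightarrow> exp \<Rightarrow> com" where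
  "accumulate i d l e = Seq (SetVar d (Num 0)) (For i l (SetVar d (Add (Var d) e)))"

lemma loop_triple_accumulate:
  assumes names: "i \<noteq> d" "M i = []" and L: "N < L"
    and bound: "\<And>k \<sigma>. k \<le> N \<Longrightarrow> represents (M(d := [sum v {..<k}], i := [of_nat k])) \<sigma> \<Longrightarrow>
      eval l \<sigma> = Some (of_nat N)"
    and entry: "\<And>k \<sigma>. k < N \<Longrightarrow> represents (M(d := [sum v {..<k}], i := [of_nat k])) \<sigma> \<Longrightarrow>
      eval e \<sigma> = Some (v k)"
  shows "loop_triple L (represents M) (accumulate i d l e) (represents (M(d := [sum v {..<N}])))"
  unfolding accumulate_def
proof (rule loop_triple_Seq)
  show "loop_triple L (represents M) (SetVar d (Num 0)) (represents (M(d := [sum v {..<0}])))"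
    using loop_triple_SetVar[of M "Num 0" 0] L by simp
  show "loop_triple L (represents (M(d := [sum v {..<0}]))) (For i l (SetVar d (Add (Var d) e)))
      (represents (M(d := [sum v {..<N}])))"
  proof (rule loop_triple_For_memory[where M = "\<lambda>k. M(d := [sum v {..<k}])", OF _ L])
    fix k assume k: "k < N"
    let ?M = "M(d := [sum v {..<k}], i := [of_nat k])"
    have "loop_triple 1 (represents ?M) (SetVar d (Add (Var d) e))
        (represents (?M(d := [sum v {..<Suc k}])))"
      using entry[OF k] names by (intro loop_triple_SetVar) (auto simp: representsD)
    then show "loop_triple 1 (represents ?M) (SetVar d (Add (Var d) e))
        (represents (M(d := [sum v {..<Suc k}], i := [of_nat k])))"
      using names by (simp add: fun_upd_twist)
  qed (use names bound in auto)
qed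

definition table :: "nat \<Rightarrow> nat \<Rightarrow> nat \<Rightarrow> exp \<Rightarrow> com" where
  "table i b l e = tabulate i b (Num 0) (Var l) e"

lemma loop_triple_table:
  assumes names: "i \<notin> {b, l}" "l \<noteq> b" "M i = []" and l: "M l = [of_nat (length ys)]"
    and L: "length ys < L"
    and entry: "\<And>k \<sigma>. k < length ys \<Longrightarrow> represents (M(b := take k ys @ drop k (M b), i := [of_nat k]))
        \<sigma> \<Longrightarrow>
      eval e \<sigma> = Some (ys ! k)"
  shows "loop_triple L (represents M) (table i b l e) (represents (M(b := ys)))"
  unfolding table_def using loop_triple_tabulate[of i b M ys L 0 "Num 0" "Var l" e] assms
  by (simp add: representsD)

definition extend :: "nat \<Rightarrow> nat \<Rightarrow> rat list \<Rightarrow> memory \<Rightarrow> memory" where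
  "extend b p ys M = M(b := M b @ ys, p := [of_nat (length (M b @ ys))])"

definition append_table :: "nat \<Rightarrow> nat \<Rightarrow> nat \<Rightarrow> nat \<Rightarrow> exp \<Rightarrow> com" where
  "append_table i b p l e = Seq (tabulate i b (Var p) (Var l) e) (SetVar p (Add (Var p) (Var l)))"

lemma loop_triple_append_table:
  assumes names: "i \<notin> {b, l, p}" "b \<notin> {l, p}" "M i = []"
    and p: "M p = [of_nat (length (M b))]" and l: "M l = [of_nat (length ys)]"
    and L: "length ys < L"
    and entry: "\<And>k \<sigma>. k < length ys \<Longrightarrow> represents (M(b := M b @ take k ys, i := [of_nat k])) \<sigma> \<Longrightarrow>
      eval e \<sigma> = Some (ys ! k)"
  shows "loop_triple L (represents M) (append_table i b p l e)
    (represents (extend b p ys M))"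
  unfolding append_table_def extend_def
proof (rule loop_triple_Seq)
  show "loop_triple L (represents M) (tabulate i b (Var p) (Var l) e)
      (represents (M(b := M b @ ys)))"
    using loop_triple_tabulate[of i b M ys L "length (M b)" "Var p" "Var l" e] assms
    by (simp add: representsD)
  show "loop_triple L (represents (M(b := M b @ ys))) (SetVar p (Add (Var p) (Var l)))
      (represents (M(b := M b @ ys, p := [of_nat (length (M b @ ys))])))"
    using names p l L by (intro loop_triple_SetVar) (auto simp: representsD)
qed

definition append_value :: "nat \<Rightarrow> nat \<Rightarrow> exp \<Rightarrow> com" where
  "append_value b p e = Seq (Assign b (Var p) e) (SetVar p (Add (Var p) (Num 1)))"

lemma loop_triple_append_value:
  assumes "b \<noteq> p" and p: "M p = [of_nat (length (M b))]"
    and e: "\<And>\<sigma>. represents M \<sigma> \<Longrightarrow> eval e \<sigma> = Some v"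
    and L: "0 < L"
  shows "loop_triple L (represents M) (append_value b p e)
    (represents (extend b p [v] M))"
  unfolding append_value_def extend_def
proof (rule loop_triple_Seq)
  show "loop_triple L (represents M) (Assign b (Var p) e) (represents (M(b := M b @ [v])))"
    using loop_triple_Assign_memory[of M "Var p" "length (M b)" e v b L] p e L
    by (simp add: representsD)
  show "loop_triple L (represents (M(b := M b @ [v]))) (SetVar p (Add (Var p) (Num 1)))
      (represents (M(b := M b @ [v], p := [of_nat (length (M b @ [v]))])))"
    using assms(1) p L by (intro loop_triple_SetVar) (auto simp: representsD)
qed

definition read_table :: "nat \<Rightarrow> nat \<Rightarrow> nat \<Rightarrow> nat \<Rightarrow> nat \<Rightarrow> com" where
  "read_table i a p b l = Seq (table i b l (Cell a (Add (Var p) (Var i))))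
    (SetVar p (Add (Var p) (Var l)))"

lemma loop_triple_read_table:
  assumes names: "i \<notin> {a, b, l, p}" "b \<notin> {a, l, p}" "M i = []"
    and a: "M a = xs @ ys @ zs" and p: "M p = [of_nat (length xs)]"
    and l: "M l = [of_nat (length ys)]"
    and L: "length ys < L"
  shows "loop_triple L (represents M) (read_table i a p b l)
    (represents (M(b := ys, p := [of_nat (length (xs @ ys))])))"
  unfolding read_table_def
proof (rule loop_triple_Seq)
  show "loop_triple L (represents M) (table i b l (Cell a (Add (Var p) (Var i))))
      (represents (M(b := ys)))"
    using names a p l L by (intro loop_triple_table) (auto simp: representsD nth_append)
  show "loop_triple L (represents (M(b := ys))) (SetVar p (Add (Var p) (Var l)))
      (represents (M(b := ys, p := [of_nat (length (xs @ ys))])))"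
    using names p l L by (intro loop_triple_SetVar) (auto simp: representsD)
qed

subsection \<open>Calling a subroutine\<close>

fun clear_below :: "nat \<Rightarrow> com" where
  "clear_below 0 = Skip"
| "clear_below (Suc k) = Seq (clear_below k) (New k)"

definition hide_below :: "nat \<Rightarrow> memory \<Rightarrow> memory" where
  "hide_below K M a = (if a < K then [] else M a)"

lemma loop_triple_clear_below:
  "0 < L \<Longrightarrow> loop_triple L (represents M) (clear_below K)
     (\<lambda>\<sigma>. represents (hide_below K M) \<sigma> \<and> (\<forall>a<K. \<sigma> a = (\<lambda>_. 0)))"
proof (induction K)
  case 0
  then show ?case using loop_triple_Skip by (simp add: hide_below_def[abs_def])
next
  case (Suc K)
  then show ?case unfolding clear_below.simps
    by (intro loop_triple_Seq[OF Suc.IH] loop_triple_New)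
      (auto simp: represents_def hide_below_def less_Suc_eq)
qed

definition load_input :: "nat \<Rightarrow> nat \<Rightarrow> nat \<Rightarrow> exp \<Rightarrow> com" where
  "load_input K i b l = Seq (clear_below K) (tabulate i 0 (Num 0) l (Cell b (Var i)))"

lemma loop_triple_load_input:
  assumes names: "K \<le> i" "K \<le> b" "i \<noteq> b" "0 < K" and M: "M b = ins" "M i = []"
    and L: "length ins < L"
    and bound: "\<And>k \<sigma>. k \<le> length ins \<Longrightarrow> represents ((hide_below K M)(i := [of_nat k])) \<sigma> \<Longrightarrow>
      eval l \<sigma> = Some (of_nat (length ins))"
  shows "loop_triple L (represents M) (load_input K i b l)
    (\<lambda>\<sigma>. represents (hide_below K M) \<sigma> \<and> (\<forall>a<K. \<sigma> a = initial_store ins a))"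
  unfolding load_input_def
proof (rule loop_triple_Seq)
  let ?I = "\<lambda>k \<sigma>. represents (hide_below K M) \<sigma> \<and> (\<forall>a<K. \<sigma> a = initial_store (take k ins) a)"
  show "loop_triple L (represents M) (clear_below K) (?I 0)"
    by (rule loop_triple_weaken[OF loop_triple_clear_below])
      (use L in \<open>auto simp: initial_store_def\<close>)
  have i: "hide_below K M i = []" using M by (simp add: hide_below_def)
  have "loop_triple L (?I 0) (tabulate i 0 (Num 0) l (Cell b (Var i))) (?I (length ins))"
    unfolding tabulate_def
  proof (rule loop_triple_For[OF _ _ _ L])
    fix k assume k: "k < length ins"
    show "loop_triple 1 (\<lambda>\<sigma>. ?I k \<sigma> \<and> \<sigma> i 0 = of_nat k)
        (Assign 0 (Add (Num 0) (Var i)) (Cell b (Var i)))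
        (\<lambda>\<sigma>. ?I (Suc k) \<sigma> \<and> \<sigma> i 0 = of_nat k)"
    proof (rule loop_triple_Assign)
      fix \<sigma> assume I: "?I k \<sigma> \<and> \<sigma> i 0 = of_nat k"
      then have "\<sigma> b k = ins ! k"
        using representsD[of "hide_below K M" \<sigma> k b] k M names by (simp add: hide_below_def)
      moreover have "initial_store (take (Suc k) ins) a
          = (if a = 0 then (initial_store (take k ins) a)(k := ins ! k) else initial_store
            (take k ins) a)" for a
        using k by (auto simp: initial_store_def fun_eq_iff less_Suc_eq)
      ultimately show "\<exists>j v. eval (Add (Num 0) (Var i)) \<sigma> = Some (of_nat j) \<and>
          eval (Cell b (Var i)) \<sigma> = Some v \<and>
          ?I (Suc k) (\<sigma>(0 := (\<sigma> 0)(j := v))) \<and> (\<sigma>(0 := (\<sigma> 0)(j := v))) i 0 = of_nat k"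
        using I names by (intro exI[of _ k] exI[of _ "ins ! k"])
          (auto simp: represents_def hide_below_def)
    qed simp
  next
    fix k \<sigma> v assume "?I k \<sigma>"
    then show "?I k (\<sigma>(i := (\<sigma> i)(0 := v)))" using i names by (auto simp: represents_def)
  qed (use bound i in \<open>auto simp: represents_fun_upd\<close>)
  then show "loop_triple L (?I 0) (tabulate i 0 (Num 0) l (Cell b (Var i)))
      (\<lambda>\<sigma>. represents (hide_below K M) \<sigma> \<and> (\<forall>a<K. \<sigma> a = initial_store ins a))"
    by simp
qed

lemma triple_call:
  assumes E: "computes_in_time E ins outs t" and names: "com_names E \<subseteq> {..<K}" "1 < K"
  shows "triple t (\<lambda>\<sigma>. represents M \<sigma> \<and> (\<forall>a<K. \<sigma> a = initial_store ins a)) E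
    (represents ((hide_below K M)(1 := outs)))"
proof (rule tripleI, elim conjE)
  fix \<sigma> assume M: "represents M \<sigma>" and "\<forall>a<K. \<sigma> a = initial_store ins a"
  then have \<sigma>: "\<sigma> = override_on \<sigma> (initial_store ins) {..<K}" by (auto simp: override_on_def)
  from E obtain k \<sigma>E where run: "exec E (initial_store ins) k \<sigma>E" "k \<le> t"
    and outs: "outs = map (\<sigma>E 1) [0..<length outs]"
    by (auto simp: computes_in_time_def)
  have "exec E \<sigma> k (override_on \<sigma> \<sigma>E {..<K})" using exec_override_on[OF run(1) names(1), of \<sigma>] \<sigma>
    by simp
  moreover have "\<sigma>E 1 j = outs ! j" if "j < length outs" for j
    using arg_cong[OF outs, of "\<lambda>xs. xs ! j"] that by simp
  then have "represents ((hide_below K M)(1 := outs)) (override_on \<sigma> \<sigma>E {..<K})"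
    using M names(2) by (auto simp: represents_def hide_below_def override_on_def)
  ultimately show "\<exists>k \<sigma>'. k \<le> t \<and> exec E \<sigma> k \<sigma>' \<and> represents ((hide_below K M)(1 := outs)) \<sigma>'"
    using run(2) by blast
qed

lemma represents_initial_store: "represents ((\<lambda>_. [])(0 := ins)) (initial_store ins)"
  by (simp add: represents_def initial_store_def)

lemma computes_in_timeI:
  assumes "exec p (initial_store ins) k \<sigma>" "represents ((\<lambda>_. [])(1 := outs)) \<sigma>"
  shows "computes_in_time p ins outs (k + length ins + length outs)"
  unfolding computes_in_time_def
proof (intro exI conjI)
  show "outs = map (\<sigma> 1) [0..<length outs]"
    using representsD[OF assms(2), of _ 1] by (intro nth_equalityI) simp_all
qed (rule assms(1), simp)

section \<open>The potential reduction algorithm\<close>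

definition call_time :: "(nat \<Rightarrow> nat \<Rightarrow> rat \<Rightarrow> real) \<Rightarrow> nat \<Rightarrow> nat \<Rightarrow> nat" where
  "call_time CEF n m = nat \<lfloor>CEF n m (call_precision m)\<rfloor>"

lemma electrical_flow_time_ge:
  fixes CEF :: "nat \<Rightarrow> nat \<Rightarrow> rat \<Rightarrow> real"
  assumes E: "certifying_electrical_flow_algorithm E CEF" and G: "numbered_digraph n m G"
    and \<epsilon>: "\<epsilon> > 0"
  shows "real (3 + 4 * m + 2 * n) \<le> CEF n m \<epsilon>"
proof -
  have "vec m (\<lambda>_. 1 :: rat) $ a > 0" if "a < m" for a using that by simp
  from certifying_electrical_flow_algorithm_energy[OF E G vec_carrier this zero_carrier_vec \<epsilon>]
  obtain f \<pi> t where "computes_in_time E (encode_digraph n m G @ list_of_vec (vec m (\<lambda>_. 1))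
        @ list_of_vec (incidence_mat n m G *\<^sub>v 0\<^sub>v m) @ [\<epsilon>]) (list_of_vec f @ list_of_vec \<pi>) t"
    and "real t \<le> CEF n m \<epsilon>" and "f \<in> carrier_vec m" "\<pi> \<in> carrier_vec n"
    by blast
  then show ?thesis by (auto simp: computes_in_time_def encode_digraph_def)
qed

notation Seq (infixl ";;" 60)

text \<open>The subroutine uses array names below \<open>K + 3\<close> only.\<close>

context
  fixes K :: nat
begin

abbreviation (input) "COUNTER \<equiv> K + 3"
abbreviation (input) "NODES \<equiv> K + 4"
abbreviation (input) "ARCS \<equiv> K + 5"
abbreviation (input) "TAILS \<equiv> K + 6"
abbreviation (input) "HEADS \<equiv> K + 7"
abbreviation (input) "PARAMETER \<equiv> K + 8"
abbreviation (input) "PRIMAL \<equiv> K + 9"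
abbreviation (input) "DUAL \<equiv> K + 10"
abbreviation (input) "SLACK \<equiv> K + 11"
abbreviation (input) "GAP \<equiv> K + 12"
abbreviation (input) "UNFINISHED \<equiv> K + 13"
abbreviation (input) "POSITION \<equiv> K + 14"
abbreviation (input) "RESISTANCE \<equiv> K + 15"
abbreviation (input) "GRADIENT \<equiv> K + 16"
abbreviation (input) "CURRENT \<equiv> K + 17"
abbreviation (input) "INPUT \<equiv> K + 18"
abbreviation (input) "VOLTAGE \<equiv> K + 19"
abbreviation (input) "DROP \<equiv> K + 20"
abbreviation (input) "INDUCED \<equiv> K + 21"
abbreviation (input) "CIRCULATION_ENERGY \<equiv> K + 22"
abbreviation (input) "RESIDUAL_ENERGY \<equiv> K + 23"
abbreviation (input) "PRIMAL_STEP \<equiv> K + 24"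
abbreviation (input) "DUAL_STEP \<equiv> K + 25"

abbreviation (input) entry :: "nat \<Rightarrow> exp" where
  "entry a \<equiv> Cell a (Var COUNTER)"

abbreviation (input) arc_table :: "nat \<Rightarrow> exp \<Rightarrow> com" where
  "arc_table b e \<equiv> table COUNTER b ARCS e"

abbreviation (input) node_table :: "nat \<Rightarrow> exp \<Rightarrow> com" where
  "node_table b e \<equiv> table COUNTER b NODES e"

abbreviation (input) tail_list :: "(nat, nat) pre_digraph \<Rightarrow> nat \<Rightarrow> rat list" where
  "tail_list G m \<equiv> map (\<lambda>a. of_nat (tail G a)) [0..<m]"

abbreviation (input) head_list :: "(nat, nat) pre_digraph \<Rightarrow> nat \<Rightarrow> rat list" where
  "head_list G m \<equiv> map (\<lambda>a. of_nat (head G a)) [0..<m]"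

definition graph_memory :: "nat \<Rightarrow> nat \<Rightarrow> (nat, nat) pre_digraph \<Rightarrow> memory" where
  "graph_memory n m G = (\<lambda>_. [])
     (NODES := [of_nat n], ARCS := [of_nat m],
      TAILS := tail_list G m, HEADS := head_list G m,
      PARAMETER := [of_nat (potential_parameter m)])"

definition point_memory ::
    "nat \<Rightarrow> nat \<Rightarrow> (nat, nat) pre_digraph \<Rightarrow> rat vec \<Rightarrow> rat vec \<Rightarrow> rat vec \<Rightarrow> memory"
  where
  "point_memory n m G x y s = (graph_memory n m G)
     (PRIMAL := list_of_vec x, DUAL := list_of_vec y, SLACK := list_of_vec s, GAP := [x \<bullet> s],
      UNFINISHED := [if x \<bullet> s < 1 then 0 else 1])"

text \<open>Loops test a strict inequality only, so the condition \<open>x\<^sup>T s \<ge> 1\<close> is stored as a flag.\<close>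

definition measure_gap :: com where
  "measure_gap =
     accumulate COUNTER GAP (Var ARCS) (Mul (entry PRIMAL) (entry SLACK)) ;;
     IfLess (Var GAP) (Num 1) (SetVar UNFINISHED (Num 0)) (SetVar UNFINISHED (Num 1))"

definition root_loop :: com where
  "root_loop =
     WhileLess (Mul (Var PARAMETER) (Var PARAMETER)) (Var ARCS)
       (SetVar PARAMETER (Add (Var PARAMETER) (Num 1)))"

definition read_input :: com where
  "read_input =
     SetVar NODES (Cell 0 (Num 0)) ;;
     SetVar ARCS (Cell 0 (Num 1)) ;;
     SetVar POSITION (Num 2) ;;
     read_table COUNTER 0 POSITION TAILS ARCS ;;
     read_table COUNTER 0 POSITION HEADS ARCS ;;
     SetVar POSITION (Add (Var POSITION) (Add (Var NODES) (Var ARCS))) ;;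
     read_table COUNTER 0 POSITION PRIMAL ARCS ;;
     read_table COUNTER 0 POSITION DUAL NODES ;;
     read_table COUNTER 0 POSITION SLACK ARCS"

definition find_parameter :: com where
  "find_parameter =
     SetVar PARAMETER (Num 0) ;;
     root_loop ;;
     SetVar PARAMETER (Add (Var ARCS) (Var PARAMETER))"

definition initialise :: com where
  "initialise = read_input ;; find_parameter ;; measure_gap"

abbreviation (input) add_at :: "nat \<Rightarrow> exp \<Rightarrow> exp \<Rightarrow> com" where
  "add_at b j e \<equiv> Assign b j (Add (Cell b j) e)"

definition sum_currents :: com where
  "sum_currents = For COUNTER (Var ARCS)
     (add_at CURRENT (entry HEADS) (entry GRADIENT) ;;
      add_at CURRENT (entry TAILS) (Sub (Num 0) (entry GRADIENT)))"

definition make_instance :: com where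
  "make_instance =
     arc_table RESISTANCE (Div (Num 1) (Mul (entry PRIMAL) (entry PRIMAL))) ;;
     arc_table GRADIENT (Mul (entry PRIMAL)
       (Sub (Div (Mul (Var PARAMETER) (Mul (entry PRIMAL) (entry SLACK))) (Var GAP)) (Num 1))) ;;
     node_table CURRENT (Num 0) ;;
     sum_currents"

definition write_instance :: com where
  "write_instance =
     SetVar POSITION (Num 0) ;;
     append_value INPUT POSITION (Var NODES) ;;
     append_value INPUT POSITION (Var ARCS) ;;
     append_table COUNTER INPUT POSITION ARCS (entry TAILS) ;;
     append_table COUNTER INPUT POSITION ARCS (entry HEADS) ;;
     append_table COUNTER INPUT POSITION ARCS (entry RESISTANCE) ;;
     append_table COUNTER INPUT POSITION NODES (entry CURRENT) ;;
     append_value INPUT POSITION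
       (Div (Num 1) (Mul (Num 16) (Mul (Var PARAMETER) (Var PARAMETER)))) ;;
     load_input (K + 3) COUNTER INPUT (Var POSITION)"

definition measure_energies :: com where
  "measure_energies =
     node_table VOLTAGE (Cell 1 (Add (Var ARCS) (Var COUNTER))) ;;
     arc_table DROP (Sub (Cell VOLTAGE (entry HEADS)) (Cell VOLTAGE (entry TAILS))) ;;
     arc_table INDUCED (Div (entry DROP) (entry RESISTANCE)) ;;
     accumulate COUNTER CIRCULATION_ENERGY (Var ARCS)
       (Mul (entry RESISTANCE) (Mul (Sub (entry GRADIENT) (entry 1))
         (Sub (entry GRADIENT) (entry 1)))) ;;
     accumulate COUNTER RESIDUAL_ENERGY (Var ARCS)
       (Mul (entry RESISTANCE) (Mul (Sub (entry GRADIENT) (entry INDUCED))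
         (Sub (entry GRADIENT) (entry INDUCED))))"

definition choose_steps :: com where
  "choose_steps =
     IfLess (Num (9 / 64)) (Var RESIDUAL_ENERGY)
       (SetVar PRIMAL_STEP (Div (Num 1) (Mul (Num 128) (Add (Var CIRCULATION_ENERGY) (Num 1)))) ;;
        SetVar DUAL_STEP (Num 0))
       (SetVar PRIMAL_STEP (Num 0) ;;
        SetVar DUAL_STEP (Div (Var GAP) (Var PARAMETER)))"

definition take_steps :: com where
  "take_steps =
     arc_table PRIMAL
       (Sub (entry PRIMAL) (Mul (Var PRIMAL_STEP) (Sub (entry GRADIENT) (entry 1)))) ;;
     arc_table SLACK (Sub (entry SLACK) (Mul (Var DUAL_STEP) (entry DROP))) ;;
     node_table DUAL (Add (entry DUAL) (Mul (Var DUAL_STEP) (entry VOLTAGE))) ;;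
     measure_gap"

definition write_output :: com where
  "write_output =
     SetVar POSITION (Num 0) ;;
     append_table COUNTER 1 POSITION ARCS (entry PRIMAL) ;;
     append_table COUNTER 1 POSITION NODES (entry DUAL) ;;
     append_table COUNTER 1 POSITION ARCS (entry SLACK)"

definition before_call :: com where
  "before_call = make_instance ;; write_instance"

definition after_call :: com where
  "after_call = measure_energies ;; choose_steps ;; take_steps"

definition iteration :: "com \<Rightarrow> com" where
  "iteration E = before_call ;; E ;; after_call"

definition main_loop :: "com \<Rightarrow> com" where
  "main_loop E = WhileLess (Num 0) (Var UNFINISHED) (iteration E)"

definition potential_reduction_algorithm :: "com \<Rightarrow> com" where
  "potential_reduction_algorithm E = initialise ;; main_loop E ;; write_output"

lemma loop_triple_measure_gap:
  assumes M: "M COUNTER = []" "M ARCS = [of_nat m]" "M PRIMAL = list_of_vec x"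
      "M SLACK = list_of_vec s"
    and dims: "x \<in> carrier_vec m" "s \<in> carrier_vec m" and L: "m < L"
  shows "loop_triple L (represents M) measure_gap
    (represents (M(GAP := [x \<bullet> s], UNFINISHED := [if x \<bullet> s < 1 then 0 else 1])))"
  unfolding measure_gap_def
proof (rule loop_triple_Seq)
  have sum: "x \<bullet> s = (\<Sum>a<m. x $ a * s $ a)" using dims
    by (simp add: scalar_prod_def lessThan_atLeast0)
  show "loop_triple L (represents M)
      (accumulate COUNTER GAP (Var ARCS) (Mul (entry PRIMAL) (entry SLACK)))
      (represents (M(GAP := [x \<bullet> s])))"
    unfolding sum using M dims L by (intro loop_triple_accumulate) (auto simp: representsD)
  show "loop_triple L (represents (M(GAP := [x \<bullet> s])))
      (IfLess (Var GAP) (Num 1) (SetVar UNFINISHED (Num 0)) (SetVar UNFINISHED (Num 1)))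
      (represents (M(GAP := [x \<bullet> s], UNFINISHED := [if x \<bullet> s < 1 then 0 else 1])))"
  proof (rule loop_triple_IfLess)
    fix \<sigma> assume "represents (M(GAP := [x \<bullet> s])) \<sigma>"
    then show "\<exists>v w. eval (Var GAP) \<sigma> = Some v \<and> eval (Num 1) \<sigma> = Some w \<and>
        (if v < w then x \<bullet> s < 1 \<and> represents (M(GAP := [x \<bullet> s])) \<sigma>
         else \<not> x \<bullet> s < 1 \<and> represents (M(GAP := [x \<bullet> s])) \<sigma>)"
      by (auto simp: representsD)
  qed (use L in \<open>auto intro!: loop_triple_Assign exI[of _ "0::nat"] simp: represents_def\<close>)
qed

lemma loop_triple_root_loop:
  assumes M: "M ARCS = [of_nat m]" "M PARAMETER = [0]" and L: "m < L"
  shows "loop_triple L (represents M) root_loop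
      (represents (M(PARAMETER := [of_nat (LEAST k. k\<^sup>2 \<ge> m)])))"
proof -
  define r where "r = (LEAST k. k\<^sup>2 \<ge> m)"
  define N where "N j = M(PARAMETER := [of_nat j])" for j
  define I where "I k \<sigma> \<longleftrightarrow> (\<exists>j. j + k = r \<and> represents (N j) \<sigma>)" for k \<sigma>
  define B where "B k \<sigma> \<longleftrightarrow> (\<exists>j. Suc (j + k) = r \<and> represents (N j) \<sigma>)" for k \<sigma>
  have m: "m \<le> m\<^sup>2" by (simp add: power2_eq_square)
  have r: "m \<le> r\<^sup>2" "r \<le> m" unfolding r_def using m by (rule LeastI, intro Least_le)
  have "loop_triple L (I r) root_loop (represents (N r))"
    unfolding root_loop_def
  proof (rule loop_triple_While)
    fix k \<sigma> assume "I k \<sigma>"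
    then obtain j where j: "j + k = r" "represents (N j) \<sigma>" by (auto simp: I_def)
    then have "eval (Mul (Var PARAMETER) (Var PARAMETER)) \<sigma> = Some (of_nat (j\<^sup>2))"
        "eval (Var ARCS) \<sigma> = Some (of_nat m)"
      using M by (simp_all add: N_def representsD power2_eq_square)
    moreover have "j\<^sup>2 < m \<longleftrightarrow> 0 < k"
      using j(1) r(1) not_less_Least[of j "\<lambda>k. m \<le> k\<^sup>2"] by (cases k) (auto simp: r_def)
    moreover have "if 0 < k then B (k - 1) \<sigma> else represents (N r) \<sigma>"
      using j by (cases k) (auto simp: B_def)
    ultimately show "\<exists>v w. eval (Mul (Var PARAMETER) (Var PARAMETER)) \<sigma> = Some v \<and>
        eval (Var ARCS) \<sigma> = Some w \<and>
        (if v < w then 0 < k \<and> B (k - 1) \<sigma> else represents (N r) \<sigma>)"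
      by (intro exI conjI) (auto simp del: of_nat_power)
  next
    fix k
    show "loop_triple 1 (B k) (SetVar PARAMETER (Add (Var PARAMETER) (Num 1))) (I k)"
    proof (rule loop_triple_Assign)
      fix \<sigma> assume "B k \<sigma>"
      then obtain j where "Suc (j + k) = r" "represents (N j) \<sigma>" by (auto simp: B_def)
      then show "\<exists>i v. eval (Num 0) \<sigma> = Some (of_nat i) \<and>
          eval (Add (Var PARAMETER) (Num 1)) \<sigma> = Some v \<and>
          I k (\<sigma>(PARAMETER := (\<sigma> PARAMETER)(i := v)))"
        by (intro exI[of _ 0] exI[of _ "of_nat (Suc j)"])
          (auto simp: I_def N_def represents_def intro!: exI[of _ "Suc j"])
    qed simp
  qed (use r L in simp)
  moreover have "I r \<sigma>" if "represents M \<sigma>" for \<sigma>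
    using that M by (auto simp: I_def N_def represents_def)
  ultimately show ?thesis by (auto simp: N_def r_def elim: loop_triple_weaken)
qed

lemma loop_triple_sum_currents:
  assumes G: "numbered_digraph n m G" and M: "M COUNTER = []" "M ARCS = [of_nat m]"
    "M TAILS = tail_list G m" "M HEADS = head_list G m"
    "M GRADIENT = list_of_vec u" "M CURRENT = replicate n 0"
    and u: "u \<in> carrier_vec m" and L: "m < L"
  shows "loop_triple L (represents M) sum_currents
    (represents (M(CURRENT := list_of_vec (incidence_mat n m G *\<^sub>v u))))"
proof -
  define partial where "partial k = map (\<lambda>v. \<Sum>a<k. incidence_mat n m G $$ (v, a) * u $ a) [0..<n]"
    for k
  define N where "N k = M(CURRENT := partial k)" for k
  have "loop_triple L (represents (N 0)) sum_currents (represents (N m))"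
    unfolding sum_currents_def
  proof (rule loop_triple_For_memory[where M = N, OF _ L])
    fix k assume k: "k < m"
    define w where "w = (partial k)[head G k := partial k ! head G k + u $ k]"
    note bounds = numbered_digraph_bounds[OF G k]
    let ?N = "(N k)(COUNTER := [of_nat k])"
    have "loop_triple 1 (represents ?N) (add_at CURRENT (entry HEADS) (entry GRADIENT))
        (represents (?N(CURRENT := w)))"
      using k u M bounds
        loop_triple_Assign_memory[of ?N "entry HEADS" "head G k"
          "Add (Cell CURRENT (entry HEADS)) (entry GRADIENT)"
          "partial k ! head G k + u $ k" CURRENT 1]
      by (simp add: N_def representsD partial_def w_def upd_conv_take_nth_drop)
    also have "loop_triple 1 (represents (?N(CURRENT := w)))
        (add_at CURRENT (entry TAILS) (Sub (Num 0) (entry GRADIENT)))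
        (represents (?N(CURRENT := w[tail G k := w ! tail G k - u $ k])))"
      using k u M bounds
        loop_triple_Assign_memory[of "?N(CURRENT := w)" "entry TAILS" "tail G k"
          "Add (Cell CURRENT (entry TAILS)) (Sub (Num 0) (entry GRADIENT))"
            "w ! tail G k - u $ k" CURRENT 1]
      by (simp add: N_def representsD partial_def w_def upd_conv_take_nth_drop)
    also have "w[tail G k := w ! tail G k - u $ k] = partial (Suc k)"
      using bounds k
      by (intro nth_equalityI) (auto simp: w_def partial_def incidence_mat_def nth_list_update
        left_diff_distrib)
    also have "?N(CURRENT := partial (Suc k)) = (N (Suc k))(COUNTER := [of_nat k])"
      by (auto simp: N_def)
    finally show "loop_triple 1 (represents ?N)
       (add_at CURRENT (entry HEADS) (entry GRADIENT) ;;
        add_at CURRENT (entry TAILS) (Sub (Num 0) (entry GRADIENT)))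
       (represents ((N (Suc k))(COUNTER := [of_nat k])))" .
  qed (use M in \<open>auto simp: N_def representsD\<close>)
  moreover have "N 0 = M" using M by (auto simp: N_def partial_def map_replicate_const)
  moreover have "partial m = list_of_vec (incidence_mat n m G *\<^sub>v u)"
    unfolding partial_def list_of_vec_map using incidence_mat_mult_vec[OF u, of _ n G] by simp
  ultimately show ?thesis by (simp add: N_def)
qed

lemma loop_triple_find_parameter:
  assumes M: "M ARCS = [of_nat m]" and L: "m < L"
  shows "loop_triple L (represents M) find_parameter
      (represents (M(PARAMETER := [of_nat (potential_parameter m)])))"
proof -
  let ?r = "LEAST k. k\<^sup>2 \<ge> m"
  have "loop_triple L (represents M) (SetVar PARAMETER (Num 0)) (represents (M(PARAMETER := [0])))"
    using L by (intro loop_triple_SetVar) auto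
  also have "loop_triple L \<dots> root_loop (represents (M(PARAMETER := [0], PARAMETER := [of_nat ?r])))"
    using M L by (intro loop_triple_root_loop) auto
  also have "loop_triple L \<dots> (SetVar PARAMETER (Add (Var ARCS) (Var PARAMETER)))
      (represents (M(PARAMETER := [0], PARAMETER := [of_nat ?r],
        PARAMETER := [of_nat (potential_parameter m)])))"
    using M L by (intro loop_triple_SetVar) (auto simp: representsD potential_parameter_def)
  finally show ?thesis unfolding find_parameter_def by simp
qed

lemma loop_triple_read_input:
  assumes dims: "length bc = n + m" "length xs = m" "length ys = n" "length ss = m"
    and L: "n < L" "m < L"
  shows "loop_triple L (represents ((\<lambda>_. [])(0 := encode_digraph n m G @ bc @ xs @ ys @ ss)))
      read_input
    (represents ((\<lambda>_. [])(NODES := [of_nat n], ARCS := [of_nat m], TAILS := tail_list G m,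
      HEADS := head_list G m,
      PRIMAL := xs, DUAL := ys, SLACK := ss)))"
proof -
  let ?ts = "tail_list G m" and ?hs = "head_list G m"
  let ?head = "[of_nat n, of_nat m] :: rat list"
  let ?at = "\<lambda>xs. [of_nat (length xs)] :: rat list"
  let ?ins = "?head @ ?ts @ ?hs @ bc @ xs @ ys @ ss"
  let ?M0 = "(\<lambda>_. [])(0 := ?ins)"
  let ?M1 = "?M0(NODES := [of_nat n], ARCS := [of_nat m], POSITION := ?at ?head)"
  let ?M2 = "?M1(TAILS := ?ts, POSITION := ?at (?head @ ?ts))"
  let ?M3 = "?M2(HEADS := ?hs, POSITION := ?at ((?head @ ?ts) @ ?hs))"
  let ?M4 = "?M3(POSITION := ?at (?head @ ?ts @ ?hs @ bc))"
  let ?M5 = "?M4(PRIMAL := xs, POSITION := ?at ((?head @ ?ts @ ?hs @ bc) @ xs))"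
  let ?M6 = "?M5(DUAL := ys, POSITION := ?at ((?head @ ?ts @ ?hs @ bc @ xs) @ ys))"
  let ?M7 = "?M6(SLACK := ss, POSITION := ?at ((?head @ ?ts @ ?hs @ bc @ xs @ ys) @ ss))"
  have "loop_triple L (represents ?M0) (SetVar NODES (Cell 0 (Num 0)))
      (represents (?M0(NODES := [of_nat n])))"
    using L by (intro loop_triple_SetVar) (auto simp: representsD)
  also have "loop_triple L \<dots> (SetVar ARCS (Cell 0 (Num 1)))
      (represents (?M0(NODES := [of_nat n], ARCS := [of_nat m])))"
    using L by (intro loop_triple_SetVar) (auto simp: representsD)
  also have "loop_triple L \<dots> (SetVar POSITION (Num 2)) (represents ?M1)"
    using L by (intro loop_triple_SetVar) auto
  also have "loop_triple L \<dots> (read_table COUNTER 0 POSITION TAILS ARCS) (represents ?M2)"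
    using L by (intro loop_triple_read_table[where xs = ?head and ys = ?ts]) auto
  also have "loop_triple L \<dots> (read_table COUNTER 0 POSITION HEADS ARCS) (represents ?M3)"
    using L by (intro loop_triple_read_table[where xs = "?head @ ?ts"]) auto
  also have "loop_triple L \<dots> (SetVar POSITION (Add (Var POSITION) (Add (Var NODES) (Var ARCS))))
      (represents ?M4)"
    using L dims by (intro loop_triple_SetVar) (auto simp: representsD)
  also have "loop_triple L \<dots> (read_table COUNTER 0 POSITION PRIMAL ARCS) (represents ?M5)"
    using L dims by (intro loop_triple_read_table[where xs = "?head @ ?ts @ ?hs @ bc"]) auto
  also have "loop_triple L \<dots> (read_table COUNTER 0 POSITION DUAL NODES) (represents ?M6)"
    using L dims by (intro loop_triple_read_table[where xs = "?head @ ?ts @ ?hs @ bc @ xs"]) auto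
  also have "loop_triple L \<dots> (read_table COUNTER 0 POSITION SLACK ARCS) (represents ?M7)"
    using L dims by (intro loop_triple_read_table[where xs = "?head @ ?ts @ ?hs @ bc @ xs @ ys"])
      auto
  finally show ?thesis unfolding read_input_def
    by (rule loop_triple_weaken) (auto elim!: represents_mono simp: encode_digraph_def)
qed

lemma loop_triple_initialise:
  assumes dims: "b \<in> carrier_vec n" "c \<in> carrier_vec m" "x \<in> carrier_vec m" "y \<in> carrier_vec n"
      "s \<in> carrier_vec m"
    and L: "n < L" "m < L"
  shows "loop_triple L (represents
      ((\<lambda>_. [])(0 := encode_digraph n m G @ list_of_vec b @ list_of_vec c
      @ list_of_vec x @ list_of_vec y @ list_of_vec s)))
    initialise (represents (point_memory n m G x y s))"
proof -
  let ?M = "(\<lambda>_. [])(NODES := [of_nat n], ARCS := [of_nat m],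
    TAILS := tail_list G m, HEADS := head_list G m,
    PRIMAL := list_of_vec x, DUAL := list_of_vec y, SLACK := list_of_vec s)"
  let ?M1 = "?M(PARAMETER := [of_nat (potential_parameter m)])"
  have "loop_triple L (represents
      ((\<lambda>_. [])(0 := encode_digraph n m G @ list_of_vec b @ list_of_vec c
      @ list_of_vec x @ list_of_vec y @ list_of_vec s))) read_input (represents ?M)"
    using loop_triple_read_input[of "list_of_vec b @ list_of_vec c" n m] dims L by simp
  also have "loop_triple L \<dots> find_parameter (represents ?M1)"
    using L by (intro loop_triple_find_parameter) auto
  also have "loop_triple L \<dots> measure_gap
      (represents (?M1(GAP := [x \<bullet> s], UNFINISHED := [if x \<bullet> s < 1 then 0 else 1])))"
    using L dims by (intro loop_triple_measure_gap[where m = m]) auto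
  finally show ?thesis unfolding initialise_def
    by (rule loop_triple_weaken)
      (auto elim!: represents_mono simp: point_memory_def graph_memory_def)
qed

lemma loop_triple_make_instance:
  assumes G: "numbered_digraph n m G" and x: "x \<in> carrier_vec m" "\<And>a. a < m \<Longrightarrow> x $ a > 0"
    and s: "s \<in> carrier_vec m" and gap: "x \<bullet> s \<noteq> 0" and L: "n < L" "m < L"
  defines "u \<equiv> gradient_flow x s"
  shows "loop_triple L (represents (point_memory n m G x y s)) make_instance
    (represents ((point_memory n m G x y s)(RESISTANCE := list_of_vec (barrier_resistances x),
      GRADIENT := list_of_vec u, CURRENT := list_of_vec (incidence_mat n m G *\<^sub>v u))))"
proof -
  let ?M = "point_memory n m G x y s"
  let ?M1 = "?M(RESISTANCE := list_of_vec (barrier_resistances x))"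
  let ?M2 = "?M1(GRADIENT := list_of_vec u)"
  let ?M3 = "?M2(CURRENT := replicate n 0)"
  note memory = point_memory_def graph_memory_def
  have u: "u \<in> carrier_vec m" using x by (simp add: u_def)
  have "loop_triple L (represents ?M)
      (arc_table RESISTANCE (Div (Num 1) (Mul (entry PRIMAL) (entry PRIMAL)))) (represents ?M1)"
    using x L by (intro loop_triple_table)
      (fastforce simp: memory representsD barrier_resistances_def power2_eq_square)+
  also have "loop_triple L \<dots> (arc_table GRADIENT (Mul (entry PRIMAL)
      (Sub (Div (Mul (Var PARAMETER) (Mul (entry PRIMAL) (entry SLACK))) (Var GAP)) (Num 1))))
        (represents ?M2)"
    using x s u gap L by (intro loop_triple_table)
      (auto simp: memory representsD u_def gradient_flow_def)
  also have "loop_triple L \<dots> (node_table CURRENT (Num 0)) (represents ?M3)"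
    using L by (intro loop_triple_table) (auto simp: memory)
  also have "loop_triple L \<dots> sum_currents
      (represents (?M3(CURRENT := list_of_vec (incidence_mat n m G *\<^sub>v u))))"
    using u L by (intro loop_triple_sum_currents[OF G]) (auto simp: memory)
  finally show ?thesis unfolding make_instance_def by simp
qed

lemma loop_triple_write_instance:
  assumes M: "M COUNTER = []" "M INPUT = []" "M POSITION = []" "M NODES = [of_nat n]"
      "M ARCS = [of_nat m]"
      "M TAILS = tail_list G m" "M HEADS = head_list G m"
      "M RESISTANCE = list_of_vec r" "M CURRENT = list_of_vec \<chi>" "M PARAMETER = [of_nat q]"
    and dims: "r \<in> carrier_vec m" "\<chi> \<in> carrier_vec n" "0 < q"
    and ins: "ins = encode_digraph n m G @ list_of_vec r @ list_of_vec \<chi> @ [1 / (16 * (of_nat q)\<^sup>2)]"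
    and L: "length ins < L"
  shows "loop_triple L (represents M) write_instance
    (\<lambda>\<sigma>. represents (hide_below (K + 3) M) \<sigma> \<and> (\<forall>a<K + 3. \<sigma> a = initial_store ins a))"
proof -
  let ?add = "extend INPUT POSITION"
  let ?tails = "tail_list G m" and ?heads = "head_list G m"
  let ?\<epsilon> = "1 / (16 * (of_nat q)\<^sup>2) :: rat"
  let ?M1 = "?add [of_nat n] (M(POSITION := [0]))"
  let ?M2 = "?add [of_nat m] ?M1"
  let ?M3 = "?add ?tails ?M2"
  let ?M4 = "?add ?heads ?M3"
  let ?M5 = "?add (list_of_vec r) ?M4"
  let ?M6 = "?add (list_of_vec \<chi>) ?M5"
  let ?M7 = "?add [?\<epsilon>] ?M6"
  have L': "n < L" "m < L" using L dims by (simp_all add: ins encode_digraph_def)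
  have input: "?M7 INPUT = ins" "?M7 POSITION = [of_nat (length ins)]"
    using M dims by (simp_all add: ins encode_digraph_def extend_def)
  have "loop_triple L (represents M) (SetVar POSITION (Num 0)) (represents (M(POSITION := [0])))"
    using L' by (intro loop_triple_SetVar) auto
  also have "loop_triple L \<dots> (append_value INPUT POSITION (Var NODES)) (represents ?M1)"
    using M L' by (intro loop_triple_append_value) (auto simp: representsD)
  also have "loop_triple L \<dots> (append_value INPUT POSITION (Var ARCS)) (represents ?M2)"
    using M L' by (intro loop_triple_append_value) (auto simp: representsD extend_def)
  also have "loop_triple L \<dots> (append_table COUNTER INPUT POSITION ARCS (entry TAILS))
      (represents ?M3)"
    using M L' by (intro loop_triple_append_table) (auto simp: representsD extend_def)
  also have "loop_triple L \<dots> (append_table COUNTER INPUT POSITION ARCS (entry HEADS))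
      (represents ?M4)"
    using M L' by (intro loop_triple_append_table) (auto simp: representsD extend_def)
  also have "loop_triple L \<dots> (append_table COUNTER INPUT POSITION ARCS (entry RESISTANCE))
      (represents ?M5)"
    using M L' dims by (intro loop_triple_append_table) (auto simp: representsD extend_def)
  also have "loop_triple L \<dots> (append_table COUNTER INPUT POSITION NODES (entry CURRENT))
      (represents ?M6)"
    using M L' dims by (intro loop_triple_append_table) (auto simp: representsD extend_def)
  also have "loop_triple L \<dots> (append_value INPUT POSITION
      (Div (Num 1) (Mul (Num 16) (Mul (Var PARAMETER) (Var PARAMETER))))) (represents ?M7)"
    using M L' dims by (intro loop_triple_append_value)
      (auto simp: representsD extend_def power2_eq_square)
  also have "loop_triple L \<dots> (load_input (K + 3) COUNTER INPUT (Var POSITION))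
      (\<lambda>\<sigma>. represents (hide_below (K + 3) ?M7) \<sigma> \<and> (\<forall>a<K + 3. \<sigma> a = initial_store ins a))"
    using input M L by (intro loop_triple_load_input)
      (auto simp: representsD hide_below_def extend_def)
  finally show ?thesis unfolding write_instance_def
    by (rule loop_triple_weaken)
      (use M in \<open>auto elim!: represents_mono simp: hide_below_def extend_def\<close>)
qed

lemma loop_triple_measure_energies:
  assumes G: "numbered_digraph n m G"
    and dims: "x \<in> carrier_vec m" "f \<in> carrier_vec m" "\<pi> \<in> carrier_vec n"
    and x: "\<And>a. a < m \<Longrightarrow> x $ a > 0" and L: "n < L" "m < L"
    and M: "M COUNTER = []" "M NODES = [of_nat n]" "M ARCS = [of_nat m]"
      "M TAILS = tail_list G m" "M HEADS = head_list G m"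
      "M RESISTANCE = list_of_vec (barrier_resistances x)"
        "M GRADIENT = list_of_vec (gradient_flow x s)"
      "M 1 = list_of_vec f @ list_of_vec \<pi>"
  defines "A \<equiv> incidence_mat n m G"
  shows "loop_triple L (represents M) measure_energies (represents (M(VOLTAGE := list_of_vec \<pi>,
    DROP := list_of_vec (A\<^sup>T *\<^sub>v \<pi>), INDUCED := list_of_vec
      (induced_flow A (barrier_resistances x) \<pi>),
    CIRCULATION_ENERGY := [circulation_energy x s f],
      RESIDUAL_ENERGY := [residual_energy A x s \<pi>])))"
proof -
  let ?r = "barrier_resistances x" and ?u = "gradient_flow x s"
  let ?h = "induced_flow A ?r \<pi>"
  let ?M1 = "M(VOLTAGE := list_of_vec \<pi>)"
  let ?M2 = "?M1(DROP := list_of_vec (A\<^sup>T *\<^sub>v \<pi>))"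
  let ?M3 = "?M2(INDUCED := list_of_vec ?h)"
  let ?M4 = "?M3(CIRCULATION_ENERGY := [circulation_energy x s f])"
  have r: "?r $ a \<noteq> 0" if "a < m" for a using dims x[OF that] that
    by (simp add: barrier_resistances_def)
  have drop: "(A\<^sup>T *\<^sub>v \<pi>) $ a = \<pi> $ head G a - \<pi> $ tail G a" if "a < m" for a
    unfolding A_def by (rule incidence_mat_transpose_mult_vec[OF G dims(3) that])
  have dim_drop: "dim_vec (A\<^sup>T *\<^sub>v \<pi>) = m" by (simp add: A_def)
  note bounds = numbered_digraph_bounds[OF G]
  have circulation: "circulation_energy x s f
      = (\<Sum>a<m. ?r $ a * ((?u $ a - f $ a) * (?u $ a - f $ a)))"
    using dims by (simp add: circulation_energy_def energy_def energy_inner_def)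
  have residual: "residual_energy A x s \<pi>
      = (\<Sum>a<m. ?r $ a * ((?u $ a - ?h $ a) * (?u $ a - ?h $ a)))"
    using dims by (simp add: residual_energy_def energy_def energy_inner_def)
  have "loop_triple L (represents M) (node_table VOLTAGE (Cell 1 (Add (Var ARCS) (Var COUNTER))))
      (represents ?M1)"
    using M dims L by (intro loop_triple_table) (auto simp: representsD nth_append)
  also have "loop_triple L \<dots>
      (arc_table DROP (Sub (Cell VOLTAGE (entry HEADS)) (Cell VOLTAGE (entry TAILS))))
        (represents ?M2)"
    using M dims L bounds by (intro loop_triple_table)
      (auto simp: representsD drop dim_drop simp del: index_mult_mat_vec dim_mult_mat_vec)
  also have "loop_triple L \<dots> (arc_table INDUCED (Div (entry DROP) (entry RESISTANCE)))
      (represents ?M3)"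
    using M L r dims by (intro loop_triple_table)
      (auto simp: representsD induced_flow_def dim_drop simp del: index_mult_mat_vec
        dim_mult_mat_vec)
  also have "loop_triple L \<dots> (accumulate COUNTER CIRCULATION_ENERGY (Var ARCS)
      (Mul (entry RESISTANCE) (Mul (Sub (entry GRADIENT) (entry 1))
        (Sub (entry GRADIENT) (entry 1))))) (represents ?M4)"
    unfolding circulation using M L dims
    by (intro loop_triple_accumulate) (auto simp: representsD nth_append)
  also have "loop_triple L \<dots> (accumulate COUNTER RESIDUAL_ENERGY (Var ARCS)
      (Mul (entry RESISTANCE) (Mul (Sub (entry GRADIENT) (entry INDUCED))
        (Sub (entry GRADIENT) (entry INDUCED)))))
      (represents (?M4(RESIDUAL_ENERGY := [residual_energy A x s \<pi>])))"
    unfolding residual using M L dims by (intro loop_triple_accumulate) (auto simp: representsD)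
  finally show ?thesis unfolding measure_energies_def .
qed

lemma loop_triple_choose_steps:
  assumes dims: "x \<in> carrier_vec m" and m: "m \<ge> 1" and L: "0 < L"
    and nonneg: "circulation_energy x s f \<ge> 0"
    and M: "M RESIDUAL_ENERGY = [residual_energy A x s \<pi>]"
        "M CIRCULATION_ENERGY = [circulation_energy x s f]"
      "M GAP = [x \<bullet> s]" "M PARAMETER = [of_nat (potential_parameter m)]"
  shows "loop_triple L (represents M) choose_steps
    (represents (M(PRIMAL_STEP := [primal_step_size A x s f \<pi>],
      DUAL_STEP := [dual_step_size A x s \<pi>])))"
  unfolding choose_steps_def
proof (rule loop_triple_IfLess)
  fix \<sigma> assume "represents M \<sigma>"
  then show "\<exists>v w. eval (Num (9 / 64)) \<sigma> = Some v \<and> eval (Var RESIDUAL_ENERGY) \<sigma> = Some w \<and>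
      (if v < w then 9 / 64 < residual_energy A x s \<pi> \<and> represents M \<sigma>
       else \<not> 9 / 64 < residual_energy A x s \<pi> \<and> represents M \<sigma>)"
    using M by (intro exI[of _ "9 / 64"] exI[of _ "residual_energy A x s \<pi>"])
      (simp add: representsD)
next
  let ?\<alpha> = "1 / (128 * (circulation_energy x s f + 1))"
    and ?\<beta> = "(x \<bullet> s) / of_nat (potential_parameter m)"
  have "circulation_energy x s f + 1 \<noteq> 0" using nonneg by simp
  then have "loop_triple L (represents M)
      (SetVar PRIMAL_STEP (Div (Num 1) (Mul (Num 128) (Add (Var CIRCULATION_ENERGY) (Num 1)))))
      (represents (M(PRIMAL_STEP := [?\<alpha>])))"
    using M L by (intro loop_triple_SetVar) (auto simp: representsD)
  also have "loop_triple L \<dots> (SetVar DUAL_STEP (Num 0))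
      (represents (M(PRIMAL_STEP := [?\<alpha>], DUAL_STEP := [0])))"
    using L by (intro loop_triple_SetVar) auto
  finally show "loop_triple L (\<lambda>\<sigma>. 9 / 64 < residual_energy A x s \<pi> \<and> represents M \<sigma>)
      (SetVar PRIMAL_STEP (Div (Num 1) (Mul (Num 128) (Add (Var CIRCULATION_ENERGY) (Num 1)))) ;;
       SetVar DUAL_STEP (Num 0))
      (represents (M(PRIMAL_STEP := [primal_step_size A x s f \<pi>],
        DUAL_STEP := [dual_step_size A x s \<pi>])))"
    unfolding loop_triple_def triple_def primal_step_size_def dual_step_size_def by auto
  have "loop_triple L (represents M) (SetVar PRIMAL_STEP (Num 0))
      (represents (M(PRIMAL_STEP := [0])))"
    using L by (intro loop_triple_SetVar) auto
  also have "potential_parameter m \<noteq> 0" using potential_parameter_pos[OF m] by simp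
  then have "loop_triple L (represents (M(PRIMAL_STEP := [0])))
      (SetVar DUAL_STEP (Div (Var GAP) (Var PARAMETER)))
      (represents (M(PRIMAL_STEP := [0], DUAL_STEP := [?\<beta>])))"
    using M L by (intro loop_triple_SetVar) (auto simp: representsD)
  finally show "loop_triple L (\<lambda>\<sigma>. \<not> 9 / 64 < residual_energy A x s \<pi> \<and> represents M \<sigma>)
      (SetVar PRIMAL_STEP (Num 0) ;; SetVar DUAL_STEP (Div (Var GAP) (Var PARAMETER)))
      (represents (M(PRIMAL_STEP := [primal_step_size A x s f \<pi>],
        DUAL_STEP := [dual_step_size A x s \<pi>])))"
    using dims unfolding loop_triple_def triple_def primal_step_size_def dual_step_size_def by auto
qed fact

lemma loop_triple_take_steps:
  assumes dims: "x \<in> carrier_vec m" "y \<in> carrier_vec n" "s \<in> carrier_vec m" "f \<in> carrier_vec m"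
      "\<pi> \<in> carrier_vec n"
    and A: "A \<in> carrier_mat n m" and L: "n < L" "m < L"
  defines "\<beta> \<equiv> dual_step_size A x s \<pi>"
  defines "x' \<equiv> primal_step A x s f \<pi>" and "y' \<equiv> y + \<beta> \<cdot>\<^sub>v \<pi>" and "s' \<equiv> slack_step A x s \<pi>"
  assumes M: "M COUNTER = []" "M NODES = [of_nat n]" "M ARCS = [of_nat m]"
      "M PRIMAL = list_of_vec x" "M DUAL = list_of_vec y" "M SLACK = list_of_vec s"
      "M GRADIENT = list_of_vec (gradient_flow x s)" "M DROP = list_of_vec (A\<^sup>T *\<^sub>v \<pi>)"
        "M VOLTAGE = list_of_vec \<pi>"
      "M 1 = list_of_vec f @ list_of_vec \<pi>"
      "M PRIMAL_STEP = [primal_step_size A x s f \<pi>]" "M DUAL_STEP = [\<beta>]"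
  shows "loop_triple L (represents M) take_steps
      (represents (M(PRIMAL := list_of_vec x', SLACK := list_of_vec s',
    DUAL := list_of_vec y', GAP := [x' \<bullet> s'], UNFINISHED := [if x' \<bullet> s' < 1 then 0 else 1])))"
proof -
  let ?M1 = "M(PRIMAL := list_of_vec x')"
  let ?M2 = "?M1(SLACK := list_of_vec s')"
  let ?M3 = "?M2(DUAL := list_of_vec y')"
  have new_dims: "x' \<in> carrier_vec m" "s' \<in> carrier_vec m"
    using dims A by (auto simp: x'_def s'_def primal_step_def slack_step_def intro!: carrier_vecI)
  have "loop_triple L (represents M) (arc_table PRIMAL (Sub (entry PRIMAL)
      (Mul (Var PRIMAL_STEP) (Sub (entry GRADIENT) (entry 1))))) (represents ?M1)"
    using M dims L by (intro loop_triple_table)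
      (auto simp: representsD nth_append x'_def primal_step_def)
  also have "loop_triple L \<dots>
      (arc_table SLACK (Sub (entry SLACK) (Mul (Var DUAL_STEP) (entry DROP)))) (represents ?M2)"
    using M dims A L by (intro loop_triple_table)
      (auto simp: representsD nth_append s'_def \<beta>_def slack_step_def simp del: index_mult_mat_vec)
  also have "loop_triple L \<dots>
      (node_table DUAL (Add (entry DUAL) (Mul (Var DUAL_STEP) (entry VOLTAGE)))) (represents ?M3)"
    using M dims L by (intro loop_triple_table) (auto simp: representsD nth_append y'_def)
  also have "loop_triple L \<dots> measure_gap
      (represents (?M3(GAP := [x' \<bullet> s'], UNFINISHED := [if x' \<bullet> s' < 1 then 0 else 1])))"
    using M L new_dims by (intro loop_triple_measure_gap[where m = m]) auto
  finally show ?thesis unfolding take_steps_def .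
qed

lemma loop_triple_write_output:
  assumes dims: "x \<in> carrier_vec m" "y \<in> carrier_vec n" "s \<in> carrier_vec m" and L: "n < L" "m < L"
  shows "loop_triple L (represents (point_memory n m G x y s)) write_output
    (represents ((\<lambda>_. [])(1 := list_of_vec x @ list_of_vec y @ list_of_vec s)))"
proof -
  let ?M = "point_memory n m G x y s"
  let ?M1 = "extend 1 POSITION (list_of_vec x) (?M(POSITION := [0]))"
  let ?M2 = "extend 1 POSITION (list_of_vec y) ?M1"
  let ?M3 = "extend 1 POSITION (list_of_vec s) ?M2"
  note memory = point_memory_def graph_memory_def extend_def
  have "loop_triple L (represents ?M) (SetVar POSITION (Num 0)) (represents (?M(POSITION := [0])))"
    using L by (intro loop_triple_SetVar) auto
  also have "loop_triple L \<dots> (append_table COUNTER 1 POSITION ARCS (entry PRIMAL)) (represents ?M1)"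
    using dims L by (intro loop_triple_append_table) (auto simp: memory representsD)
  also have "loop_triple L \<dots> (append_table COUNTER 1 POSITION NODES (entry DUAL)) (represents ?M2)"
    using dims L by (intro loop_triple_append_table) (auto simp: memory representsD)
  also have "loop_triple L \<dots> (append_table COUNTER 1 POSITION ARCS (entry SLACK)) (represents ?M3)"
    using dims L by (intro loop_triple_append_table) (auto simp: memory representsD)
  finally show ?thesis unfolding write_output_def
    by (rule loop_triple_weaken) (auto elim!: represents_mono simp: memory)
qed

definition call_input :: "nat \<Rightarrow> nat \<Rightarrow> (nat, nat) pre_digraph \<Rightarrow> rat vec \<Rightarrow> rat vec \<Rightarrow> rat list" where
  "call_input n m G x s = encode_digraph n m G @ list_of_vec (barrier_resistances x)
     @ list_of_vec (incidence_mat n m G *\<^sub>v gradient_flow x s)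
     @ [call_precision m]"

definition call_memory ::
    "nat \<Rightarrow> nat \<Rightarrow> (nat, nat) pre_digraph \<Rightarrow> rat vec \<Rightarrow> rat vec \<Rightarrow> rat vec \<Rightarrow> memory"
  where
  "call_memory n m G x y s = (point_memory n m G x y s)
     (RESISTANCE := list_of_vec (barrier_resistances x), GRADIENT := list_of_vec
       (gradient_flow x s))"

lemma length_call_input:
  "x \<in> carrier_vec m \<Longrightarrow> length (call_input n m G x s) = 3 + 3 * m + n"
  by (simp add: call_input_def encode_digraph_def)

lemma loop_triple_before_call:
  assumes G: "numbered_digraph n m G" and m: "m \<ge> 1"
    and x: "x \<in> carrier_vec m" "\<And>a. a < m \<Longrightarrow> x $ a > 0"
    and s: "s \<in> carrier_vec m" and gap: "x \<bullet> s \<noteq> 0" and L: "3 + 3 * m + n < L"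
  shows "loop_triple L (represents (point_memory n m G x y s)) before_call
    (\<lambda>\<sigma>. represents (call_memory n m G x y s) \<sigma> \<and>
      (\<forall>a<K + 3. \<sigma> a = initial_store (call_input n m G x s) a))"
proof -
  let ?\<chi> = "incidence_mat n m G *\<^sub>v gradient_flow x s"
  let ?M = "(call_memory n m G x y s)(CURRENT := list_of_vec ?\<chi>)"
  note memory = call_memory_def point_memory_def graph_memory_def
  have q: "0 < potential_parameter m" using potential_parameter_pos[OF m] by simp
  have \<chi>: "?\<chi> \<in> carrier_vec n" by (intro carrier_vecI) simp
  have "loop_triple L (represents (point_memory n m G x y s)) make_instance (represents ?M)"
    unfolding call_memory_def using L by (intro loop_triple_make_instance[OF G x s gap]) auto
  also have "loop_triple L \<dots> write_instance
      (\<lambda>\<sigma>. represents (hide_below (K + 3) ?M) \<sigma> \<and>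
        (\<forall>a<K + 3. \<sigma> a = initial_store (call_input n m G x s) a))"
    using L x by (intro loop_triple_write_instance[OF _ _ _ _ _ _ _ _ _ _ _ \<chi> q call_input_def])
      (auto simp: memory length_call_input)
  finally show ?thesis unfolding before_call_def
    by (rule loop_triple_weaken) (auto elim!: represents_mono simp: memory hide_below_def)
qed

lemma loop_triple_after_call:
  assumes G: "numbered_digraph n m G" and m: "m \<ge> 1"
    and dims: "x \<in> carrier_vec m" "y \<in> carrier_vec n" "s \<in> carrier_vec m" "f \<in> carrier_vec m"
        "\<pi> \<in> carrier_vec n"
    and x: "\<And>a. a < m \<Longrightarrow> x $ a > 0" and L: "n < L" "m < L"
  defines "A \<equiv> incidence_mat n m G"
  shows "loop_triple L (represents ((call_memory n m G x y s)(1 := list_of_vec f @ list_of_vec \<pi>)))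
      after_call
    (represents (point_memory n m G (primal_step A x s f \<pi>) (y + dual_step_size A x s \<pi> \<cdot>\<^sub>v \<pi>)
      (slack_step A x s \<pi>)))"
proof -
  let ?M = "(call_memory n m G x y s)(1 := list_of_vec f @ list_of_vec \<pi>)"
  let ?x' = "primal_step A x s f \<pi>" and ?y' = "y + dual_step_size A x s \<pi> \<cdot>\<^sub>v \<pi>"
    and ?s' = "slack_step A x s \<pi>"
  let ?M1 = "?M(VOLTAGE := list_of_vec \<pi>,
    DROP := list_of_vec (A\<^sup>T *\<^sub>v \<pi>), INDUCED := list_of_vec
      (induced_flow A (barrier_resistances x) \<pi>),
    CIRCULATION_ENERGY := [circulation_energy x s f], RESIDUAL_ENERGY := [residual_energy A x s \<pi>])"
  let ?M2 = "?M1(PRIMAL_STEP := [primal_step_size A x s f \<pi>],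
      DUAL_STEP := [dual_step_size A x s \<pi>])"
  note memory = call_memory_def point_memory_def graph_memory_def
  have A: "A \<in> carrier_mat n m" by (simp add: A_def)
  have nonneg: "circulation_energy x s f \<ge> 0"
    unfolding circulation_energy_def using barrier_resistances_pos[OF dims(1) x] dims
    by (intro energy_nonneg) auto
  have "loop_triple L (represents ?M) measure_energies (represents ?M1)"
    unfolding A_def using dims x L by (intro loop_triple_measure_energies[OF G]) (auto simp: memory)
  also have "loop_triple L \<dots> choose_steps (represents ?M2)"
    using L by (intro loop_triple_choose_steps[OF dims(1) m _ nonneg]) (auto simp: memory)
  also have "loop_triple L \<dots> take_steps
      (represents (?M2(PRIMAL := list_of_vec ?x', SLACK := list_of_vec ?s',
      DUAL := list_of_vec ?y', GAP := [?x' \<bullet> ?s'],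
        UNFINISHED := [if ?x' \<bullet> ?s' < 1 then 0 else 1])))"
    by (intro loop_triple_take_steps[OF dims A L]) (auto simp: memory)
  finally show ?thesis unfolding after_call_def
    by (rule loop_triple_weaken) (auto elim!: represents_mono simp: memory)
qed

definition iteration_factor :: nat where
  "iteration_factor = com_cost before_call + 1 + com_cost after_call"

lemma triple_iteration:
  assumes names: "com_names E \<subseteq> {..<K + 3}" and G: "numbered_digraph n m G" and m: "m \<ge> 1"
    and x: "x \<in> carrier_vec m" "\<And>a. a < m \<Longrightarrow> x $ a > 0"
    and dims: "y \<in> carrier_vec n" "s \<in> carrier_vec m" "f \<in> carrier_vec m" "\<pi> \<in> carrier_vec n"
    and gap: "x \<bullet> s \<noteq> 0"
    and run: "computes_in_time E (call_input n m G x s) (list_of_vec f @ list_of_vec \<pi>) t"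
    and T: "t \<le> T"
  defines "A \<equiv> incidence_mat n m G"
  shows "triple (iteration_factor * T)
    (represents (point_memory n m G x y s)) (iteration E)
    (represents (point_memory n m G (primal_step A x s f \<pi>) (y + dual_step_size A x s \<pi> \<cdot>\<^sub>v \<pi>)
      (slack_step A x s \<pi>)))"
    (is "triple _ _ _ ?Q")
proof -
  define L where "L = 4 + 3 * m + n"
  have L: "L \<le> T"
    using run T m x dims by (auto simp: computes_in_time_def length_call_input L_def)
  have hide: "hide_below (K + 3) (call_memory n m G x y s) = call_memory n m G x y s"
    by (auto simp: hide_below_def call_memory_def point_memory_def graph_memory_def)
  have "triple (com_cost before_call * L) (represents (point_memory n m G x y s)) before_call
      (\<lambda>\<sigma>. represents (call_memory n m G x y s) \<sigma> \<and>
        (\<forall>a<K + 3. \<sigma> a = initial_store (call_input n m G x s) a))"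
    using loop_triple_before_call[OF G m x dims(2) gap, of L] by (simp add: loop_triple_def L_def)
  also have "triple t \<dots> E
      (represents ((call_memory n m G x y s)(1 := list_of_vec f @ list_of_vec \<pi>)))"
    using triple_call[OF run names, of "call_memory n m G x y s"] by (simp add: hide)
  also have "triple (com_cost after_call * L) \<dots> after_call ?Q"
    using loop_triple_after_call[OF G m x(1) dims x(2), of L]
    by (simp add: loop_triple_def L_def A_def)
  finally have "triple (com_cost before_call * L + t + com_cost after_call * L)
      (represents (point_memory n m G x y s)) (iteration E) ?Q"
    unfolding iteration_def .
  moreover have "com_cost before_call * L \<le> com_cost before_call * T"
      "com_cost after_call * L \<le> com_cost after_call * T"
    using L by simp_all
  then have "com_cost before_call * L + t + com_cost after_call * L
      \<le> iteration_factor * T"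
    unfolding iteration_factor_def add_mult_distrib using T by linarith
  ultimately show ?thesis using triple_mono by blast
qed

lemma iteration_decreases_potential:
  assumes E: "certifying_electrical_flow_algorithm E CEF" and names: "com_names E \<subseteq> {..<K + 3}"
    and G: "numbered_digraph n m G" and m: "m \<ge> 1"
    and P: "interior_primal (incidence_mat n m G) b x"
    and D: "interior_dual (incidence_mat n m G) c y s"
  obtains x' y' s' where
    "interior_primal (incidence_mat n m G) b x'" and "interior_dual (incidence_mat n m G) c y' s'"
    and "potential m (real_vec x') (real_vec s')
        \<le> potential m (real_vec x) (real_vec s) - 1 / 32768"
    and "triple (iteration_factor * call_time CEF n m)
      (represents (point_memory n m G x y s)) (iteration E)
        (represents (point_memory n m G x' y' s'))"
proof -
  let ?A = "incidence_mat n m G :: rat mat" and ?u = "gradient_flow x s"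
    and ?r = "barrier_resistances x"
  let ?\<epsilon> = "call_precision m"
  have x: "x \<in> carrier_vec m" "\<And>a. a < m \<Longrightarrow> x $ a > 0"
    and s: "s \<in> carrier_vec m" "\<And>a. a < m \<Longrightarrow> s $ a > 0"
    and y: "y \<in> carrier_vec n"
    using P D by (auto simp: interior_primal_def interior_dual_def)
  have "x \<bullet> s > 0"
    unfolding scalar_prod_def using m x s by (intro sum_pos) auto
  then have gap: "x \<bullet> s \<noteq> 0" by simp
  have \<epsilon>: "?\<epsilon> > 0" using potential_parameter_pos[OF m] by simp
  obtain f \<pi> t where run:
      "computes_in_time E (call_input n m G x s) (list_of_vec f @ list_of_vec \<pi>) t"
      and time: "real t \<le> CEF n m ?\<epsilon>"
      and f: "f \<in> carrier_vec m" "?A *\<^sub>v f = ?A *\<^sub>v ?u" and \<pi>: "\<pi> \<in> carrier_vec n"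
      and energies: "residual_energy ?A x s \<pi> + energy ?r f \<le> (1 + 2 * ?\<epsilon>) * energy ?r ?u"
    unfolding call_input_def residual_energy_def
    using certifying_electrical_flow_algorithm_energy[OF E G barrier_resistances_carrier[OF x(1)]
        barrier_resistances_pos[OF x] gradient_flow_carrier[OF x(1)] \<epsilon>, of s] by metis
  have "t \<le> call_time CEF n m" using time by (simp add: call_time_def le_nat_floor)
  show thesis
    by (rule that[OF potential_step_decreases_rat[OF m incidence_mat_carrier P D f \<pi> refl refl
      energies]
        triple_iteration[OF names G m x y s(1) f(1) \<pi> gap run \<open>t \<le> call_time CEF n m\<close>]])
qed

lemma potential_real_vec_nonneg:
  assumes A: "A \<in> carrier_mat n m" and m: "m \<ge> 1" and P: "interior_primal A b x"
    and D: "interior_dual A c y s"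
    and gap: "\<not> x \<bullet> s < 1"
  shows "0 \<le> potential m (real_vec x) (real_vec s)"
proof -
  have x: "x \<in> carrier_vec m" "\<And>a. a < m \<Longrightarrow> x $ a > 0"
    and s: "s \<in> carrier_vec m" "\<And>a. a < m \<Longrightarrow> s $ a > 0"
    using P D A by (auto simp: interior_primal_def interior_dual_def)
  have "real_of_rat 1 \<le> real_of_rat (x \<bullet> s)" using gap by (simp only: of_rat_less_eq not_less)
  then show ?thesis using m x s by (intro potential_nonneg) (auto simp: scalar_prod_real_vec)
qed

definition holds_interior_point ::
    "nat \<Rightarrow> nat \<Rightarrow> (nat, nat) pre_digraph \<Rightarrow> rat vec \<Rightarrow> rat vec \<Rightarrow> (rat vec \<Rightarrow> rat vec \<Rightarrow> bool) \<Rightarrow> store \<Rightarrow>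
      bool" where
  "holds_interior_point n m G b c Q \<sigma> \<longleftrightarrow>
     (\<exists>x y s. interior_primal (incidence_mat n m G) b x \<and>
       interior_dual (incidence_mat n m G) c y s \<and>
        Q x s \<and> represents (point_memory n m G x y s) \<sigma>)"

abbreviation (input) holds_potential_below ::
    "nat \<Rightarrow> nat \<Rightarrow> (nat, nat) pre_digraph \<Rightarrow> rat vec \<Rightarrow> rat vec \<Rightarrow> real \<Rightarrow> store \<Rightarrow> bool" where
  "holds_potential_below n m G b c P \<equiv>
     holds_interior_point n m G b c (\<lambda>x s. potential m (real_vec x) (real_vec s) < P)"

lemma triple_iteration_potential_below:
  assumes E: "certifying_electrical_flow_algorithm E CEF" and names: "com_names E \<subseteq> {..<K + 3}"
    and G: "numbered_digraph n m G" and m: "m \<ge> 1"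
  shows "triple (iteration_factor * call_time CEF n m)
    (holds_potential_below n m G b c P) (iteration E)
      (holds_potential_below n m G b c (P - 1 / 32768))"
    (is "triple ?T (?holds P) _ _")
proof (rule tripleI)
  fix \<sigma> assume "?holds P \<sigma>"
  then obtain x y s where x: "interior_primal (incidence_mat n m G) b x"
    and y: "interior_dual (incidence_mat n m G) c y s"
    and below: "potential m (real_vec x) (real_vec s) < P"
    and M: "represents (point_memory n m G x y s) \<sigma>"
    by (auto simp: holds_interior_point_def)
  obtain x' y' s' where interior: "interior_primal (incidence_mat n m G) b x'"
      "interior_dual (incidence_mat n m G) c y' s'"
    and decrease: "potential m (real_vec x') (real_vec s')
        \<le> potential m (real_vec x) (real_vec s) - 1 / 32768"
    and run: "triple ?T (represents (point_memory n m G x y s)) (iteration E)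
        (represents (point_memory n m G x' y' s'))"
    by (rule iteration_decreases_potential[OF E names G m x y])
  from run M obtain t \<sigma>' where "t \<le> ?T" "exec (iteration E) \<sigma> t \<sigma>'"
    "represents (point_memory n m G x' y' s') \<sigma>'" by (rule tripleE)
  moreover have "potential m (real_vec x') (real_vec s') < P - 1 / 32768" using decrease below
    by simp
  ultimately show "\<exists>t \<sigma>'. t \<le> ?T \<and> exec (iteration E) \<sigma> t \<sigma>' \<and> ?holds (P - 1 / 32768) \<sigma>'"
    unfolding holds_interior_point_def using interior by blast
qed

lemma triple_main_loop:
  assumes E: "certifying_electrical_flow_algorithm E CEF" and names: "com_names E \<subseteq> {..<K + 3}"
    and G: "numbered_digraph n m G" and m: "m \<ge> 1"
  shows "triple ((N + 1) * (4 + iteration_factor * call_time CEF n m))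
    (holds_potential_below n m G b c (N / 32768)) (main_loop E)
    (holds_interior_point n m G b c (\<lambda>x s. x \<bullet> s < 1))"
proof -
  let ?below = "holds_potential_below n m G b c"
  let ?done = "holds_interior_point n m G b c (\<lambda>x s. x \<bullet> s < 1)"
  let ?T = "iteration_factor * call_time CEF n m"
  have "triple ((N + 1) * (1 + cost (Num 0) + cost (Var UNFINISHED) + ?T)) (?below (N / 32768))
      (WhileLess (Num 0) (Var UNFINISHED) (iteration E)) ?done"
  proof (rule triple_While)
    fix k \<sigma> assume inv: "?below (real k / 32768) \<sigma>"
    then obtain x y s where P: "interior_primal (incidence_mat n m G) b x"
      and D: "interior_dual (incidence_mat n m G) c y s"
      and below: "potential m (real_vec x) (real_vec s) < real k / 32768"
      and M: "represents (point_memory n m G x y s) \<sigma>"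
      by (auto simp: holds_interior_point_def)
    have "eval (Num 0) \<sigma> = Some 0" "eval (Var UNFINISHED) \<sigma> = Some (if x \<bullet> s < 1 then 0 else 1)"
      using M by (auto simp: representsD point_memory_def)
    moreover have "0 < k" if "\<not> x \<bullet> s < 1"
      using potential_real_vec_nonneg[OF incidence_mat_carrier m P D that] below by auto
    moreover have "?done \<sigma>" if "x \<bullet> s < 1"
      unfolding holds_interior_point_def using P D M that by blast
    ultimately show "\<exists>v w. eval (Num 0) \<sigma> = Some v \<and> eval (Var UNFINISHED) \<sigma> = Some w \<and>
        (if v < w then 0 < k \<and> ?below (real (Suc (k - 1)) / 32768) \<sigma> else ?done \<sigma>)"
      using inv by auto
  next
    fix k
    have "real (Suc k) / 32768 - 1 / 32768 = real k / 32768" by (simp add: add_divide_distrib)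
    then show "triple ?T (?below (real (Suc k) / 32768)) (iteration E) (?below (real k / 32768))"
      using triple_iteration_potential_below[OF E names G m, of b c "real (Suc k) / 32768"]
      by (simp only:)
  qed
  moreover have "1 + cost (Num 0) + cost (Var UNFINISHED) + ?T = 4 + ?T" by simp
  ultimately show ?thesis unfolding main_loop_def by (simp only:)
qed

definition time_factor :: nat where
  "time_factor = com_cost initialise + com_cost write_output + 3 + 32770 * (4 + iteration_factor)"

lemma triple_potential_reduction_algorithm:
  assumes E: "certifying_electrical_flow_algorithm E CEF" and names: "com_names E \<subseteq> {..<K + 3}"
    and G: "numbered_digraph n m G" and m: "m \<ge> 1"
    and P: "interior_primal (incidence_mat n m G) b x"
    and D: "interior_dual (incidence_mat n m G) c y s"
    and N: "potential m (real_vec x) (real_vec s) < N / 32768" and L: "n < L" "m < L"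
  shows "triple (com_cost initialise * L + (N + 1) * (4 + iteration_factor * call_time CEF n m)
      + com_cost write_output * L)
    (represents ((\<lambda>_. [])(0 := encode_digraph n m G @ list_of_vec b @ list_of_vec c
       @ list_of_vec x @ list_of_vec y @ list_of_vec s)))
    (potential_reduction_algorithm E)
    (\<lambda>\<sigma>. \<exists>x' y' s'. interior_primal (incidence_mat n m G) b x' \<and>
      interior_dual (incidence_mat n m G) c y' s' \<and>
       x' \<bullet> s' < 1 \<and> represents ((\<lambda>_. [])(1 := list_of_vec x' @ list_of_vec y' @ list_of_vec s'))
         \<sigma>)"
    (is "triple _ (represents ?input) _ ?output")
proof -
  let ?holds = "holds_interior_point n m G b c"
  let ?below = "\<lambda>x s. potential m (real_vec x) (real_vec s) < N / 32768"
  have dims: "b \<in> carrier_vec n" "c \<in> carrier_vec m" "x \<in> carrier_vec m" "y \<in> carrier_vec n"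
      "s \<in> carrier_vec m"
    using P D by (auto simp: interior_primal_def interior_dual_def intro!: carrier_vecI)
  have "loop_triple L (represents ?input) initialise (represents (point_memory n m G x y s))"
    using L by (rule loop_triple_initialise[OF dims])
  then have "triple (com_cost initialise * L) (represents ?input) initialise (?holds ?below)"
    unfolding loop_triple_def by (rule triple_mono)
      (use P D N in \<open>auto simp: holds_interior_point_def\<close>)
  also have "triple ((N + 1) * (4 + iteration_factor * call_time CEF n m))
      (?holds ?below) (main_loop E) (?holds (\<lambda>x s. x \<bullet> s < 1))"
    by (rule triple_main_loop[OF E names G m])
  also have "triple (com_cost write_output * L) (?holds (\<lambda>x s. x \<bullet> s < 1)) write_output ?output"
  proof (rule tripleI)
    fix \<sigma> assume "?holds (\<lambda>x s. x \<bullet> s < 1) \<sigma>"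
    then obtain x' y' s' where P': "interior_primal (incidence_mat n m G) b x'"
      and D': "interior_dual (incidence_mat n m G) c y' s'" and gap: "x' \<bullet> s' < 1"
      and M: "represents (point_memory n m G x' y' s') \<sigma>"
      by (auto simp: holds_interior_point_def)
    have "x' \<in> carrier_vec m" "y' \<in> carrier_vec n" "s' \<in> carrier_vec m"
      using P' D' by (auto simp: interior_primal_def interior_dual_def)
    from loop_triple_write_output[OF this L, of G] M P' D' gap
    show "\<exists>t \<sigma>'. t \<le> com_cost write_output * L \<and> exec write_output \<sigma> t \<sigma>' \<and> ?output \<sigma>'"
      unfolding loop_triple_def triple_def by blast
  qed
  finally show ?thesis unfolding potential_reduction_algorithm_def .
qed

lemma potential_reduction_time_le:
  fixes T L N :: nat and P :: real
  assumes "1 \<le> L" "L \<le> T" "N \<le> 32768 * max 1 P + 1"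
  shows "real (com_cost initialise * L + (N + 1) * (4 + iteration_factor * T)
    + com_cost write_output * L + 3 * L) \<le> time_factor * (max 1 P * T)"
proof -
  let ?M = "max 1 P" and ?c = "real (4 + iteration_factor)"
  let ?d = "real (com_cost initialise + com_cost write_output + 3)"
  have "?d * L \<le> ?d * (?M * T)"
    using assms mult_mono[of 1 ?M L T] by (intro mult_left_mono) auto
  moreover have "real (N + 1) * real (4 + iteration_factor * T)
      \<le> (32770 * ?M) * (?c * T)"
  proof (rule mult_mono)
    show "real (N + 1) \<le> 32770 * ?M" using assms(3) by simp
    show "real (4 + iteration_factor * T) \<le> ?c * T"
      using assms(1,2) by (simp add: algebra_simps)
  qed auto
  ultimately show ?thesis by (simp add: time_factor_def algebra_simps)
qed

end

lemma potential_reduction_algorithm_correct: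
  fixes CEF :: "nat \<Rightarrow> nat \<Rightarrow> rat \<Rightarrow> real" and P\<^sub>0 :: real
  assumes E: "certifying_electrical_flow_algorithm E CEF" and names: "com_names E \<subseteq> {..<K + 3}"
    and G: "numbered_digraph n m G" and m: "m \<ge> 1"
    and P: "interior_primal (incidence_mat n m G) b x"
    and D: "interior_dual (incidence_mat n m G) c y s"
    and P\<^sub>0: "potential m (real_vec x) (real_vec s) = P\<^sub>0"
  shows "\<exists>x' y' s' t.
    computes_in_time (potential_reduction_algorithm K E)
      (encode_digraph n m G @ list_of_vec b @ list_of_vec c @ list_of_vec x @ list_of_vec y @
        list_of_vec s)
      (list_of_vec x' @ list_of_vec y' @ list_of_vec s') t \<and>
    interior_primal (incidence_mat n m G) b x' \<and> interior_dual (incidence_mat n m G) c y' s' \<and>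
      x' \<bullet> s' < 1 \<and>
    real t \<le> time_factor K * (max 1 P\<^sub>0 * CEF n m (call_precision m))"
proof -
  let ?CEF = "CEF n m (call_precision m)"
  let ?ins = "encode_digraph n m G @ list_of_vec b @ list_of_vec c @ list_of_vec x @ list_of_vec y
      @ list_of_vec s"
  let ?T = "call_time CEF n m"
  define L where "L = 4 + 3 * m + n"
  define N where "N = nat \<lfloor>32768 * max 1 P\<^sub>0\<rfloor> + 1"
  have "32768 * P\<^sub>0 \<le> 32768 * max 1 P\<^sub>0" by simp
  also have "\<dots> < N" unfolding N_def by linarith
  finally have "potential m (real_vec x) (real_vec s) < N / 32768" using P\<^sub>0 by simp
  from triple_potential_reduction_algorithm[OF E names G m P D this, of L]
  obtain k x' y' s' \<sigma> where run: "exec (potential_reduction_algorithm K E) (initial_store ?ins) k \<sigma>"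
      and k: "k \<le> com_cost (initialise K) * L
        + (N + 1) * (4 + iteration_factor K * ?T) + com_cost (write_output K) * L"
      and P': "interior_primal (incidence_mat n m G) b x'"
      and D': "interior_dual (incidence_mat n m G) c y' s'"
      and gap: "x' \<bullet> s' < 1"
      and out: "represents ((\<lambda>_. [])(1 := list_of_vec x' @ list_of_vec y' @ list_of_vec s')) \<sigma>"
    using represents_initial_store[of ?ins] by (auto simp: L_def elim!: tripleE)
  let ?outs = "list_of_vec x' @ list_of_vec y' @ list_of_vec s'"
  have time_ge: "real (3 + 4 * m + 2 * n) \<le> ?CEF"
    using potential_parameter_pos[OF m] by (intro electrical_flow_time_ge[OF E G]) auto
  have "dim_vec b = n" "dim_vec c = m" "dim_vec x = m" "dim_vec y = n" "dim_vec s = m"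
      "dim_vec x' = m" "dim_vec y' = n" "dim_vec s' = m"
    using P D P' D' by (auto simp: interior_primal_def interior_dual_def)
  then have "length ?ins + length ?outs \<le> 3 * L" by (simp add: encode_digraph_def L_def)
  moreover have "real L \<le> ?CEF" using time_ge m by (simp add: L_def)
  then have "1 \<le> L" "L \<le> ?T" by (simp_all add: L_def call_time_def le_nat_floor)
  moreover have "N \<le> 32768 * max 1 P\<^sub>0 + 1" unfolding N_def by linarith
  ultimately have "real (k + length ?ins + length ?outs) \<le> time_factor K * (max 1 P\<^sub>0 * ?T)"
    using k potential_reduction_time_le[of L ?T N P\<^sub>0 K] by linarith
  also have "\<dots> \<le> time_factor K * (max 1 P\<^sub>0 * ?CEF)"
    using time_ge by (intro mult_left_mono) (auto simp: call_time_def)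
  finally show ?thesis using computes_in_timeI[OF run out] P' D' gap by blast
qed

theorem theorem4:
  fixes E :: com and CEF :: "nat \<Rightarrow> nat \<Rightarrow> rat \<Rightarrow> real"
  assumes "certifying_electrical_flow_algorithm E CEF"
  shows "\<exists>M :: com. \<exists>C :: real.
    \<forall>(n::nat) (m::nat) (G :: (nat, nat) pre_digraph)
      (b :: rat vec) (c :: rat vec) (x :: rat vec) (y :: rat vec) (s :: rat vec) (P\<^sub>0 :: real).
      m \<ge> 1 \<and> numbered_digraph n m G \<and>
      interior_primal (incidence_mat n m G) b x \<and>
      interior_dual (incidence_mat n m G) c y s \<and>
      potential m (real_vec x) (real_vec s) = P\<^sub>0 \<longrightarrow>
      (\<exists>x' y' s' t.
         computes_in_time M
           (encode_digraph n m G @ list_of_vec b @ list_of_vec c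
              @ list_of_vec x @ list_of_vec y @ list_of_vec s)
           (list_of_vec x' @ list_of_vec y' @ list_of_vec s') t \<and>
         interior_primal (incidence_mat n m G) b x' \<and>
         interior_dual (incidence_mat n m G) c y' s' \<and>
         x' \<bullet> s' < 1 \<and>
         real t \<le> C * (max 1 P\<^sub>0 * CEF n m (1 / (16 * (of_nat (potential_parameter m))\<^sup>2))))"
proof -
  obtain K where "\<forall>a \<in> com_names E. a < K"
    using finite_com_names[of E] by (auto simp: finite_nat_set_iff_bounded)
  then have "com_names E \<subseteq> {..<K + 3}" by force
  then show ?thesis
    using potential_reduction_algorithm_correct[OF assms]
    by (intro exI[of _ "potential_reduction_algorithm K E"] exI[of _ "real (time_factor K)"]) blast
qed

end
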